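(* Let $B=B^*$. Assume that the operator $L_{C,D}(0)$ is accumulative (respectively, dissipative) and $\det T_-\neq0$ (respectively, $\det T_+\neq0$), where $T_\pm:=CP_\pm+DP_\mp$. Then both conditions $\det T_+\neq0$ and $\det T_-\neq0$ are satisfied, and the system of root functions of the operator $L_{C,D}(Q)$ with $Q\in L^2([0,1];\mathbb{C}^{n\times n})$ is complete and minimal in $L^2([0,1];\mathbb{C}^n)$.
   Context: $B=\operatorname{diag}(b_1^{-1}I_{n_1},\dots,b_r^{-1}I_{n_r})\in\mathbb{C}^{n\times n}$, $n=n_1+\dots+n_r$, is a nonsingular diagonal matrix, $b_j\neq b_k$ for $j\neq k$ (real entries when $B=B^*$). $C,D\in\mathbb{C}^{n\times n}$ satisfy $\operatorname{rank}(C\ D)=n$. $P_+$ and $P_-$ are the spectral projectors of $B$ onto the positive and negative parts of its spectrum. $L_{C,D}(Q)$ is the operator in $L^2([0,1];\mathbb{C}^n)$ acting by $Ly=-iBy'+Q(x)y$ on $\{y\in W^1_2([0,1];\mathbb{C}^n): Cy(0)+Dy(1)=0\}$. An operator $T$ in a Hilbert space is accumulative (dissipative) if $\operatorname{Im}(Tf,f)\le0$ ($\ge0$) for all $f\in\operatorname{dom}(T)$. Root functions are eigenfunctions and associated functions; the system of root functions is the union, over all eigenvalues $\lambda$, of bases of the root subspaces $\operatorname{span}\{\ker(L_{C,D}(Q)-\lambda)^k: k\in\mathbb{N}\}$. A system is complete if its closed linear span is the whole space, and minimal if no element belongs to the closed linear span of the others. *)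

theory Defs
  imports "HOL-Analysis.Analysis" "HOL-Library.Function_Algebras"
begin

section \<open>Matrices\<close>

text \<open>
  The matrix \<open>diag(b\<^sub>1\<^sup>-\<^sup>1 I, \<dots>, b\<^sub>r\<^sup>-\<^sup>1 I)\<close>; \<open>blk k\<close> is the number of the block containing the index \<open>k\<close>,
  so that the size of the \<open>j\<close>-th block is the cardinality of the fibre of \<open>blk\<close> over \<open>j\<close>.
\<close>

definition block_diag :: "(nat \<Rightarrow> complex) \<Rightarrow> ('n \<Rightarrow> nat) \<Rightarrow> complex^'n^'n" where
  "block_diag b blk = (\<chi> i j. if i = j then inverse (b (blk i)) else 0)"

definition conj_transpose :: "complex^'n^'m \<Rightarrow> complex^'m^'n" where
  "conj_transpose A = (\<chi> i j. cnj (A $ j $ i))"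

definition hjoin :: "complex^'n^'m \<Rightarrow> complex^'k^'m \<Rightarrow> complex^('n + 'k)^'m" where
  "hjoin C D = (\<chi> i k. case k of Inl j \<Rightarrow> C $ i $ j | Inr j \<Rightarrow> D $ i $ j)"

text \<open>
  Meaningful for diagonalizable \<open>A\<close>: the projector onto the sum of the eigenspaces with eigenvalue
  in \<open>S\<close>, along the sum of the remaining eigenspaces.
\<close>

definition spectral_projector :: "complex^'n^'n \<Rightarrow> complex set \<Rightarrow> complex^'n^'n" where
  "spectral_projector A S =
     (THE P. \<forall>\<mu> v. A *v v = \<mu> *s v \<longrightarrow> P *v v = (if \<mu> \<in> S then v else 0))"

definition proj_pos :: "complex^'n^'n \<Rightarrow> complex^'n^'n" where
  "proj_pos B = spectral_projector B (of_real ` {0<..})"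

definition proj_neg :: "complex^'n^'n \<Rightarrow> complex^'n^'n" where
  "proj_neg B = spectral_projector B (of_real ` {..<0})"

definition T_plus :: "complex^'n^'n \<Rightarrow> complex^'n^'n \<Rightarrow> complex^'n^'n \<Rightarrow> complex^'n^'n" where
  "T_plus B C D = C ** proj_pos B + D ** proj_neg B"

definition T_minus :: "complex^'n^'n \<Rightarrow> complex^'n^'n \<Rightarrow> complex^'n^'n \<Rightarrow> complex^'n^'n" where
  "T_minus B C D = C ** proj_neg B + D ** proj_pos B"

lemma spectral_projector_diag:
  fixes d :: "'n::finite \<Rightarrow> complex"
  shows "spectral_projector (\<chi> i j. if i = j then d i else 0) S =
         (\<chi> i j. if i = j \<and> d i \<in> S then 1 else 0)"
proof -
  define A P :: "complex^'n^'n"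
    where A_def: "A = (\<chi> i j. if i = j then d i else 0)"
      and P_def: "P = (\<chi> i j. if i = j \<and> d i \<in> S then 1 else 0)"
  have A: "(A *v v) $ i = d i * v $ i" for v i
    by (simp add: A_def matrix_vector_mult_def if_distrib [of "\<lambda>x. x * _"] cong: if_cong)
  have P: "(P *v v) $ i = (if d i \<in> S then v $ i else 0)" for v i
    by (cases "d i \<in> S")
       (simp_all add: P_def matrix_vector_mult_def if_distrib [of "\<lambda>x. x * _"] cong: if_cong)
  have "spectral_projector A S = P"
    unfolding spectral_projector_def
  proof (rule the_equality)
    show "\<forall>\<mu> v. A *v v = \<mu> *s v \<longrightarrow> P *v v = (if \<mu> \<in> S then v else 0)"
    proof (intro allI impI)
      fix \<mu> v
      assume eig: "A *v v = \<mu> *s v"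
      have "v $ i = 0 \<or> d i = \<mu>" for i
        using arg_cong [OF eig, of "\<lambda>w. w $ i"] by (simp add: A)
      then show "P *v v = (if \<mu> \<in> S then v else 0)"
        by (fastforce simp: vec_eq_iff P)
    qed
  next
    fix X
    assume X: "\<forall>\<mu> v. A *v v = \<mu> *s v \<longrightarrow> X *v v = (if \<mu> \<in> S then v else 0)"
    have axis: "(M *v axis j 1) $ i = M $ i $ j" for M :: "complex^'n^'n" and i j
      by (simp add: matrix_vector_mult_def axis_def if_distrib [of "\<lambda>x. _ * x"] cong: if_cong)
    have "X $ i $ j = P $ i $ j" for i j
    proof -
      have "A *v axis j 1 = d j *s axis j 1"
        by (simp add: vec_eq_iff A axis_def)
      then have "X *v axis j 1 = (if d j \<in> S then axis j 1 else 0)"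
        using X by blast
      also have "\<dots> = P *v axis j 1"
        by (simp add: vec_eq_iff P axis_def)
      finally show ?thesis
        by (metis axis)
    qed
    then show "X = P"
      by (simp add: vec_eq_iff)
  qed
  then show ?thesis
    by (simp only: A_def P_def)
qed


section \<open>The space \<open>L\<^sup>2[0,1]\<close>\<close>

text \<open>
  Elements of \<open>L\<^sup>2\<close> are handled through representatives: functions on the real line of which only
  the restriction to the unit interval matters, up to null sets.
\<close>

definition L2 :: "(real \<Rightarrow> 'a::euclidean_space) set" where
  "L2 = {f. f \<in> borel_measurable (lebesgue_on {0..1}) \<and>
            integrable (lebesgue_on {0..1}) (\<lambda>x. (norm (f x))\<^sup>2)}"

definition l2_norm :: "(real \<Rightarrow> 'a::euclidean_space) \<Rightarrow> real" where
  "l2_norm f = sqrt (LINT x|lebesgue_on {0..1}. (norm (f x))\<^sup>2)"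

definition l2_inner :: "(real \<Rightarrow> complex^'n) \<Rightarrow> (real \<Rightarrow> complex^'n) \<Rightarrow> complex" where
  "l2_inner f g = (LINT x|lebesgue_on {0..1}. (\<Sum>i\<in>UNIV. f x $ i * cnj (g x $ i)))"

definition fscale :: "complex \<Rightarrow> (real \<Rightarrow> complex^'n) \<Rightarrow> (real \<Rightarrow> complex^'n)" where
  "fscale c f = (\<lambda>x. c *s f x)"

interpretation fun_vs: vector_space fscale
  by unfold_locales
     (auto simp: fscale_def fun_eq_iff vector_add_ldistrib vector_sadd_rdistrib vector_smult_assoc)

definition closed_span :: "(real \<Rightarrow> complex^'n) set \<Rightarrow> (real \<Rightarrow> complex^'n) set" where
  "closed_span S = {f \<in> L2. \<forall>\<epsilon>>0. \<exists>g\<in>fun_vs.span S. l2_norm (f - g) < \<epsilon>}"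

definition complete_system :: "(real \<Rightarrow> complex^'n) set \<Rightarrow> bool" where
  "complete_system S \<longleftrightarrow> closed_span S = L2"

text \<open>
  Here distinct functions in \<open>S\<close> are meant to be distinct as elements of \<open>L\<^sup>2\<close>; this holds for
  functions in the domain of the operator below.
\<close>

definition minimal_system :: "(real \<Rightarrow> complex^'n) set \<Rightarrow> bool" where
  "minimal_system S \<longleftrightarrow> (\<forall>f\<in>S. f \<notin> closed_span (S - {f}))"


section \<open>Operators\<close>

text \<open>
  \<open>W12 y y'\<close>: on the unit interval \<open>y\<close> is the absolutely continuous representative of an element
  of \<open>W\<^sup>1\<^sub>2\<close>, and \<open>y'\<close> represents its derivative.
\<close>

definition W12 :: "(real \<Rightarrow> complex^'n) \<Rightarrow> (real \<Rightarrow> complex^'n) \<Rightarrow> bool" where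
  "W12 y y' \<longleftrightarrow> y' \<in> L2 \<and> (\<forall>x\<in>{0..1}. y x = y 0 + (LINT t|lebesgue_on {0..x}. y' t))"

type_synonym 'n op = "((real \<Rightarrow> complex^'n) \<times> (real \<Rightarrow> complex^'n)) set"

text \<open>
  The operator \<open>L\<^sub>C\<^sub>,\<^sub>D(Q)\<close> as a graph. Each element \<open>y\<close> of its domain is given by a unique
  representative, the one that is continuous on the unit interval and vanishes outside; hence linear
  independence and equality of domain elements as functions and in \<open>L\<^sup>2\<close> agree. Its value is
  given by all representatives \<open>f\<close> of the class of \<open>-iBy' + Qy\<close>.
\<close>

definition L_op :: "complex^'n^'n \<Rightarrow> complex^'n^'n \<Rightarrow> complex^'n^'n \<Rightarrow>
    (real \<Rightarrow> complex^'n^'n) \<Rightarrow> 'n op" where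
  "L_op B C D Q = {(y, f). \<exists>y'. W12 y y' \<and> (\<forall>x. x \<notin> {0..1} \<longrightarrow> y x = 0) \<and>
      C *v y 0 + D *v y 1 = 0 \<and> f \<in> L2 \<and>
      (AE x in lebesgue_on {0..1}. f x = (- \<i>) *s (B *v y' x) + Q x *v y x)}"

definition accumulative :: "'n::finite op \<Rightarrow> bool" where
  "accumulative T \<longleftrightarrow> (\<forall>(f, Tf)\<in>T. Im (l2_inner Tf f) \<le> 0)"

definition dissipative :: "'n::finite op \<Rightarrow> bool" where
  "dissipative T \<longleftrightarrow> (\<forall>(f, Tf)\<in>T. Im (l2_inner Tf f) \<ge> 0)"

definition op_shift :: "'n::finite op \<Rightarrow> complex \<Rightarrow> 'n op" where
  "op_shift T z = {(y, f - fscale z y) |y f. (y, f) \<in> T}"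

definition op_ker :: "'n::finite op \<Rightarrow> (real \<Rightarrow> complex^'n) set" where
  "op_ker T = {y. (y, 0) \<in> T}"

definition eigenvalue :: "'n::finite op \<Rightarrow> complex \<Rightarrow> bool" where
  "eigenvalue T z \<longleftrightarrow> op_ker (op_shift T z) \<noteq> {0}"

text \<open>
  Powers of operators are powers of graphs under relational composition, which yields the maximal
  domain of the iterated operator.
\<close>

definition root_subspace :: "'n::finite op \<Rightarrow> complex \<Rightarrow> (real \<Rightarrow> complex^'n) set" where
  "root_subspace T z = fun_vs.span (\<Union>k::nat. op_ker (op_shift T z ^^ k))"

definition root_system :: "'n::finite op \<Rightarrow> (real \<Rightarrow> complex^'n) set \<Rightarrow> bool" where
  "root_system T S \<longleftrightarrow> (\<exists>bas. S = (\<Union>z\<in>{z. eigenvalue T z}. bas z) \<and>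
     (\<forall>z. eigenvalue T z \<longrightarrow>
        fun_vs.independent (bas z) \<and> fun_vs.span (bas z) = root_subspace T z))"

end

theory Submission
  imports Defs "HOL-Complex_Analysis.Complex_Analysis"
begin

text \<open>
  The form \<open>Im (L\<^sub>C\<^sub>,\<^sub>D(0) y, y)\<close> depends only on the boundary values of \<open>y\<close> and is definite on those of the
  shape \<open>(P\<^sub>+v, P\<^sub>-v)\<close> and \<open>(P\<^sub>-v, P\<^sub>+v)\<close>; so accumulativity excludes a kernel of \<open>T\<^sub>+\<close>, and dissipativity one of
  \<open>T\<^sub>-\<close>.

  By Duhamel's formula and \<open>\<integral> exp (- s (x - t)) p(t) dt \<le> \<parallel>p\<parallel> / sqrt (2 s)\<close>, a potential in \<open>L\<^sup>2\<close> is a small perturbation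
  far away from the real axis, and the invertibility of \<open>T\<^sub>\<plusminus>\<close> bounds the resolvent there by a multiple of
  \<open>\<bar>Im \<zeta>\<bar> powr (- 1 / 2)\<close>.

  Completeness: let \<open>\<phi>\<close> be a continuous functional that vanishes on all root functions. The resolvent at \<open>\<zeta>\<close> is
  a quotient with the characteristic determinant \<open>\<Delta>\<close> as denominator, and at a zero of \<open>\<Delta>\<close> the Taylor
  coefficients of its numerator below the order of the zero are root functions. Hence \<open>\<phi>\<close> of the resolvent is
  entire. It is a quotient of functions bounded on horizontal strips, hence bounded there by a normal family
  argument; by Liouville's theorem and the decay away from the real axis it vanishes, that is, \<open>\<phi>\<close> vanishes on
  the dense range of the resolvent.

  Minimality: the contour integrals of \<open>(\<zeta> - \<zeta>\<^sub>0) ^ j\<close> times the resolvent around an eigenvalue \<open>\<zeta>\<^sub>0\<close>, evaluated at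
  \<open>x = 0\<close>, are continuous functionals that vanish on the root subspaces of the other eigenvalues; finitely many
  of them separate the points of the root subspace of \<open>\<zeta>\<^sub>0\<close>.
\<close>

unbundle no fps_syntax

section \<open>Square integrable functions\<close>

text \<open>The potential is merely square integrable, so asymptotic formulas for solutions are not
  at hand. Their place is taken by bounds that depend on \<open>Im \<zeta>\<close> only. Uniformity
  in \<open>Re \<zeta>\<close> is what makes horizontal translates of \<open>\<Delta>\<close> a
  normal family and lets Liouville's theorem suffice.

  The two matrices divide the plane between them. Component \<open>i\<close> behaves like exp (\<i>
  b_i \<zeta> x), with 1 / b_i the i-th diagonal entry of B. For \<open>Im \<zeta> > 0\<close> the
  components with b_i > 0 decay away from 0 and the others away from 1. Up to small errors only
  their values at those ends enter the boundary condition, and the matrix acting on them is T_+. In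
  the lower half plane the ends are exchanged and T_- appears.

  Holomorphy in \<zeta> is asserted only for scalar functionals of solutions. Their Taylor
  coefficients are functionals of explicit functions, built from powers of a Volterra operator; this
  is how root functions are recognised in them.\<close>

lemma L2_iff:
  "f \<in> L2 \<longleftrightarrow> f \<in> borel_measurable (lebesgue_on {0..1}) \<and>
    integrable (lebesgue_on {0..1}) (\<lambda>x. (norm (f x))\<^sup>2)"
  by (simp add: L2_def)

lemma L2_measurable [measurable_dest]: "f \<in> L2 \<Longrightarrow> f \<in> borel_measurable (lebesgue_on {0..1})"
  by (simp add: L2_iff)

lemma L2_square_integrable: "f \<in> L2 \<Longrightarrow> integrable (lebesgue_on {0..1}) (\<lambda>x. (norm (f x))\<^sup>2)"
  by (simp add: L2_iff)

lemma L2_bound: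
  fixes f :: "real \<Rightarrow> 'a::euclidean_space" and g :: "real \<Rightarrow> 'b::euclidean_space"
  assumes g: "g \<in> L2" and [measurable]: "f \<in> borel_measurable (lebesgue_on {0..1})"
    and le: "\<And>x. x \<in> {0..1} \<Longrightarrow> norm (f x) \<le> c * norm (g x)"
  shows "f \<in> L2"
  unfolding L2_iff
proof (rule conjI [OF _ Bochner_Integration.integrable_bound [OF _ _ AE_I2]])
  show "integrable (lebesgue_on {0..1}) (\<lambda>x. c\<^sup>2 * (norm (g x))\<^sup>2)"
    using g by (simp add: L2_iff)
  show "norm ((norm (f x))\<^sup>2) \<le> norm (c\<^sup>2 * (norm (g x))\<^sup>2)" if "x \<in> space (lebesgue_on {0..1})" for x
    using power_mono [OF le, of x 2] that by (simp add: power_mult_distrib)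
qed measurable

lemma L2_bounded_linear:
  fixes f :: "real \<Rightarrow> 'a::euclidean_space" and T :: "'a \<Rightarrow> 'b::euclidean_space"
  assumes T: "bounded_linear T" and f: "f \<in> L2"
  shows "(\<lambda>x. T (f x)) \<in> L2"
proof -
  interpret bounded_linear T by (rule T)
  obtain K where "\<And>x. norm (T x) \<le> norm x * K"
    using bounded by blast
  then show ?thesis
    using measurable_compose [OF L2_measurable [OF f]
        borel_measurable_continuous_onI [OF linear_continuous_on [OF T]]]
    by (intro L2_bound [OF f, of _ K]) (simp_all add: mult.commute)
qed

lemma L2_add:
  fixes f g :: "real \<Rightarrow> 'a::euclidean_space"
  assumes f: "f \<in> L2" and g: "g \<in> L2"
  shows "(\<lambda>x. f x + g x) \<in> L2"
  unfolding L2_iff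
proof (rule conjI [OF _ Bochner_Integration.integrable_bound [OF _ _ AE_I2]])
  note [measurable] = L2_measurable [OF f] L2_measurable [OF g]
  show "integrable (lebesgue_on {0..1}) (\<lambda>x. 2 * (norm (f x))\<^sup>2 + 2 * (norm (g x))\<^sup>2)"
    using f g by (simp add: L2_iff)
  show "(\<lambda>x. f x + g x) \<in> borel_measurable (lebesgue_on {0..1})"
    "(\<lambda>x. (norm (f x + g x))\<^sup>2) \<in> borel_measurable (lebesgue_on {0..1})"
    by measurable
  show "norm ((norm (f x + g x))\<^sup>2) \<le> norm (2 * (norm (f x))\<^sup>2 + 2 * (norm (g x))\<^sup>2)" for x
  proof -
    have "(norm (f x + g x))\<^sup>2 \<le> (norm (f x) + norm (g x))\<^sup>2"
      by (intro power_mono norm_triangle_ineq norm_ge_zero)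
    also have "\<dots> \<le> 2 * (norm (f x))\<^sup>2 + 2 * (norm (g x))\<^sup>2"
      using zero_le_power2 [of "norm (f x) - norm (g x)"] by (simp add: power2_sum power2_diff)
    finally show ?thesis by simp
  qed
qed

lemma L2_zero [simp]: "0 \<in> L2" "(\<lambda>x. 0) \<in> L2"
  by (auto simp: L2_iff zero_fun_def)

lemma L2_uminus: "f \<in> L2 \<Longrightarrow> (\<lambda>x. - f x) \<in> L2"
  by (rule L2_bounded_linear [OF bounded_linear_minus [OF bounded_linear_ident]])

lemma L2_diff: "f \<in> L2 \<Longrightarrow> g \<in> L2 \<Longrightarrow> (\<lambda>x. f x - g x) \<in> L2"
  using L2_add [OF _ L2_uminus] by fastforce

lemma bounded_linear_smult: "bounded_linear ((*s) (c::complex) :: complex^'n \<Rightarrow> _)"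
proof (rule bounded_linear_intro [of _ "norm c"])
  show "c *s (r *\<^sub>R x) = r *\<^sub>R (c *s x)" for r and x :: "complex^'n"
    by (simp add: vec_eq_iff)
  show "norm (c *s x) \<le> norm x * norm c" for x :: "complex^'n"
    by (simp add: norm_vec_def norm_mult L2_set_right_distrib mult.commute)
qed (simp add: vector_add_ldistrib)

lemma norm_smult: "norm (c *s x) = norm (c::complex) * norm (x :: complex^'n)"
  by (simp add: norm_vec_def norm_mult L2_set_right_distrib)

lemma bounded_linear_matrix_vector: "bounded_linear ((*v) (A :: complex^'n^'m))"
proof -
  have "linear ((*v) A)"
    by (rule linearI) (simp_all add: matrix_vector_mult_def vec_eq_iff sum.distrib ring_distribs
        scaleR_sum_right)
  then show ?thesis
    by (simp add: linear_conv_bounded_linear)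
qed

lemma L2_fscale: "f \<in> L2 \<Longrightarrow> fscale c f \<in> L2"
  unfolding fscale_def by (rule L2_bounded_linear [OF bounded_linear_smult])

lemma L2_fplus: "f \<in> L2 \<Longrightarrow> g \<in> L2 \<Longrightarrow> f + g \<in> L2"
  using L2_add by (simp add: plus_fun_def)

lemma L2_fdiff: "f \<in> L2 \<Longrightarrow> g \<in> L2 \<Longrightarrow> f - g \<in> L2"
  using L2_diff by (simp add: fun_diff_def)

lemma subspace_L2: "fun_vs.subspace L2"
  by (simp add: fun_vs.subspace_def L2_fplus L2_fscale)

lemma continuous_imp_L2:
  assumes "continuous_on {0..1} f"
  shows "f \<in> L2"
proof -
  have "continuous_on {0..1} (\<lambda>x. (norm (f x))\<^sup>2)"
    by (intro continuous_intros assms)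
  then show ?thesis
    using assms
    by (auto simp: L2_iff continuous_imp_integrable_real continuous_imp_measurable_on_sets_lebesgue)
qed

lemma L2_norm: "f \<in> L2 \<Longrightarrow> (\<lambda>x. norm (f x)) \<in> L2"
  by (auto simp: L2_iff)

lemma integrable_norm_mult:
  assumes f: "f \<in> L2" and g: "g \<in> L2"
  shows "integrable (lebesgue_on {0..1}) (\<lambda>x. norm (f x) * norm (g x))"
proof (rule Bochner_Integration.integrable_bound [OF _ _ AE_I2])
  note [measurable] = L2_measurable [OF f] L2_measurable [OF g]
  show "integrable (lebesgue_on {0..1}) (\<lambda>x. (norm (f x))\<^sup>2 + (norm (g x))\<^sup>2)"
    using f g by (simp add: L2_iff)
  show "(\<lambda>x. norm (f x) * norm (g x)) \<in> borel_measurable (lebesgue_on {0..1})"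
    by measurable
  show "norm (norm (f x) * norm (g x)) \<le> norm ((norm (f x))\<^sup>2 + (norm (g x))\<^sup>2)" for x
  proof -
    have "0 \<le> norm (f x) * norm (g x)" by simp
    with sum_squares_bound [of "norm (f x)" "norm (g x)"]
    have "norm (f x) * norm (g x) \<le> (norm (f x))\<^sup>2 + (norm (g x))\<^sup>2" by linarith
    then show ?thesis by simp
  qed
qed

section \<open>Inequalities for the norm of L2\<close>

lemma l2_norm_nonneg [simp]: "0 \<le> l2_norm f"
  by (simp add: l2_norm_def)

lemma l2_norm_power2: "(l2_norm f)\<^sup>2 = (LINT x|lebesgue_on {0..1}. (norm (f x))\<^sup>2)"
  by (simp add: l2_norm_def)

lemma l2_norm_norm [simp]: "l2_norm (\<lambda>x. norm (f x)) = l2_norm f"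
  by (simp add: l2_norm_def)

text \<open>The pointwise inequality 2xy \<le> t x^2 + y^2 / t is integrated and \<open>t\<close> is
  chosen close to the quotient of the two norms.\<close>

lemma Cauchy_Schwarz_L2:
  assumes f: "f \<in> L2" and g: "g \<in> L2"
  shows "(LINT x|lebesgue_on {0..1}. norm (f x) * norm (g x)) \<le> l2_norm f * l2_norm g"
proof -
  define I where "I = (LINT x|lebesgue_on {0..1}. norm (f x) * norm (g x))"
  have key: "2 * I \<le> t * (l2_norm f)\<^sup>2 + inverse t * (l2_norm g)\<^sup>2" if "t > 0" for t
  proof -
    have "2 * I = (LINT x|lebesgue_on {0..1}. 2 * (norm (f x) * norm (g x)))"
      by (simp add: I_def)
    also have "\<dots> \<le> (LINT x|lebesgue_on {0..1}. t * (norm (f x))\<^sup>2 + inverse t * (norm (g x))\<^sup>2)"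
    proof (rule integral_mono)
      show "2 * (norm (f x) * norm (g x)) \<le> t * (norm (f x))\<^sup>2 + inverse t * (norm (g x))\<^sup>2" for x
      proof -
        define s where "s = sqrt t"
        then have s: "s \<noteq> 0" "t = s\<^sup>2" using that by auto
        have "0 \<le> (s * norm (f x) - inverse s * norm (g x))\<^sup>2" by simp
        also have "\<dots> = t * (norm (f x))\<^sup>2 + inverse t * (norm (g x))\<^sup>2 - 2 * (norm (f x) * norm (g x))"
          using s by (simp add: power2_eq_square field_simps)
        finally show ?thesis by simp
      qed
    qed (use f g in \<open>auto simp: L2_iff intro!: integrable_norm_mult integrable_mult_right Bochner_Integration.integrable_add\<close>)
    also have "\<dots> = t * (l2_norm f)\<^sup>2 + inverse t * (l2_norm g)\<^sup>2"
      using f g by (simp add: L2_iff l2_norm_power2)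
    finally show ?thesis .
  qed
  define u v where "u = l2_norm f" and "v = l2_norm g"
  have uv: "0 \<le> u" "0 \<le> v" by (auto simp: u_def v_def)
  have "I \<le> u * v"
  proof (rule field_le_epsilon)
    fix e :: real assume e: "0 < e"
    \<comment> \<open>Both norms are shifted by \<open>d\<close>, so that the quotient (v + d) / (u
      + d) is defined and positive even if a norm vanishes; the size of \<open>d\<close> keeps the
      loss below \<open>2 * e\<close>.\<close>
    define d where "d = e / (u + v + e + 1)"
    have d: "0 < d" "d * (u + v + d) \<le> 2 * e"
    proof -
      show "0 < d" using e uv by (simp add: d_def)
      have "d \<le> e" "d * (u + v + e + 1) = e"
        using e uv by (auto simp: d_def field_simps)
      then have "d * (u + v + d) \<le> d * (u + v + e + 1)"
        using \<open>0 < d\<close> by (intro mult_left_mono) auto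
      then show "d * (u + v + d) \<le> 2 * e"
        using \<open>d * (u + v + e + 1) = e\<close> e by simp
    qed
    have t: "0 < (v + d) / (u + d)" using uv d by (simp add: add_nonneg_pos)
    have "2 * I \<le> (v + d) / (u + d) * u\<^sup>2 + inverse ((v + d) / (u + d)) * v\<^sup>2"
      using key [OF t] by (simp add: u_def v_def)
    also have "\<dots> \<le> (v + d) * u + (u + d) * v"
    proof -
      have "u\<^sup>2 / (u + d) \<le> u" "v\<^sup>2 / (v + d) \<le> v"
        using uv d by (auto simp: divide_simps power2_eq_square algebra_simps add_nonneg_pos)
      then have "(v + d) * (u\<^sup>2 / (u + d)) \<le> (v + d) * u" "(u + d) * (v\<^sup>2 / (v + d)) \<le> (u + d) * v"
        using uv d by (simp_all only: mult_left_mono add_nonneg_nonneg less_imp_le)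
      then show ?thesis by simp
    qed
    also have "\<dots> = 2 * (u * v) + d * (u + v)" by (simp add: algebra_simps)
    finally show "I \<le> u * v + e"
      using d by (smt (verit) mult_left_mono)
  qed
  then show ?thesis by (simp add: I_def u_def v_def)
qed

lemma l2_norm_triangle:
  assumes f: "f \<in> L2" and g: "g \<in> L2"
  shows "l2_norm (\<lambda>x. f x + g x) \<le> l2_norm f + l2_norm g"
proof (rule power2_le_imp_le)
  have "(l2_norm (\<lambda>x. f x + g x))\<^sup>2 \<le>
    (LINT x|lebesgue_on {0..1}. (norm (f x))\<^sup>2 + 2 * (norm (f x) * norm (g x)) + (norm (g x))\<^sup>2)"
    unfolding l2_norm_power2
  proof (rule integral_mono)
    show "(norm (f x + g x))\<^sup>2 \<le> (norm (f x))\<^sup>2 + 2 * (norm (f x) * norm (g x)) + (norm (g x))\<^sup>2" for x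
      using power_mono [OF norm_triangle_ineq [of "f x" "g x"], of 2] by (simp add: power2_sum)
  qed (use f g L2_add [OF f g] in \<open>auto simp: L2_iff intro!: integrable_norm_mult integrable_mult_right Bochner_Integration.integrable_add\<close>)
  also have "\<dots> = (l2_norm f)\<^sup>2 + 2 * (LINT x|lebesgue_on {0..1}. norm (f x) * norm (g x)) + (l2_norm g)\<^sup>2"
    using f g integrable_norm_mult [OF f g] by (simp add: L2_iff l2_norm_power2)
  also have "\<dots> \<le> (l2_norm f + l2_norm g)\<^sup>2"
    using Cauchy_Schwarz_L2 [OF f g] by (simp add: power2_sum)
  finally show "(l2_norm (\<lambda>x. f x + g x))\<^sup>2 \<le> (l2_norm f + l2_norm g)\<^sup>2" .
qed simp

lemma l2_norm_mono:
  assumes g: "g \<in> L2" and f: "f \<in> borel_measurable (lebesgue_on {0..1})"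
    and le: "\<And>x. x \<in> {0..1} \<Longrightarrow> norm (f x) \<le> c * norm (g x)" and c: "0 \<le> c"
  shows "l2_norm f \<le> c * l2_norm g"
proof -
  have "f \<in> L2" by (rule L2_bound [OF g f le])
  have "(l2_norm f)\<^sup>2 \<le> (LINT x|lebesgue_on {0..1}. c\<^sup>2 * (norm (g x))\<^sup>2)"
    unfolding l2_norm_power2
  proof (rule integral_mono)
    show "(norm (f x))\<^sup>2 \<le> c\<^sup>2 * (norm (g x))\<^sup>2" if "x \<in> space (lebesgue_on {0..1})" for x
      using power_mono [OF le, of x 2] that by (simp add: power_mult_distrib)
  qed (use g \<open>f \<in> L2\<close> in \<open>auto simp: L2_iff\<close>)
  also have "\<dots> = (c * l2_norm g)\<^sup>2"
    by (simp add: power_mult_distrib l2_norm_power2)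
  finally show ?thesis
    by (rule power2_le_imp_le) (simp add: c)
qed

lemma L2_const: "(\<lambda>x. c) \<in> L2"
  by (simp add: continuous_imp_L2)

lemma l2_norm_const: "l2_norm (\<lambda>x. c) = norm c"
  by (simp add: l2_norm_def measure_restrict_space)

lemma l2_norm_le_sup:
  assumes f: "f \<in> borel_measurable (lebesgue_on {0..1})" and le: "\<And>x. x \<in> {0..1} \<Longrightarrow> norm (f x) \<le> M"
  shows "l2_norm f \<le> M"
proof -
  have "0 \<le> M" using le [of 0] norm_ge_zero [of "f 0"] by (simp del: norm_ge_zero)
  then have "l2_norm f \<le> M * l2_norm (\<lambda>x. 1::real)"
    using le by (intro l2_norm_mono L2_const f) auto
  then show ?thesis by (simp add: l2_norm_const)
qed

lemma L2_integrable:
  assumes "f \<in> L2"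
  shows "integrable (lebesgue_on {0..1}) f"
  using integrable_norm_mult [OF assms L2_const [of "1::real"]] assms
  by (simp add: integrable_norm_iff L2_measurable)

lemma L2_absolutely_integrable:
  "f \<in> L2 \<Longrightarrow> f absolutely_integrable_on {0..1}"
  using L2_integrable absolutely_integrable_on_def
  by (simp add: set_integrable_def integrable_restrict_space)

lemma integral_norm_le_l2:
  assumes "f \<in> L2"
  shows "integral {0..1} (\<lambda>x. norm (f x)) \<le> l2_norm f"
proof -
  have "integral {0..1} (\<lambda>x. norm (f x)) = (LINT x|lebesgue_on {0..1}. norm (f x))"
    using L2_integrable [OF L2_norm [OF assms]] by (simp add: lebesgue_integral_eq_integral)
  then show ?thesis
    using Cauchy_Schwarz_L2 [OF assms L2_const [of "1::real"]] by (simp add: l2_norm_const)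
qed

lemma l2_norm_square_integral:
  assumes "f \<in> L2"
  shows "((\<lambda>x. (norm (f x))\<^sup>2) has_integral (l2_norm f)\<^sup>2) {0..1}"
  unfolding l2_norm_power2 using assms
  by (intro has_integral_integral_lebesgue_on) (auto simp: L2_iff)

lemma l2_norm_tendsto_0:
  fixes f :: "nat \<Rightarrow> real \<Rightarrow> 'a::euclidean_space" and g :: "real \<Rightarrow> 'b::euclidean_space"
  assumes g: "g \<in> L2" and f: "\<And>n. f n \<in> borel_measurable (lebesgue_on {0..1})"
    and lim: "AE x in lebesgue_on {0..1}. (\<lambda>n. f n x) \<longlonglongrightarrow> 0"
    and le: "\<And>n x. x \<in> {0..1} \<Longrightarrow> norm (f n x) \<le> norm (g x)"
  shows "(\<lambda>n. l2_norm (f n)) \<longlonglongrightarrow> 0"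
proof -
  note [measurable] = f
  have "(\<lambda>n. LINT x|lebesgue_on {0..1}. (norm (f n x))\<^sup>2) \<longlonglongrightarrow> (LINT x|lebesgue_on {0..1::real}. (0::real))"
  proof (rule integral_dominated_convergence [where w = "\<lambda>x. (norm (g x))\<^sup>2"])
    show "integrable (lebesgue_on {0..1}) (\<lambda>x. (norm (g x))\<^sup>2)"
      using g by (simp add: L2_iff)
    show "AE x in lebesgue_on {0..1}. (\<lambda>n. (norm (f n x))\<^sup>2) \<longlonglongrightarrow> 0"
      using lim
    proof eventually_elim
      case (elim x)
      from tendsto_power [OF tendsto_norm [OF this], of 2] show ?case by simp
    qed
    show "AE x in lebesgue_on {0..1}. norm ((norm (f n x))\<^sup>2) \<le> (norm (g x))\<^sup>2" for n
      by (rule AE_I2) (use le in \<open>auto intro!: power_mono\<close>)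
  qed auto
  from tendsto_real_sqrt [OF this] show ?thesis
    by (simp add: l2_norm_def)
qed

text \<open>The function is truncated in its values, and the truncation is approximated almost
  everywhere by continuous functions truncated at the same level. Both limits are instances of
  dominated convergence.\<close>

lemma continuous_dense_L2:
  fixes g :: "real \<Rightarrow> 'a::euclidean_space"
  assumes g: "g \<in> L2" and e: "0 < e"
  obtains k where "continuous_on UNIV k" "l2_norm (\<lambda>x. g x - k x) < e"
proof -
  \<comment> \<open>The nearest-point map onto a ball is a continuous truncation: it is the identity
    on the ball, and it moves \<open>v\<close> by at most \<open>norm v\<close>, which supplies the
    dominating function.\<close>
  define c where "c = (\<lambda>N::nat. closest_point (cball (0::'a) (real N)))"
  have contc: "continuous_on A (c N)" for A N
    unfolding c_def by (rule continuous_on_closest_point) auto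
  have cN: "norm (c N v) \<le> real N" for N v
    using closest_point_in_set [of "cball (0::'a) (real N)" v] by (simp add: c_def)
  have c_le: "norm (v - c N v) \<le> norm v" for N v
    using closest_point_le [of "cball (0::'a) (real N)" 0 v] by (simp add: c_def dist_norm)
  have c_eq: "c N v = v" if "norm v \<le> real N" for N v
    unfolding c_def using that by (intro closest_point_self) simp
  note gm [measurable] = L2_measurable [OF g]
  have [measurable]: "c N \<in> borel_measurable borel" for N
    by (intro borel_measurable_continuous_onI contc)
  have "(\<lambda>N. l2_norm (\<lambda>x. g x - c N (g x))) \<longlonglongrightarrow> 0"
  proof (rule l2_norm_tendsto_0 [OF g])
    show "AE x in lebesgue_on {0..1}. (\<lambda>N. g x - c N (g x)) \<longlonglongrightarrow> 0"
    proof (rule AE_I2)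
      fix x
      have "\<forall>\<^sub>F N in sequentially. g x - c N (g x) = 0"
        by (rule eventually_sequentiallyI [of "nat \<lceil>norm (g x)\<rceil>"]) (simp add: c_eq nat_ceiling_le_eq)
      then show "(\<lambda>N. g x - c N (g x)) \<longlonglongrightarrow> 0"
        by (rule tendsto_eventually)
    qed
  qed (use c_le in auto)
  then obtain N where N: "l2_norm (\<lambda>x. g x - c N (g x)) < e / 2"
    using order_tendstoD(2) [of _ 0 sequentially "e / 2"] e
    unfolding eventually_sequentially by (meson half_gt_zero order_refl)
  have "g measurable_on {0..1}"
    by (simp add: measurable_on_iff_borel_measurable gm)
  \<comment> \<open>Measurability yields continuous functions that converge off a null set but are
    not dominated; composing them with \<open>c N\<close> bounds them by \<open>N\<close> and keeps
    them continuous.\<close>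
  then obtain Z k where Z: "negligible Z" and k: "\<And>n. continuous_on UNIV (k n)"
    and lim: "\<And>x. x \<notin> Z \<Longrightarrow> (\<lambda>n. k n x) \<longlonglongrightarrow> (if x \<in> {0..1} then g x else 0)"
    unfolding measurable_on_def by blast
  have ck: "continuous_on A (\<lambda>x. c N (k n x))" for n A
    by (rule continuous_on_compose2 [OF contc [of UNIV]]) (auto intro: continuous_on_subset [OF k])
  have ckm [measurable]: "(\<lambda>x. c N (k n x)) \<in> borel_measurable (lebesgue_on {0..1})" for n
    by (rule L2_measurable [OF continuous_imp_L2 [OF ck]])
  have "(\<lambda>n. l2_norm (\<lambda>x. c N (g x) - c N (k n x))) \<longlonglongrightarrow> 0"
  proof (rule l2_norm_tendsto_0 [OF L2_const [of "2 * real N"]])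
    have "AE x in lebesgue. x \<notin> Z"
      using Z by (simp add: negligible_iff_null_sets AE_not_in)
    then have "AE x in lebesgue_on {0..1}. x \<notin> Z"
      by (auto simp: AE_restrict_space_iff)
    then show "AE x in lebesgue_on {0..1}. (\<lambda>n. c N (g x) - c N (k n x)) \<longlonglongrightarrow> 0"
    proof (rule AE_mp, intro AE_I2 impI)
      fix x assume x: "x \<in> space (lebesgue_on {0..1})" "x \<notin> Z"
      have "(\<lambda>n. c N (k n x)) \<longlonglongrightarrow> c N (g x)"
        using lim [OF x(2)] x(1) contc [of UNIV N] by (intro isCont_tendsto_compose [where g = "c N"])
          (auto simp: continuous_on_eq_continuous_at)
      then show "(\<lambda>n. c N (g x) - c N (k n x)) \<longlonglongrightarrow> 0"
        using tendsto_diff [OF tendsto_const [of "c N (g x)"]] by fastforce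
    qed
    show "norm (c N (g x) - c N (k n x)) \<le> norm (2 * real N)" for n x
      using norm_triangle_ineq4 [of "c N (g x)" "c N (k n x)"] cN [of N "g x"] cN [of N "k n x"] by simp
  qed measurable
  then obtain n where n: "l2_norm (\<lambda>x. c N (g x) - c N (k n x)) < e / 2"
    using order_tendstoD(2) [of _ 0 sequentially "e / 2"] e
    unfolding eventually_sequentially by (meson half_gt_zero order_refl)
  have L: "(\<lambda>x. c N (g x)) \<in> L2"
    by (rule L2_bound [OF L2_const [of "real N"], of _ 1]) (use cN in auto)
  have "l2_norm (\<lambda>x. (g x - c N (g x)) + (c N (g x) - c N (k n x))) < e"
    using l2_norm_triangle [OF L2_diff [OF g L] L2_diff [OF L continuous_imp_L2 [OF ck [of _ n]]]] N n by linarith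
  then show thesis
    using that [OF ck [of UNIV]] by simp
qed

section \<open>Duhamel's formula and its bounds\<close>

lemma L2_absolutely_integrable_sub:
  assumes "f \<in> L2" "{a..b} \<subseteq> {0..1}"
  shows "f absolutely_integrable_on {a..b}"
  using L2_absolutely_integrable [OF assms(1)] by (rule set_integrable_subset) (use assms(2) in auto)

lemma L2_integrable_on:
  assumes "f \<in> L2" "{a..b} \<subseteq> {0..1}"
  shows "f integrable_on {a..b}"
  using L2_absolutely_integrable_sub [OF assms] by (rule set_lebesgue_integral_eq_integral(1))

lemma L2_mult_continuous:
  fixes f :: "real \<Rightarrow> 'a::{euclidean_space, real_normed_field}"
  assumes e: "continuous_on {0..1} e" and f: "f \<in> L2"
  shows "(\<lambda>x. e x * f x) \<in> L2"
proof -
  have "bounded (e ` {0..1})"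
    by (intro compact_imp_bounded compact_continuous_image e) simp
  then obtain K where K: "\<And>x. x \<in> {0..1} \<Longrightarrow> norm (e x) \<le> K"
    unfolding bounded_iff by blast
  note [measurable] = L2_measurable [OF f] L2_measurable [OF continuous_imp_L2 [OF e]]
  show ?thesis
    using K by (intro L2_bound [OF f, of _ K]) (auto simp: norm_mult intro!: mult_right_mono)
qed

lemma norm_integral_le_l2:
  fixes f :: "real \<Rightarrow> 'a::euclidean_space"
  assumes f: "f \<in> L2" and ab: "{a..b} \<subseteq> {0..1}"
  shows "norm (integral {a..b} f) \<le> l2_norm f"
proof -
  have "norm (integral {a..b} f) \<le> integral {a..b} (\<lambda>x. norm (f x))"
    using L2_integrable_on [OF f ab] L2_integrable_on [OF L2_norm [OF f] ab]
    by (rule integral_norm_bound_integral) simp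
  also have "\<dots> \<le> integral {0..1} (\<lambda>x. norm (f x))"
    using L2_integrable_on [OF L2_norm [OF f]] ab by (intro integral_subset_le) auto
  also have "\<dots> \<le> l2_norm f"
    by (rule integral_norm_le_l2 [OF f])
  finally show ?thesis .
qed

text \<open>Only the weight \<open>e\<close> is cut down to the subinterval. All smallness in later
  estimates comes from its square integral there.\<close>

lemma Cauchy_Schwarz_interval:
  fixes e p :: "real \<Rightarrow> real"
  assumes e: "continuous_on {0..1} e" and p: "p \<in> L2" and ab: "{a..b} \<subseteq> {0..1}"
  shows "integral {a..b} (\<lambda>t. \<bar>e t\<bar> * \<bar>p t\<bar>) \<le> sqrt (integral {a..b} (\<lambda>t. (e t)\<^sup>2)) * l2_norm p"
proof -
  define k where "k = (\<lambda>t. if t \<in> {a..b} then e t else 0)"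
  have "(\<lambda>t. indicator {a..b} t *\<^sub>R e t) \<in> borel_measurable (lebesgue_on {0..1})"
    by (intro borel_measurable_scaleR borel_measurable_indicator L2_measurable [OF continuous_imp_L2 [OF e]])
      (use ab in \<open>auto simp: sets_restrict_space intro!: image_eqI [of _ _ "{a..b}"]\<close>)
  also have "(\<lambda>t. indicator {a..b} t *\<^sub>R e t) = k"
    by (auto simp: k_def)
  finally have km: "k \<in> borel_measurable (lebesgue_on {0..1})" .
  have k: "k \<in> L2"
    by (rule L2_bound [OF continuous_imp_L2 [OF e] km, of 1]) (simp add: k_def)
  have "(l2_norm k)\<^sup>2 = integral {0..1} (\<lambda>t. (norm (k t))\<^sup>2)"
    using l2_norm_square_integral [OF k] by (simp add: integral_unique)
  also have "(\<lambda>t. (norm (k t))\<^sup>2) = (\<lambda>t. if t \<in> {a..b} then (e t)\<^sup>2 else 0)"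
    by (auto simp: k_def)
  also have "integral {0..1} \<dots> = integral {a..b} (\<lambda>t. (e t)\<^sup>2)"
    using ab by (simp only: integral_restrict_Int Int_absorb2)
  finally have l2k: "l2_norm k = sqrt (integral {a..b} (\<lambda>t. (e t)\<^sup>2))"
    by (metis abs_of_nonneg l2_norm_nonneg real_sqrt_abs)
  have "integral {a..b} (\<lambda>t. \<bar>e t\<bar> * \<bar>p t\<bar>) = integral {0..1} (\<lambda>t. if t \<in> {a..b} then \<bar>e t\<bar> * \<bar>p t\<bar> else 0)"
    using ab by (simp only: integral_restrict_Int Int_absorb2)
  also have "(\<lambda>t. if t \<in> {a..b} then \<bar>e t\<bar> * \<bar>p t\<bar> else 0) = (\<lambda>t. norm (k t) * norm (p t))"
    by (auto simp: k_def)
  also have "integral {0..1} \<dots> = (LINT t|lebesgue_on {0..1}. norm (k t) * norm (p t))"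
    using integrable_norm_mult [OF k p] by (simp add: lebesgue_integral_eq_integral)
  also have "\<dots> \<le> l2_norm k * l2_norm p"
    by (rule Cauchy_Schwarz_L2 [OF k p])
  finally show ?thesis by (simp add: l2k)
qed

lemma integral_exp_square_le:
  fixes s a b :: real
  assumes s: "0 < s" and ab: "a \<le> b"
  shows "integral {a..b} (\<lambda>t. (exp (- s * (b - t)))\<^sup>2) \<le> 1 / (2 * s)"
    and "integral {a..b} (\<lambda>t. (exp (- s * (t - a)))\<^sup>2) \<le> 1 / (2 * s)"
proof -
  have "((\<lambda>t. (exp (- s * (b - t)))\<^sup>2) has_integral
      (exp (- s * (b - b)))\<^sup>2 / (2 * s) - (exp (- s * (b - a)))\<^sup>2 / (2 * s)) {a..b}"
    using s by (intro fundamental_theorem_of_calculus ab)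
      (auto simp: has_real_derivative_iff_has_vector_derivative [symmetric] power2_eq_square field_simps
        intro!: derivative_eq_intros)
  then have "integral {a..b} (\<lambda>t. (exp (- s * (b - t)))\<^sup>2) =
      (exp (- s * (b - b)))\<^sup>2 / (2 * s) - (exp (- s * (b - a)))\<^sup>2 / (2 * s)"
    by (rule integral_unique)
  also have "\<dots> \<le> 1 / (2 * s)" using s by simp
  finally show "integral {a..b} (\<lambda>t. (exp (- s * (b - t)))\<^sup>2) \<le> 1 / (2 * s)" .
  have "((\<lambda>t. (exp (- s * (t - a)))\<^sup>2) has_integral
      (- (exp (- s * (b - a)))\<^sup>2 / (2 * s)) - (- (exp (- s * (a - a)))\<^sup>2 / (2 * s))) {a..b}"
    using s by (intro fundamental_theorem_of_calculus ab)
      (auto simp: has_real_derivative_iff_has_vector_derivative [symmetric] power2_eq_square field_simps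
        intro!: derivative_eq_intros)
  then have "integral {a..b} (\<lambda>t. (exp (- s * (t - a)))\<^sup>2) =
      (- (exp (- s * (b - a)))\<^sup>2 / (2 * s)) - (- (exp (- s * (a - a)))\<^sup>2 / (2 * s))"
    by (rule integral_unique)
  also have "\<dots> \<le> 1 / (2 * s)" using s by simp
  finally show "integral {a..b} (\<lambda>t. (exp (- s * (t - a)))\<^sup>2) \<le> 1 / (2 * s)" .
qed

lemma integral_exp_mult_le:
  assumes s: "0 < s" and p: "p \<in> L2" and ab: "{a..b} \<subseteq> {0..1}" "a \<le> b"
  shows "integral {a..b} (\<lambda>t. exp (- s * (b - t)) * \<bar>p t :: real\<bar>) \<le> l2_norm p / sqrt (2 * s)"
    and "integral {a..b} (\<lambda>t. exp (- s * (t - a)) * \<bar>p t :: real\<bar>) \<le> l2_norm p / sqrt (2 * s)"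
proof -
  have "integral {a..b} (\<lambda>t. \<bar>exp (- s * (b - t))\<bar> * \<bar>p t\<bar>)
      \<le> sqrt (integral {a..b} (\<lambda>t. (exp (- s * (b - t)))\<^sup>2)) * l2_norm p"
    by (intro Cauchy_Schwarz_interval p ab continuous_intros)
  also have "\<dots> \<le> sqrt (1 / (2 * s)) * l2_norm p"
    by (intro mult_right_mono real_sqrt_le_mono integral_exp_square_le s ab) simp
  finally show "integral {a..b} (\<lambda>t. exp (- s * (b - t)) * \<bar>p t :: real\<bar>) \<le> l2_norm p / sqrt (2 * s)"
    by (simp add: real_sqrt_divide)
  have "integral {a..b} (\<lambda>t. \<bar>exp (- s * (t - a))\<bar> * \<bar>p t\<bar>)
      \<le> sqrt (integral {a..b} (\<lambda>t. (exp (- s * (t - a)))\<^sup>2)) * l2_norm p"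
    by (intro Cauchy_Schwarz_interval p ab continuous_intros)
  also have "\<dots> \<le> sqrt (1 / (2 * s)) * l2_norm p"
    by (intro mult_right_mono real_sqrt_le_mono integral_exp_square_le s ab) simp
  finally show "integral {a..b} (\<lambda>t. exp (- s * (t - a)) * \<bar>p t :: real\<bar>) \<le> l2_norm p / sqrt (2 * s)"
    by (simp add: real_sqrt_divide)
qed

text \<open>For continuous \<open>h\<close> this is the fundamental theorem of calculus. Both sides
  depend continuously on \<open>h\<close> in the norm of L2, so density carries the identity over,
  and no almost-everywhere derivative of the indefinite integral is involved.\<close>

lemma integral_by_parts_L2:
  fixes \<phi> \<phi>' h :: "real \<Rightarrow> complex"
  assumes d: "\<And>t. t \<in> {0..1} \<Longrightarrow> (\<phi> has_vector_derivative \<phi>' t) (at t within {0..1})"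
    and \<phi>': "continuous_on {0..1} \<phi>'" and h: "h \<in> L2" and x: "x \<in> {0..1}"
  shows "integral {0..x} (\<lambda>t. \<phi>' t * integral {0..t} h) =
    \<phi> x * integral {0..x} h - integral {0..x} (\<lambda>t. \<phi> t * h t)"
proof -
  have \<phi>: "continuous_on {0..1} \<phi>"
    by (rule continuous_on_vector_derivative [OF d])
  have "bounded (\<phi> ` {0..1})" "bounded (\<phi>' ` {0..1})"
    by (intro compact_imp_bounded compact_continuous_image \<phi> \<phi>' compact_Icc)+
  then obtain K where K: "\<And>t. t \<in> {0..1} \<Longrightarrow> norm (\<phi> t) \<le> K" "\<And>t. t \<in> {0..1} \<Longrightarrow> norm (\<phi>' t) \<le> K"
    unfolding bounded_iff by (metis (full_types) image_eqI max.coboundedI1 max.coboundedI2)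
  have "0 \<le> K" using K(1) [of 0] norm_ge_zero [of "\<phi> 0"] by (simp del: norm_ge_zero)
  have sub: "{0..x} \<subseteq> {0..1}" using x by auto
  have ind: "continuous_on {0..1} (\<lambda>t. integral {0..t} k)" if "k \<in> L2" for k :: "real \<Rightarrow> complex"
    using L2_integrable_on [OF that] by (intro indefinite_integral_continuous_1) auto
  \<comment> \<open>The defect of the identity: linear in \<open>h\<close>, bounded by a multiple of
    \<open>l2_norm h\<close>, and zero on continuous functions.\<close>
  define E where "E = (\<lambda>h. integral {0..x} (\<lambda>t. \<phi>' t * integral {0..t} h) -
    \<phi> x * integral {0..x} h + integral {0..x} (\<lambda>t. \<phi> t * h t))"
  have E_diff: "E (\<lambda>t. h t - k t) = E h - E k" if h: "h \<in> L2" and k: "k \<in> L2" for h k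
  proof -
    have 1: "integral {0..t} (\<lambda>t. h t - k t) = integral {0..t} h - integral {0..t} k" if "t \<in> {0..x}" for t
      using that x by (intro integral_diff L2_integrable_on h k) auto
    have "integral {0..x} (\<lambda>t. \<phi>' t * integral {0..t} (\<lambda>t. h t - k t)) =
        integral {0..x} (\<lambda>t. \<phi>' t * integral {0..t} h - \<phi>' t * integral {0..t} k)"
      by (intro integral_cong) (simp only: 1 right_diff_distrib)
    also have "\<dots> = integral {0..x} (\<lambda>t. \<phi>' t * integral {0..t} h) - integral {0..x} (\<lambda>t. \<phi>' t * integral {0..t} k)"
      by (intro integral_diff L2_integrable_on L2_mult_continuous \<phi>' continuous_imp_L2 ind h k sub)
    finally have 2: "integral {0..x} (\<lambda>t. \<phi>' t * integral {0..t} (\<lambda>t. h t - k t)) = \<dots>" .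
    have 3: "integral {0..x} (\<lambda>t. \<phi> t * (h t - k t)) = integral {0..x} (\<lambda>t. \<phi> t * h t) - integral {0..x} (\<lambda>t. \<phi> t * k t)"
      unfolding right_diff_distrib by (intro integral_diff L2_integrable_on L2_mult_continuous \<phi> h k sub)
    have 4: "integral {0..x} (\<lambda>t. h t - k t) = integral {0..x} h - integral {0..x} k"
      using x by (intro 1) auto
    show ?thesis
      unfolding E_def 2 3 4 by algebra
  qed
  have E_le: "norm (E h) \<le> 3 * K * l2_norm h" if h: "h \<in> L2" for h
  proof -
    have *: "l2_norm (\<lambda>t. \<phi>' t * integral {0..t} h) \<le> K * l2_norm h"
    proof (rule l2_norm_le_sup)
      show "norm (\<phi>' t * integral {0..t} h) \<le> K * l2_norm h" if "t \<in> {0..1}" for t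
        unfolding norm_mult using that \<open>0 \<le> K\<close> by (intro mult_mono K norm_integral_le_l2 h) auto
    qed (intro L2_measurable continuous_imp_L2 continuous_on_mult \<phi>' ind h)
    have **: "l2_norm (\<lambda>t. \<phi> t * h t) \<le> K * l2_norm h"
      using K \<open>0 \<le> K\<close> by (intro l2_norm_mono h L2_measurable L2_mult_continuous \<phi>)
        (auto simp: norm_mult intro!: mult_right_mono)
    have "norm (E h) \<le> norm (integral {0..x} (\<lambda>t. \<phi>' t * integral {0..t} h)) +
      norm (\<phi> x * integral {0..x} h) + norm (integral {0..x} (\<lambda>t. \<phi> t * h t))"
      unfolding E_def by (meson norm_triangle_ineq norm_triangle_ineq4 order_trans add_right_mono)
    also have "\<dots> \<le> K * l2_norm h + K * l2_norm h + K * l2_norm h"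
    proof (intro add_mono)
      show "norm (integral {0..x} (\<lambda>t. \<phi>' t * integral {0..t} h)) \<le> K * l2_norm h"
        by (rule order_trans [OF norm_integral_le_l2 *])
          (intro L2_mult_continuous continuous_imp_L2 \<phi>' ind h sub)+
      show "norm (\<phi> x * integral {0..x} h) \<le> K * l2_norm h"
        unfolding norm_mult using x \<open>0 \<le> K\<close> by (intro mult_mono K norm_integral_le_l2 h) auto
      show "norm (integral {0..x} (\<lambda>t. \<phi> t * h t)) \<le> K * l2_norm h"
        by (rule order_trans [OF norm_integral_le_l2 **]) (intro L2_mult_continuous \<phi> h sub)+
    qed
    finally show ?thesis by simp
  qed
  have E_cont: "E k = 0" if k: "continuous_on UNIV k" for k
  proof -
    have k01: "continuous_on {0..x} k" and k01': "continuous_on {0..1} k"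
      using k continuous_on_subset by blast+
    have dk: "((\<lambda>t. integral {0..t} k) has_vector_derivative k t) (at t within {0..x})" if "t \<in> {0..x}" for t
      by (rule integral_has_vector_derivative [OF k01 that])
    have "((\<lambda>t. \<phi> t * k t + \<phi>' t * integral {0..t} k) has_integral
        \<phi> x * integral {0..x} k - \<phi> 0 * integral {0..0} k) {0..x}"
    proof (rule fundamental_theorem_of_calculus)
      fix t assume t: "t \<in> {0..x}"
      have "(\<phi> has_vector_derivative \<phi>' t) (at t within {0..x})"
        by (rule has_vector_derivative_within_subset [OF d sub]) (use t x in auto)
      from has_vector_derivative_mult [OF this dk [OF t]]
      show "((\<lambda>t. \<phi> t * integral {0..t} k) has_vector_derivative \<phi> t * k t + \<phi>' t * integral {0..t} k)
          (at t within {0..x})" .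
    qed (use x in auto)
    then have "integral {0..x} (\<lambda>t. \<phi> t * k t + \<phi>' t * integral {0..t} k) = \<phi> x * integral {0..x} k"
      by (simp add: integral_unique)
    moreover have "integral {0..x} (\<lambda>t. \<phi> t * k t + \<phi>' t * integral {0..t} k) =
        integral {0..x} (\<lambda>t. \<phi> t * k t) + integral {0..x} (\<lambda>t. \<phi>' t * integral {0..t} k)"
      by (intro integral_add L2_integrable_on L2_mult_continuous continuous_imp_L2 \<phi> \<phi>' ind k01' sub)
    ultimately show ?thesis by (simp add: E_def algebra_simps)
  qed
  have "norm (E h) \<le> 0"
  proof (rule field_le_epsilon)
    fix e :: real assume e: "0 < e"
    obtain k where k: "continuous_on UNIV k" "l2_norm (\<lambda>x. h x - k x) < e / (3 * K + 1)"
      using continuous_dense_L2 [OF h, of "e / (3 * K + 1)"] e \<open>0 \<le> K\<close> by auto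
    have kL: "k \<in> L2" using k(1) by (intro continuous_imp_L2) (rule continuous_on_subset, auto)
    have "norm (E h) \<le> 3 * K * l2_norm (\<lambda>x. h x - k x)"
      using E_diff [OF h kL] E_cont [OF k(1)] E_le [OF L2_diff [OF h kL]] by simp
    also have "\<dots> \<le> (3 * K + 1) * (e / (3 * K + 1))"
      using k(2) \<open>0 \<le> K\<close> by (intro mult_mono) auto
    also have "\<dots> = e" using \<open>0 \<le> K\<close> by simp
    finally show "norm (E h) \<le> 0 + e" by simp
  qed
  then show ?thesis by (simp add: E_def algebra_simps)
qed

text \<open>Variation of constants. Since \<open>u\<close> satisfies its equation only in integrated
  form, the product rule for exp (-\<mu> x) u is replaced by integration by parts against exp
  (-\<mu> t).\<close>

lemma Duhamel:
  fixes u h :: "real \<Rightarrow> complex"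
  assumes u: "continuous_on {0..1} u" and h: "h \<in> L2"
    and eq: "\<And>x. x \<in> {0..1} \<Longrightarrow> u x = u 0 + integral {0..x} (\<lambda>t. \<mu> * u t + h t)"
    and x: "x \<in> {0..1}"
  shows "exp (- \<mu> * of_real x) * u x = u 0 + integral {0..x} (\<lambda>t. exp (- \<mu> * of_real t) * h t)"
proof -
  define e where "e = (\<lambda>t. exp (- \<mu> * of_real t))"
  have e: "continuous_on A e" for A
    unfolding e_def by (intro continuous_intros)
  have de: "(e has_vector_derivative - \<mu> * e t) (at t within A)" for t A
    unfolding e_def by (rule has_vector_derivative_real_field) (auto intro!: derivative_eq_intros)
  have sub: "{0..x} \<subseteq> {0..1}" using x by auto
  have uL: "(\<lambda>t. \<mu> * u t) \<in> L2"
    by (intro continuous_imp_L2 continuous_intros u)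
  note hL = L2_add [OF uL h]
  have eq': "integral {0..t} (\<lambda>t. \<mu> * u t + h t) = u t - u 0" if "t \<in> {0..1}" for t
    using eq [OF that] by (metis add_diff_cancel_left')
  have "integral {0..x} (\<lambda>t. - \<mu> * e t * integral {0..t} (\<lambda>t. \<mu> * u t + h t)) =
      e x * integral {0..x} (\<lambda>t. \<mu> * u t + h t) - integral {0..x} (\<lambda>t. e t * (\<mu> * u t + h t))"
    by (rule integral_by_parts_L2 [OF de _ hL x]) (intro continuous_intros e)
  also have "integral {0..x} (\<lambda>t. - \<mu> * e t * integral {0..t} (\<lambda>t. \<mu> * u t + h t)) =
      integral {0..x} (\<lambda>t. (- \<mu> * e t) * (u t) - (- \<mu> * e t) * u 0)"
    using x by (intro integral_cong) (simp add: eq' right_diff_distrib)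
  also have "\<dots> = integral {0..x} (\<lambda>t. (- \<mu> * e t) * u t) - integral {0..x} (\<lambda>t. (- \<mu> * e t) * u 0)"
    by (intro integral_diff L2_integrable_on continuous_imp_L2 sub continuous_intros e u)
  also have "integral {0..x} (\<lambda>t. (- \<mu> * e t) * u 0) = (e x - 1) * u 0"
  proof -
    have "((\<lambda>t. - \<mu> * e t) has_integral e x - e 0) {0..x}"
      using x de by (intro fundamental_theorem_of_calculus) auto
    moreover have "e 0 = 1" by (simp add: e_def)
    ultimately show ?thesis
      using has_integral_mult_left by (metis integral_unique)
  qed
  also have "integral {0..x} (\<lambda>t. e t * (\<mu> * u t + h t)) = integral {0..x} (\<lambda>t. - (- \<mu> * e t * u t) + e t * h t)"
    by (simp add: algebra_simps)
  also have "\<dots> = integral {0..x} (\<lambda>t. - (- \<mu> * e t * u t)) + integral {0..x} (\<lambda>t. e t * h t)"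
    by (intro integral_add L2_integrable_on L2_mult_continuous [OF _ h] continuous_imp_L2 sub continuous_intros e u)
  also have "integral {0..x} (\<lambda>t. - (- \<mu> * e t * u t)) = - integral {0..x} (\<lambda>t. - \<mu> * e t * u t)"
    by (rule integral_neg)
  finally have "e x * u x = u 0 + integral {0..x} (\<lambda>t. e t * h t)"
    unfolding eq' [OF x] by (simp add: algebra_simps)
  then show ?thesis by (simp add: e_def)
qed

text \<open>The weight exp (-\<kappa> x) lowers the exponent to at most \<open>-s\<close>, so that
  the integral kernel is the decaying exponential of \<open>integral_exp_mult_le\<close>. A large
  \<kappa> serves the bounds in strips, and \<kappa> = 0 the decaying components far from the real
  axis.\<close>

lemma Duhamel_forward_bound:
  fixes u h :: "real \<Rightarrow> complex" and p :: "real \<Rightarrow> real"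
  assumes u: "continuous_on {0..1} u" and h: "h \<in> L2" and p: "p \<in> L2"
    and eq: "\<And>x. x \<in> {0..1} \<Longrightarrow> u x = u 0 + integral {0..x} (\<lambda>t. \<mu> * u t + h t)"
    and x: "x \<in> {0..1}" and \<mu>: "Re \<mu> \<le> \<kappa> - s" and s: "0 < s"
    and le: "\<And>t. t \<in> {0..1} \<Longrightarrow> norm (h t) \<le> exp (\<kappa> * t) * p t"
  shows "exp (- \<kappa> * x) * norm (u x) \<le> exp (- s * x) * norm (u 0) + l2_norm p / sqrt (2 * s)"
proof -
  have sub: "{0..x} \<subseteq> {0..1}" "0 \<le> x" using x by auto
  have exp_le: "exp (Re \<mu> * y) \<le> exp ((\<kappa> - s) * y)" if "0 \<le> y" for y
    using mult_right_mono [OF \<mu> that] by simp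
  have shift: "exp (\<mu> * of_real x) * (exp (- \<mu> * of_real t) * z) = exp (\<mu> * of_real (x - t)) * z" for t z
  proof -
    have "exp (\<mu> * of_real x) * exp (- \<mu> * of_real t) = exp (\<mu> * of_real (x - t))"
      by (simp add: exp_add [symmetric] right_diff_distrib)
    then show ?thesis by (simp add: mult.assoc [symmetric])
  qed
  have "u x = exp (\<mu> * of_real x) * (exp (- \<mu> * of_real x) * u x)"
    unfolding shift by simp
  also have "exp (- \<mu> * of_real x) * u x = u 0 + integral {0..x} (\<lambda>t. exp (- \<mu> * of_real t) * h t)"
    by (rule Duhamel [OF u h eq x])
  also have "exp (\<mu> * of_real x) * (u 0 + integral {0..x} (\<lambda>t. exp (- \<mu> * of_real t) * h t)) =
      exp (\<mu> * of_real x) * u 0 + integral {0..x} (\<lambda>t. exp (\<mu> * of_real (x - t)) * h t)"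
    unfolding distrib_left integral_mult_right [symmetric] shift ..
  finally have u_eq: "u x = exp (\<mu> * of_real x) * u 0 + integral {0..x} (\<lambda>t. exp (\<mu> * of_real (x - t)) * h t)" .
  have "norm (integral {0..x} (\<lambda>t. exp (\<mu> * of_real (x - t)) * h t)) \<le>
      integral {0..x} (\<lambda>t. exp (\<kappa> * x) * (exp (- s * (x - t)) * \<bar>p t\<bar>))"
  proof (rule integral_norm_bound_integral)
    show "(\<lambda>t. exp (\<mu> * of_real (x - t)) * h t) integrable_on {0..x}"
      by (intro L2_integrable_on L2_mult_continuous h sub continuous_intros)
    show "(\<lambda>t. exp (\<kappa> * x) * (exp (- s * (x - t)) * \<bar>p t\<bar>)) integrable_on {0..x}"
      using L2_norm [OF p] by (intro L2_integrable_on L2_mult_continuous sub continuous_intros) simp_all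
    show "norm (exp (\<mu> * of_real (x - t)) * h t) \<le> exp (\<kappa> * x) * (exp (- s * (x - t)) * \<bar>p t\<bar>)"
      if t: "t \<in> {0..x}" for t
    proof -
      have "norm (exp (\<mu> * of_real (x - t)) * h t) \<le> exp ((\<kappa> - s) * (x - t)) * (exp (\<kappa> * t) * \<bar>p t\<bar>)"
        unfolding norm_mult using t x exp_le [of "x - t"] le [of t]
        by (intro mult_mono) (auto intro: order_trans [OF _ mult_left_mono])
      also have "\<dots> = exp (\<kappa> * x) * (exp (- s * (x - t)) * \<bar>p t\<bar>)"
      proof -
        have "exp ((\<kappa> - s) * (x - t)) * exp (\<kappa> * t) = exp (\<kappa> * x) * exp (- s * (x - t))"
          unfolding exp_add [symmetric] by (rule arg_cong [where f = exp]) algebra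
        then show ?thesis by (simp add: mult.assoc [symmetric])
      qed
      finally show ?thesis .
    qed
  qed
  also have "\<dots> \<le> exp (\<kappa> * x) * (l2_norm p / sqrt (2 * s))"
    unfolding integral_mult_right by (intro mult_left_mono integral_exp_mult_le s p sub) simp
  finally have 1: "norm (integral {0..x} (\<lambda>t. exp (\<mu> * of_real (x - t)) * h t)) \<le> exp (\<kappa> * x) * (l2_norm p / sqrt (2 * s))" .
  have 2: "norm (exp (\<mu> * of_real x) * u 0) \<le> exp ((\<kappa> - s) * x) * norm (u 0)"
    unfolding norm_mult using exp_le [OF sub(2)] by (intro mult_right_mono) auto
  have "norm (u x) \<le> exp ((\<kappa> - s) * x) * norm (u 0) + exp (\<kappa> * x) * (l2_norm p / sqrt (2 * s))"
    unfolding u_eq by (rule norm_triangle_le) (use 1 2 in linarith)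
  then have "exp (- \<kappa> * x) * norm (u x) \<le>
      exp (- \<kappa> * x) * (exp ((\<kappa> - s) * x) * norm (u 0) + exp (\<kappa> * x) * (l2_norm p / sqrt (2 * s)))"
    by (rule mult_left_mono) simp
  also have "\<dots> = exp (- s * x) * norm (u 0) + l2_norm p / sqrt (2 * s)"
  proof -
    have "exp (- \<kappa> * x) * exp ((\<kappa> - s) * x) = exp (- s * x)" "exp (- \<kappa> * x) * exp (\<kappa> * x) = 1"
      unfolding exp_add [symmetric] by (simp_all add: left_diff_distrib)
    then show ?thesis by (simp only: distrib_left mult.assoc [symmetric] mult_1)
  qed
  finally show ?thesis .
qed

text \<open>A growing component decays when it is followed from 1 to the left, so the value at 1
  takes over the role of the initial value.\<close>

lemma Duhamel_backward_bound:
  fixes u h :: "real \<Rightarrow> complex" and p :: "real \<Rightarrow> real"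
  assumes u: "continuous_on {0..1} u" and h: "h \<in> L2" and p: "p \<in> L2"
    and eq: "\<And>x. x \<in> {0..1} \<Longrightarrow> u x = u 0 + integral {0..x} (\<lambda>t. \<mu> * u t + h t)"
    and x: "x \<in> {0..1}" and \<mu>: "s \<le> Re \<mu>" and s: "0 < s"
    and le: "\<And>t. t \<in> {0..1} \<Longrightarrow> norm (h t) \<le> p t"
  shows "norm (u x) \<le> exp (- s * (1 - x)) * norm (u 1) + l2_norm p / sqrt (2 * s)"
proof -
  have sub: "{x..1} \<subseteq> {0..1}" "x \<le> 1" "0 \<le> x" using x by auto
  have exp_le: "exp (Re \<mu> * - y) \<le> exp (- s * y)" if "0 \<le> y" for y
    using mult_right_mono [OF \<mu> that] by simp
  define E where "E = (\<lambda>t. exp (- \<mu> * of_real t) * h t)"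
  have E: "E \<in> L2"
    unfolding E_def by (intro L2_mult_continuous h continuous_intros)
  have "integral {0..x} E + integral {x..1} E = integral {0..1} E"
    using sub L2_integrable_on [OF E] by (intro Henstock_Kurzweil_Integration.integral_combine) auto
  moreover have "exp (- \<mu> * of_real x) * u x = u 0 + integral {0..x} E"
    "exp (- \<mu> * of_real 1) * u 1 = u 0 + integral {0..1} E"
    unfolding E_def using Duhamel [OF u h eq, of x] Duhamel [OF u h eq, of 1] x by (simp_all only: atLeastAtMost_iff zero_le_one order_refl simp_thms)
  \<comment> \<open>The difference of Duhamel's formula at \<open>x\<close> and at 1; the initial
    value cancels.\<close>
  ultimately have eq': "exp (- \<mu> * of_real x) * u x = exp (- \<mu> * of_real 1) * u 1 - integral {x..1} E"
    by (metis add_diff_cancel_right' add.assoc)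
  have shift: "exp (\<mu> * of_real x) * (exp (- \<mu> * of_real t) * z) = exp (\<mu> * of_real (x - t)) * z" for t z
  proof -
    have "exp (\<mu> * of_real x) * exp (- \<mu> * of_real t) = exp (\<mu> * of_real (x - t))"
      by (simp add: exp_add [symmetric] right_diff_distrib)
    then show ?thesis by (simp add: mult.assoc [symmetric])
  qed
  have "u x = exp (\<mu> * of_real x) * (exp (- \<mu> * of_real x) * u x)"
    unfolding shift by simp
  also have "\<dots> = exp (\<mu> * of_real (x - 1)) * u 1 - integral {x..1} (\<lambda>t. exp (\<mu> * of_real (x - t)) * h t)"
    unfolding eq' E_def right_diff_distrib integral_mult_right [symmetric] shift ..
  finally have u_eq: "u x = exp (\<mu> * of_real (x - 1)) * u 1 - integral {x..1} (\<lambda>t. exp (\<mu> * of_real (x - t)) * h t)" .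
  have "norm (integral {x..1} (\<lambda>t. exp (\<mu> * of_real (x - t)) * h t)) \<le>
      integral {x..1} (\<lambda>t. exp (- s * (t - x)) * \<bar>p t\<bar>)"
  proof (rule integral_norm_bound_integral)
    show "(\<lambda>t. exp (\<mu> * of_real (x - t)) * h t) integrable_on {x..1}"
      by (intro L2_integrable_on L2_mult_continuous h sub continuous_intros)
    show "(\<lambda>t. exp (- s * (t - x)) * \<bar>p t\<bar>) integrable_on {x..1}"
      using L2_norm [OF p] by (intro L2_integrable_on L2_mult_continuous sub continuous_intros) simp_all
    show "norm (exp (\<mu> * of_real (x - t)) * h t) \<le> exp (- s * (t - x)) * \<bar>p t\<bar>"
      if t: "t \<in> {x..1}" for t
      unfolding norm_mult using t x exp_le [of "t - x"] le [of t]
      by (intro mult_mono) auto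
  qed
  also have "\<dots> \<le> l2_norm p / sqrt (2 * s)"
    by (intro integral_exp_mult_le s p sub)
  finally have 1: "norm (integral {x..1} (\<lambda>t. exp (\<mu> * of_real (x - t)) * h t)) \<le> l2_norm p / sqrt (2 * s)" .
  have 2: "norm (exp (\<mu> * of_real (x - 1)) * u 1) \<le> exp (- s * (1 - x)) * norm (u 1)"
    unfolding norm_mult using exp_le [of "1 - x"] sub(2) by (intro mult_right_mono) auto
  show ?thesis
    unfolding u_eq by (rule order_trans [OF norm_triangle_ineq4]) (use 1 2 in linarith)
qed

section \<open>First-order systems\<close>

lemma norm_vec_le_sum: "norm (v :: complex^'n) \<le> (\<Sum>i\<in>UNIV. norm (v $ i))"
  by (simp add: norm_vec_def L2_set_le_sum)

lemma norm_vec_le_card: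
  fixes v :: "complex^'n"
  assumes "\<And>i. norm (v $ i) \<le> c"
  shows "norm v \<le> real CARD('n) * c"
  using norm_vec_le_sum [of v] sum_bounded_above [of UNIV "\<lambda>i. norm (v $ i)" c] assms by simp

lemma norm_matrix_vector_nth_le:
  fixes A :: "complex^'n^'n"
  shows "norm ((A *v x) $ i) \<le> real CARD('n) * (norm A * norm x)"
proof -
  have "norm (A $ i $ j * x $ j) \<le> norm A * norm x" for j
    unfolding norm_mult by (intro mult_mono order_trans [OF Finite_Cartesian_Product.norm_nth_le Finite_Cartesian_Product.norm_nth_le] Finite_Cartesian_Product.norm_nth_le) auto
  then show ?thesis
    unfolding matrix_vector_mult_def
    using norm_sum [of "\<lambda>j. A $ i $ j * x $ j" UNIV]
      sum_bounded_above [of UNIV "\<lambda>j. norm (A $ i $ j * x $ j)" "norm A * norm x"] by simp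
qed

lemma norm_matrix_vector_le:
  fixes A :: "complex^'n^'n"
  shows "norm (A *v x) \<le> (real CARD('n))\<^sup>2 * (norm A * norm x)"
  using norm_vec_le_card [OF norm_matrix_vector_nth_le, of A x]
  by (simp add: power2_eq_square mult.assoc)

lemma matrix_vector_mult_measurable:
  fixes A :: "real \<Rightarrow> complex^'n^'n"
  assumes "A \<in> borel_measurable (lebesgue_on {0..1})" "y \<in> borel_measurable (lebesgue_on {0..1})"
  shows "(\<lambda>t. A t *v y t) \<in> borel_measurable (lebesgue_on {0..1})"
proof (rule borel_measurable_bilinear [OF _ assms])
  have "linear (\<lambda>A :: complex^'n^'n. A *v x)" for x
    by (rule linearI) (simp_all add: matrix_vector_mult_def vec_eq_iff sum.distrib ring_distribs
        scaleR_sum_right)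
  then show "bilinear ((*v) :: complex^'n^'n \<Rightarrow> _)"
    using bounded_linear.linear [OF bounded_linear_matrix_vector] by (simp add: bilinear_def)
qed simp

lemma L2_matrix_vector_mult:
  fixes A :: "real \<Rightarrow> complex^'n^'n"
  assumes A: "A \<in> L2" and y: "continuous_on {0..1} y"
  shows "(\<lambda>t. A t *v y t) \<in> L2"
proof -
  have "bounded (y ` {0..1})"
    by (intro compact_imp_bounded compact_continuous_image y) simp
  then obtain K where K: "\<And>x. x \<in> {0..1} \<Longrightarrow> norm (y x) \<le> K"
    unfolding bounded_iff by blast
  show ?thesis
  proof (rule L2_bound [OF A])
    show "norm (A t *v y t) \<le> ((real CARD('n))\<^sup>2 * K) * norm (A t)" if "t \<in> {0..1}" for t
      using mult_left_mono [OF mult_left_mono [OF K [OF that], of "norm (A t)"], of "(real CARD('n))\<^sup>2"]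
        norm_matrix_vector_le [of "A t" "y t"] by (simp add: mult_ac)
  qed (intro matrix_vector_mult_measurable L2_measurable A continuous_imp_L2 y)
qed

text \<open>Exponentially small boundary terms are absorbed into the rate 1 / sqrt (2 s) with which
  the potential contributes.\<close>

lemma exp_minus_le_inverse_sqrt: "exp (- s) \<le> 1 / sqrt (2 * s)" if "0 < s"
proof -
  have "2 * s \<le> (1 + s)\<^sup>2" using zero_le_power2 [of s] by (simp add: power2_sum del: zero_le_power2)
  then have "sqrt (2 * s) \<le> 1 + s" using that by (intro real_le_lsqrt) auto
  also have "\<dots> \<le> exp s" by (rule exp_ge_add_one_self)
  finally show ?thesis using that by (simp add: exp_minus field_simps)
qed

text \<open>Extension by zero makes equality of functions the same as equality on the unit interval.
  Uniqueness of solutions thus becomes an equation between functions, in agreement with the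
  convention for the domain of \<open>L_op\<close>.\<close>

definition C0 :: "(real \<Rightarrow> complex^'n) set" where
  "C0 = {y. continuous_on {0..1} y \<and> (\<forall>x. x \<notin> {0..1} \<longrightarrow> y x = 0)}"

lemma C0_L2: "y \<in> C0 \<Longrightarrow> y \<in> L2"
  by (simp add: C0_def continuous_imp_L2)

lemma C0_zero [simp]: "0 \<in> C0"
  by (simp add: C0_def zero_fun_def)

lemma C0_add: "y \<in> C0 \<Longrightarrow> z \<in> C0 \<Longrightarrow> y + z \<in> C0"
  by (auto simp: C0_def plus_fun_def intro: continuous_on_add)

lemma C0_fscale: "y \<in> C0 \<Longrightarrow> fscale c y \<in> C0"
  using continuous_on_compose2 [OF linear_continuous_on [OF bounded_linear_smult [of c], of UNIV], of "{0..1}" y]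
  by (auto simp: C0_def fscale_def)

section \<open>The integral equation with spectral parameter\<close>

locale first_order_system =
  fixes a :: "'n::finite \<Rightarrow> real" and Q :: "real \<Rightarrow> complex^'n^'n"
  assumes a_nonzero: "a i \<noteq> 0" and Q: "Q \<in> L2"
begin

definition rhs :: "complex \<Rightarrow> (real \<Rightarrow> complex^'n) \<Rightarrow> (real \<Rightarrow> complex^'n) \<Rightarrow> real \<Rightarrow> complex^'n" where
  "rhs \<zeta> g y t = (\<chi> i. \<i> * of_real (a i) * (g t $ i + \<zeta> * y t $ i - (Q t *v y t) $ i))"

text \<open>The integral form of \<open>-iBy' + Qy - \<zeta>y = g\<close>, where \<open>B\<close> is the diagonal matrix with entries \<open>1 / a i\<close>.\<close>

definition sol :: "complex \<Rightarrow> (real \<Rightarrow> complex^'n) \<Rightarrow> (real \<Rightarrow> complex^'n) \<Rightarrow> bool" where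
  "sol \<zeta> g y \<longleftrightarrow> y \<in> C0 \<and> (\<forall>x\<in>{0..1}. y x = y 0 + integral {0..x} (rhs \<zeta> g y))"

definition \<alpha> :: real where "\<alpha> = (\<Sum>i\<in>UNIV. \<bar>a i\<bar>)"

lemma a_le: "\<bar>a i\<bar> \<le> \<alpha>"
  unfolding \<alpha>_def by (rule member_le_sum) auto

lemma \<alpha>_nonneg: "0 \<le> \<alpha>"
  using a_le [of undefined] by linarith

lemma sol_C0: "sol \<zeta> g y \<Longrightarrow> y \<in> C0"
  by (simp add: sol_def)

lemma sol_continuous: "sol \<zeta> g y \<Longrightarrow> continuous_on {0..1} y"
  by (simp add: sol_def C0_def)

lemma bounded_linear_diag: "bounded_linear (\<lambda>v :: complex^'n. \<chi> i. \<i> * of_real (a i) * v $ i)"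
proof -
  have "linear (\<lambda>v :: complex^'n. \<chi> i. \<i> * of_real (a i) * v $ i)"
    by (rule linearI) (simp_all add: vec_eq_iff ring_distribs)
  then show ?thesis by (simp add: linear_conv_bounded_linear)
qed

lemma norm_diag_le: "norm (\<chi> i. \<i> * of_real (a i) * v $ i :: complex^'n) \<le> \<alpha> * norm v"
proof -
  have "norm (\<chi> i. \<i> * of_real (a i) * v $ i :: complex^'n) \<le> L2_set (\<lambda>i. \<alpha> * norm (v $ i)) UNIV"
    unfolding norm_vec_def using a_le
    by (intro L2_set_mono) (auto simp: norm_mult intro!: mult_right_mono)
  then show ?thesis
    using \<alpha>_nonneg by (simp add: norm_vec_def L2_set_right_distrib)
qed

lemma rhs_L2:
  assumes "g \<in> L2" "continuous_on {0..1} y"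
  shows "rhs \<zeta> g y \<in> L2"
proof -
  have "(\<lambda>t. g t + \<zeta> *s y t - Q t *v y t) \<in> L2"
    using L2_fscale [OF continuous_imp_L2 [OF assms(2)], of \<zeta>] unfolding fscale_def
    by (intro L2_add L2_diff assms L2_matrix_vector_mult Q)
  from L2_bounded_linear [OF bounded_linear_diag this] show ?thesis
    by (simp add: rhs_def [abs_def])
qed

lemma rhs_integrable:
  "g \<in> L2 \<Longrightarrow> y \<in> C0 \<Longrightarrow> x \<in> {0..1} \<Longrightarrow> rhs \<zeta> g y integrable_on {0..x}"
  by (intro L2_integrable_on rhs_L2) (auto simp: C0_def)

lemma rhs_add: "rhs \<zeta> (g + h) (y + z) = (\<lambda>t. rhs \<zeta> g y t + rhs \<zeta> h z t)"
  by (simp add: rhs_def fun_eq_iff vec_eq_iff matrix_vector_right_distrib algebra_simps)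

lemma rhs_fscale: "rhs \<zeta> (fscale c g) (fscale c y) = (\<lambda>t. c *s rhs \<zeta> g y t)"
  by (simp add: rhs_def fscale_def fun_eq_iff vec_eq_iff vector_scalar_commute algebra_simps)

lemma rhs_shift: "rhs \<mu> (g + fscale (\<zeta> - \<mu>) y) y = rhs \<zeta> g y"
  by (simp add: rhs_def fscale_def fun_eq_iff vec_eq_iff algebra_simps)

lemma sol_add:
  assumes "sol \<zeta> g y" "sol \<zeta> h z" "g \<in> L2" "h \<in> L2"
  shows "sol \<zeta> (g + h) (y + z)"
  unfolding sol_def
proof (intro conjI ballI)
  fix x :: real assume x: "x \<in> {0..1}"
  have "integral {0..x} (rhs \<zeta> (g + h) (y + z)) = integral {0..x} (rhs \<zeta> g y) + integral {0..x} (rhs \<zeta> h z)"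
    unfolding rhs_add using assms x by (intro integral_add rhs_integrable) (auto simp: sol_def)
  moreover have "y x = y 0 + integral {0..x} (rhs \<zeta> g y)" "z x = z 0 + integral {0..x} (rhs \<zeta> h z)"
    using assms x unfolding sol_def by blast+
  ultimately show "(y + z) x = (y + z) 0 + integral {0..x} (rhs \<zeta> (g + h) (y + z))"
    by simp
qed (use assms in \<open>auto simp: sol_def intro: C0_add\<close>)

lemma sol_fscale:
  assumes "sol \<zeta> g y" "g \<in> L2"
  shows "sol \<zeta> (fscale c g) (fscale c y)"
  unfolding sol_def
proof (intro conjI ballI)
  fix x :: real assume x: "x \<in> {0..1}"
  have "integral {0..x} (rhs \<zeta> (fscale c g) (fscale c y)) = c *s integral {0..x} (rhs \<zeta> g y)"
    unfolding rhs_fscale using assms x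
    by (intro integral_linear [OF rhs_integrable bounded_linear_smult, unfolded o_def]) (auto simp: sol_def)
  moreover have "y x = y 0 + integral {0..x} (rhs \<zeta> g y)"
    using assms x unfolding sol_def by blast
  ultimately show "fscale c y x = fscale c y 0 + integral {0..x} (rhs \<zeta> (fscale c g) (fscale c y))"
    by (simp add: fscale_def vector_add_ldistrib)
qed (use assms in \<open>auto simp: sol_def intro: C0_fscale\<close>)

lemma sol_shift: "sol \<zeta> g y \<longleftrightarrow> sol \<mu> (g + fscale (\<zeta> - \<mu>) y) y"
  by (simp add: sol_def rhs_shift)

lemma sol_zero: "sol \<zeta> 0 0"
proof -
  have "rhs \<zeta> 0 0 = (\<lambda>t. 0)" by (simp add: rhs_def fun_eq_iff vec_eq_iff)
  then show ?thesis by (simp add: sol_def)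
qed

lemma sol_diff:
  assumes "sol \<zeta> g y" "sol \<zeta> h z" "g \<in> L2" "h \<in> L2"
  shows "sol \<zeta> (g - h) (y - z)"
proof -
  have "x + fscale (- 1) y = x - y" for x y :: "real \<Rightarrow> complex^'n"
    by (simp add: fun_eq_iff fscale_def)
  with sol_add [OF assms(1) sol_fscale [OF assms(2,4), of "- 1"] assms(3) L2_fscale [OF assms(4)]]
  show ?thesis by (simp only:)
qed

text \<open>The potential is counted as part of the inhomogeneity, so that each component satisfies
  a scalar equation with exponent \<i> \<open>a i\<close> \<zeta>, to which Duhamel's formula
  applies.\<close>

definition frc :: "(real \<Rightarrow> complex^'n) \<Rightarrow> (real \<Rightarrow> complex^'n) \<Rightarrow> 'n \<Rightarrow> real \<Rightarrow> complex" where
  "frc g y i t = \<i> * of_real (a i) * (g t $ i - (Q t *v y t) $ i)"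

lemma frc_L2:
  assumes "g \<in> L2" "continuous_on {0..1} y"
  shows "frc g y i \<in> L2"
proof -
  have "(\<lambda>t. rhs 0 g y t $ i) \<in> L2"
    by (rule L2_bounded_linear [OF bounded_linear_vec_nth rhs_L2 [OF assms]])
  then show ?thesis by (simp add: rhs_def frc_def [abs_def])
qed

lemma sol_component:
  assumes y: "sol \<zeta> g y" and g: "g \<in> L2" and x: "x \<in> {0..1}"
  shows "y x $ i = y 0 $ i + integral {0..x} (\<lambda>t. \<i> * of_real (a i) * \<zeta> * y t $ i + frc g y i t)"
proof -
  have "integral {0..x} (\<lambda>t. rhs \<zeta> g y t $ i) = integral {0..x} (rhs \<zeta> g y) $ i"
    using rhs_integrable [OF g sol_C0 [OF y] x]
    by (rule integral_linear [OF _ bounded_linear_vec_nth, unfolded o_def])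
  also have "(\<lambda>t. rhs \<zeta> g y t $ i) = (\<lambda>t. \<i> * of_real (a i) * \<zeta> * y t $ i + frc g y i t)"
    by (simp add: rhs_def frc_def fun_eq_iff algebra_simps)
  moreover have "y x = y 0 + integral {0..x} (rhs \<zeta> g y)"
    using y x unfolding sol_def by blast
  ultimately show ?thesis by simp
qed

text \<open>Here \<open>c\<close> is the exponential weight and \<open>m\<close> the weighted
  maximum of the solution. The condition \<open>1 \<le> c\<close> puts the unweighted
  \<open>g\<close> under the same factor.\<close>

lemma frc_le:
  assumes "norm (y t) \<le> c * m" "0 \<le> c" "1 \<le> c"
  shows "norm (frc g y i t) \<le> c * (\<alpha> * (norm (g t) + real CARD('n) * m * norm (Q t)))"
proof -
  have "norm (frc g y i t) = \<bar>a i\<bar> * norm (g t $ i - (Q t *v y t) $ i)"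
    by (simp add: frc_def norm_mult)
  also have "\<dots> \<le> \<alpha> * (norm (g t) + real CARD('n) * (norm (Q t) * norm (y t)))"
    using \<alpha>_nonneg norm_triangle_ineq4 [of "g t $ i" "(Q t *v y t) $ i"] Finite_Cartesian_Product.norm_nth_le [of "g t" i]
      norm_matrix_vector_nth_le [of "Q t" "y t" i]
    by (intro mult_mono a_le) auto
  also have "\<dots> \<le> \<alpha> * (c * norm (g t) + real CARD('n) * (norm (Q t) * (c * m)))"
    using assms \<alpha>_nonneg mult_right_mono [of 1 c "norm (g t)"]
    by (intro mult_left_mono add_mono) auto
  finally show ?thesis by (simp add: algebra_simps)
qed

lemma weight_L2:
  assumes "g \<in> L2" "0 \<le> m"
  shows "(\<lambda>t. \<alpha> * (norm (g t) + real CARD('n) * m * norm (Q t))) \<in> L2"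
    and "l2_norm (\<lambda>t. \<alpha> * (norm (g t) + real CARD('n) * m * norm (Q t)))
      \<le> \<alpha> * (l2_norm g + real CARD('n) * m * l2_norm Q)"
proof -
  have Q': "(\<lambda>t. real CARD('n) * m * norm (Q t)) \<in> L2"
    using L2_norm [OF Q] by (intro L2_mult_continuous continuous_intros)
  have s: "(\<lambda>t. norm (g t) + real CARD('n) * m * norm (Q t)) \<in> L2"
    using L2_norm [OF assms(1)] by (intro L2_add Q')
  show *: "(\<lambda>t. \<alpha> * (norm (g t) + real CARD('n) * m * norm (Q t))) \<in> L2"
    by (intro L2_mult_continuous s continuous_intros)
  have "l2_norm (\<lambda>t. \<alpha> * (norm (g t) + real CARD('n) * m * norm (Q t))) \<le>
      \<alpha> * l2_norm (\<lambda>t. norm (g t) + real CARD('n) * m * norm (Q t))"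
    using \<alpha>_nonneg by (intro l2_norm_mono s L2_measurable [OF *]) (auto simp: abs_mult)
  also have "\<dots> \<le> \<alpha> * (l2_norm g + real CARD('n) * m * l2_norm Q)"
  proof (intro mult_left_mono \<alpha>_nonneg)
    have "l2_norm (\<lambda>t. real CARD('n) * m * norm (Q t)) \<le> (real CARD('n) * m) * l2_norm Q"
      using assms(2) by (intro l2_norm_mono Q L2_measurable [OF Q']) auto
    then show "l2_norm (\<lambda>t. norm (g t) + real CARD('n) * m * norm (Q t)) \<le> l2_norm g + real CARD('n) * m * l2_norm Q"
      using l2_norm_triangle [OF L2_norm [OF assms(1)] Q'] by simp
  qed
  finally show "l2_norm (\<lambda>t. \<alpha> * (norm (g t) + real CARD('n) * m * norm (Q t)))
      \<le> \<alpha> * (l2_norm g + real CARD('n) * m * l2_norm Q)" .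
qed

text \<open>The maximum \<open>m\<close> of exp (-\<kappa> t) \<open>norm (y t)\<close> satisfies an
  inequality in which the potential contributes at most \<open>m / 2\<close>, which is absorbed on
  the left. The real part of the exponent \<i> \<open>a i\<close> \<zeta> involves only
  \<open>Im \<zeta>\<close>, whence the uniformity in \<open>Re \<zeta>\<close>.\<close>

lemma initial_value_bound:
  obtains K where "0 \<le> K"
    "\<And>\<zeta> g y x. \<lbrakk>\<bar>Im \<zeta>\<bar> \<le> T; g \<in> L2; sol \<zeta> g y; x \<in> {0..1}\<rbrakk> \<Longrightarrow> norm (y x) \<le> K * (norm (y 0) + l2_norm g)"
proof (cases "0 \<le> T")
  case False
  then show ?thesis using that [of 0] by fastforce
next
  case T: True
  define N where "N = real CARD('n)"
  have N: "1 \<le> N" by (simp add: N_def Suc_leI)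
  \<comment> \<open>This becomes sqrt (2 s), the denominator in the Duhamel bound. The second
    summand makes the contribution of \<open>Q\<close> at most \<open>m / 2\<close>; the first
    ensures \<open>0 < s\<close> and \<open>l2_norm g / w \<le> l2_norm g\<close>.\<close>
  define w where "w = 1 + 2 * N * \<alpha> * N * l2_norm Q"
  define s where "s = w\<^sup>2 / 2"
  define \<kappa> where "\<kappa> = \<alpha> * T + s"
  have w: "1 \<le> w" "2 * N * \<alpha> * N * l2_norm Q \<le> w" using N \<alpha>_nonneg by (auto simp: w_def)
  then have s: "0 < s" "sqrt (2 * s) = w" by (auto simp: s_def)
  have \<kappa>: "0 \<le> \<kappa>" using s(1) \<alpha>_nonneg T by (simp add: \<kappa>_def)
  define K where "K = exp \<kappa> * (2 * N * (1 + \<alpha>))"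
  have "norm (y x) \<le> K * (norm (y 0) + l2_norm g)"
    if \<zeta>: "\<bar>Im \<zeta>\<bar> \<le> T" and g: "g \<in> L2" and y: "sol \<zeta> g y" and x: "x \<in> {0..1}" for \<zeta> g y x
  proof -
    define f where "f = (\<lambda>t. exp (- \<kappa> * t) * norm (y t))"
    have "continuous_on {0..1} f"
      unfolding f_def by (intro continuous_intros sol_continuous [OF y])
    then obtain z where z: "z \<in> {0..1}" "\<And>t. t \<in> {0..1} \<Longrightarrow> f t \<le> f z"
      using continuous_attains_sup [of "{0..1}" f] by auto
    define m where "m = f z"
    have m: "0 \<le> m" by (simp add: m_def f_def)
    have y_le: "norm (y t) \<le> exp (\<kappa> * t) * m" if "t \<in> {0..1}" for t
    proof -
      have "norm (y t) = exp (\<kappa> * t) * f t"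
        by (simp add: f_def mult.assoc [symmetric] exp_add [symmetric])
      then show ?thesis using z(2) [OF that] by (simp add: m_def)
    qed
    define p where "p = (\<lambda>t. \<alpha> * (norm (g t) + real CARD('n) * m * norm (Q t)))"
    have p: "p \<in> L2" "l2_norm p \<le> \<alpha> * (l2_norm g + N * m * l2_norm Q)"
      using weight_L2 [OF g m] by (simp_all add: p_def N_def)
    have comp: "exp (- \<kappa> * z) * norm (y z $ i) \<le> norm (y 0) + l2_norm p / w" for i
    proof -
      have "exp (- \<kappa> * z) * norm (y z $ i) \<le> exp (- s * z) * norm (y 0 $ i) + l2_norm p / sqrt (2 * s)"
      proof (rule Duhamel_forward_bound [OF _ frc_L2 [OF g sol_continuous [OF y]] p(1) sol_component [OF y g] z(1) _ s(1)])
        show "continuous_on {0..1} (\<lambda>x. y x $ i)"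
          by (intro continuous_intros sol_continuous [OF y])
        have "Re (\<i> * of_real (a i) * \<zeta>) \<le> \<bar>a i\<bar> * \<bar>Im \<zeta>\<bar>"
          by (simp add: abs_mult [symmetric])
        also have "\<dots> \<le> \<alpha> * T" using \<zeta> \<alpha>_nonneg by (intro mult_mono a_le) auto
        finally show "Re (\<i> * of_real (a i) * \<zeta>) \<le> \<kappa> - s" by (simp add: \<kappa>_def)
        show "norm (frc g y i t) \<le> exp (\<kappa> * t) * p t" if "t \<in> {0..1}" for t
          unfolding p_def using that \<kappa> by (intro frc_le y_le) auto
      qed
      also have "exp (- s * z) * norm (y 0 $ i) \<le> 1 * norm (y 0)"
        using s(1) z(1) by (intro mult_mono Finite_Cartesian_Product.norm_nth_le) auto
      finally show ?thesis using s by simp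
    qed
    have "m \<le> N * (norm (y 0) + l2_norm p / w)"
    proof -
      have "m = norm (of_real (exp (- \<kappa> * z)) *s y z)"
        by (simp add: m_def f_def norm_smult del: of_real_exp)
      also have "\<dots> \<le> N * (norm (y 0) + l2_norm p / w)"
        unfolding N_def using comp by (intro norm_vec_le_card) (simp add: norm_mult del: of_real_exp)
      finally show ?thesis .
    qed
    also have "\<dots> \<le> N * (norm (y 0) + \<alpha> * (l2_norm g + N * m * l2_norm Q) / w)"
      using p(2) w N by (intro mult_left_mono add_left_mono divide_right_mono) auto
    also have "\<dots> = N * norm (y 0) + N * \<alpha> * (l2_norm g / w) + m * ((N * \<alpha> * N * l2_norm Q) / w)"
      using w by (simp add: field_simps)
    also have "\<dots> \<le> N * norm (y 0) + N * \<alpha> * l2_norm g + m * (1 / 2)"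
    proof (intro add_mono mult_left_mono)
      show "l2_norm g / w \<le> l2_norm g"
        using divide_left_mono [of 1 w "l2_norm g"] w(1) by simp
      show "N * \<alpha> * N * l2_norm Q / w \<le> 1 / 2"
        using w by (simp add: field_simps)
    qed (use m N \<alpha>_nonneg in auto)
    finally have "m \<le> 2 * N * norm (y 0) + 2 * N * \<alpha> * l2_norm g" by simp
    also have "\<dots> \<le> 2 * N * (1 + \<alpha>) * (norm (y 0) + l2_norm g)"
      using N \<alpha>_nonneg by (simp add: algebra_simps)
    finally have "exp (\<kappa> * x) * m \<le> exp \<kappa> * (2 * N * (1 + \<alpha>) * (norm (y 0) + l2_norm g))"
      using x \<kappa> m by (intro mult_mono) (auto simp: mult_left_le)
    then show ?thesis using y_le [OF x] by (simp add: K_def mult.assoc)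
  qed
  moreover have "0 \<le> K" using N \<alpha>_nonneg by (simp add: K_def)
  ultimately show ?thesis using that by blast
qed

lemma sol_unique:
  assumes "sol \<zeta> g y" "sol \<zeta> g z" "g \<in> L2" "y 0 = z 0"
  shows "y = z"
proof (rule initial_value_bound [of "\<bar>Im \<zeta>\<bar>"], rule ext)
  fix K x
  assume K: "\<And>\<mu> g y x. \<lbrakk>\<bar>Im \<mu>\<bar> \<le> \<bar>Im \<zeta>\<bar>; g \<in> L2; sol \<mu> g y; x \<in> {0..1}\<rbrakk> \<Longrightarrow> norm (y x) \<le> K * (norm (y 0) + l2_norm g)"
  show "y x = z x"
  proof (cases "x \<in> {0..1}")
    case True
    have "norm ((y - z) x) \<le> K * (norm ((y - z) 0) + l2_norm (g - g))"
      using True by (intro K [of \<zeta>] sol_diff assms) auto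
    then show ?thesis using assms(4) by (simp add: l2_norm_def zero_fun_def)
  next
    case False
    then show ?thesis using sol_C0 [OF assms(1)] sol_C0 [OF assms(2)] by (simp add: C0_def)
  qed
qed

text \<open>Banach's fixed point theorem for u(x) = exp (-\<kappa> x) y(x). The exponential weight
  turns the integral operator into a contraction on the whole interval at once.\<close>

lemma sol_exists:
  assumes g: "g \<in> L2"
  obtains y where "sol \<zeta> g y" "y 0 = v"
proof -
  define N where "N = (real CARD('n))\<^sup>2"
  define q where "q = (\<lambda>t. \<alpha> * (norm \<zeta> + N * norm (Q t)))"
  have q: "q \<in> L2"
    unfolding q_def using L2_norm [OF Q] by (intro L2_mult_continuous L2_add L2_const continuous_intros)
  have q0: "0 \<le> q t" for t
    using \<alpha>_nonneg by (simp add: q_def N_def)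
  \<comment> \<open>Chosen so that sqrt (2 \<kappa>) = 1 + 2 \<open>l2_norm q\<close>; the
    contraction constant \<open>l2_norm q / sqrt (2 * \<kappa>)\<close> is then at most 1 /
    2.\<close>
  define \<kappa> where "\<kappa> = (1 + 2 * l2_norm q)\<^sup>2 / 2"
  have \<kappa>: "0 < \<kappa>" "sqrt (2 * \<kappa>) = 1 + 2 * l2_norm q"
  proof -
    have "0 < 1 + 2 * l2_norm q" using l2_norm_nonneg [of q] by linarith
    then show "0 < \<kappa>" "sqrt (2 * \<kappa>) = 1 + 2 * l2_norm q" by (auto simp: \<kappa>_def)
  qed
  define E where "E = (\<lambda>u t. exp (\<kappa> * t) *\<^sub>R apply_bcontfun u t :: complex^'n)"
  have E: "continuous_on {0..1} (E u)" for u
    unfolding E_def by (intro continuous_intros continuous_on_apply_bcontfun)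
  have E_int: "rhs \<zeta> g (E u) integrable_on {0..x}" if "x \<in> {0..1}" for u x
    using that by (intro L2_integrable_on rhs_L2 g E) auto
  define F where "F = (\<lambda>u x. exp (- \<kappa> * x) *\<^sub>R (v + integral {0..x} (rhs \<zeta> g (E u))))"
  have "continuous_on {0..1} (F u)" for u
    unfolding F_def by (intro continuous_intros indefinite_integral_continuous_1 E_int) auto
  \<comment> \<open>The complete space is that of bounded continuous functions on the whole line, so
    the image is extended by its end values through \<open>clamp\<close>; the solution itself is
    later cut off to zero outside the interval.\<close>
  then have "\<exists>J :: real \<Rightarrow>\<^sub>C (complex^'n). \<forall>x. apply_bcontfun J x = F u (clamp 0 1 x)" for u
    by (metis continuous_on_cbox_bcontfunE box_real(2))
  then obtain J where J: "\<And>u x. apply_bcontfun (J u) x = F u (clamp 0 1 x)"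
    by metis
  have rhs_diff_le: "norm (rhs \<zeta> g (E u) t - rhs \<zeta> g (E w) t) \<le> exp (\<kappa> * t) * (q t * dist u w)" for u w t
  proof -
    define d where "d = E u t - E w t"
    have "norm d = exp (\<kappa> * t) * dist (apply_bcontfun u t) (apply_bcontfun w t)"
      by (simp add: d_def E_def dist_norm scaleR_diff_right [symmetric])
    also have "\<dots> \<le> exp (\<kappa> * t) * dist u w"
      by (intro mult_left_mono dist_bounded) auto
    finally have d: "norm d \<le> exp (\<kappa> * t) * dist u w" .
    have "rhs \<zeta> g (E u) t - rhs \<zeta> g (E w) t = (\<chi> i. \<i> * of_real (a i) * (\<zeta> *s d - Q t *v d) $ i)"
      by (simp add: rhs_def d_def vec_eq_iff matrix_vector_mult_diff_distrib algebra_simps)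
    also have "norm \<dots> \<le> \<alpha> * norm (\<zeta> *s d - Q t *v d)"
      by (rule norm_diag_le)
    also have "\<dots> \<le> \<alpha> * (norm \<zeta> * norm d + N * (norm (Q t) * norm d))"
      using norm_triangle_ineq4 [of "\<zeta> *s d" "Q t *v d"] norm_matrix_vector_le [of "Q t" d]
      by (intro mult_left_mono \<alpha>_nonneg) (simp add: norm_smult N_def)
    also have "\<dots> = q t * norm d" by (simp add: q_def algebra_simps)
    also have "\<dots> \<le> q t * (exp (\<kappa> * t) * dist u w)" by (intro mult_left_mono d q0)
    finally show ?thesis by (simp add: mult_ac)
  qed
  have F_le: "norm (F u x - F w x) \<le> 1 / 2 * dist u w" if x: "x \<in> {0..1}" for u w x
  proof -
    have sub: "{0..x} \<subseteq> {0..1}" "0 \<le> x" using x by auto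
    have qd: "(\<lambda>t. q t * dist u w) \<in> L2"
      using L2_mult_continuous [OF continuous_on_const q, of "dist u w"] by (simp add: mult.commute)
    have "norm (F u x - F w x) =
        exp (- \<kappa> * x) * norm (integral {0..x} (rhs \<zeta> g (E u)) - integral {0..x} (rhs \<zeta> g (E w)))"
      by (simp add: F_def scaleR_diff_right [symmetric])
    also have "integral {0..x} (rhs \<zeta> g (E u)) - integral {0..x} (rhs \<zeta> g (E w)) =
        integral {0..x} (\<lambda>t. rhs \<zeta> g (E u) t - rhs \<zeta> g (E w) t)"
      by (intro integral_diff [symmetric] E_int x)
    also have "norm \<dots> \<le> integral {0..x} (\<lambda>t. exp (\<kappa> * t) * (q t * dist u w))"
    proof (rule integral_norm_bound_integral)
      show "(\<lambda>t. rhs \<zeta> g (E u) t - rhs \<zeta> g (E w) t) integrable_on {0..x}"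
        by (intro integrable_diff E_int x)
      show "(\<lambda>t. exp (\<kappa> * t) * (q t * dist u w)) integrable_on {0..x}"
        by (intro L2_integrable_on L2_mult_continuous qd sub continuous_intros)
    qed (rule rhs_diff_le)
    finally have "norm (F u x - F w x) \<le> exp (- \<kappa> * x) * integral {0..x} (\<lambda>t. exp (\<kappa> * t) * (q t * dist u w))"
      by simp
    also have "\<dots> = integral {0..x} (\<lambda>t. exp (- \<kappa> * x) * (exp (\<kappa> * t) * (q t * dist u w)))"
      by (rule integral_mult_right [symmetric])
    also have "(\<lambda>t. exp (- \<kappa> * x) * (exp (\<kappa> * t) * (q t * dist u w))) = (\<lambda>t. exp (- \<kappa> * (x - t)) * \<bar>q t * dist u w\<bar>)"
    proof
      fix t
      have "exp (- \<kappa> * x) * exp (\<kappa> * t) = exp (- \<kappa> * (x - t))"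
        by (simp add: exp_add [symmetric] right_diff_distrib)
      then show "exp (- \<kappa> * x) * (exp (\<kappa> * t) * (q t * dist u w)) = exp (- \<kappa> * (x - t)) * \<bar>q t * dist u w\<bar>"
        using q0 [of t] by (simp add: mult.assoc [symmetric] abs_mult)
    qed
    also have "integral {0..x} (\<lambda>t. exp (- \<kappa> * (x - t)) * \<bar>q t * dist u w\<bar>) \<le> l2_norm (\<lambda>t. q t * dist u w) / sqrt (2 * \<kappa>)"
      by (intro integral_exp_mult_le \<kappa> qd sub)
    also have "\<dots> \<le> (dist u w * l2_norm q) / sqrt (2 * \<kappa>)"
      by (intro divide_right_mono l2_norm_mono q L2_measurable [OF qd]) (auto simp: abs_mult \<kappa>)
    also have "\<dots> \<le> 1 / 2 * dist u w"
    proof -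
      have "0 < 1 + 2 * l2_norm q" using l2_norm_nonneg [of q] by linarith
      then show ?thesis unfolding \<kappa> by (simp add: field_simps)
    qed
    finally show ?thesis .
  qed
  have clamp01: "clamp 0 1 x \<in> {0..1}" for x :: real
    using clamp_in_interval [of "0::real" 1 x] by auto
  have "dist (J u) (J w) \<le> 1 / 2 * dist u w" for u w
  proof (rule dist_bound)
    show "dist (apply_bcontfun (J u) x) (apply_bcontfun (J w) x) \<le> 1 / 2 * dist u w" for x
      using F_le [OF clamp01 [of x], of u w] by (simp only: J dist_norm [symmetric])
  qed
  then have "\<exists>!u. J u = u"
    by (intro banach_fix_type [of "1 / 2"]) auto
  then obtain u where u: "J u = u" by blast
  have "x \<in> {0..1} \<Longrightarrow> clamp 0 1 x = x" for x :: real
    by (simp add: clamp_cancel_cbox)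
  then have uF: "apply_bcontfun u x = F u x" if "x \<in> {0..1}" for x
    using J [of u x] that by (simp add: u)
  define y where "y = (\<lambda>x. if x \<in> {0..1} then E u x else 0)"
  have "y \<in> C0"
    using continuous_on_eq [OF E [of u], of y] by (simp add: C0_def y_def)
  have y_eq: "y x = v + integral {0..x} (rhs \<zeta> g y)" if x: "x \<in> {0..1}" for x
  proof -
    have "y x = exp (\<kappa> * x) *\<^sub>R F u x"
      using x uF [OF x] by (simp add: y_def E_def)
    also have "\<dots> = v + integral {0..x} (rhs \<zeta> g (E u))"
      by (simp add: F_def exp_add [symmetric])
    also have "integral {0..x} (rhs \<zeta> g (E u)) = integral {0..x} (rhs \<zeta> g y)"
      using x by (intro integral_cong) (simp add: rhs_def y_def)
    finally show ?thesis .
  qed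
  have "y 0 = v" using y_eq [of 0] by simp
  then have "sol \<zeta> g y" using \<open>y \<in> C0\<close> y_eq by (simp add: sol_def)
  then show thesis using that \<open>y 0 = v\<close> by blast
qed

text \<open>
  If the components in \<open>S\<close> decay and the others grow, then the values at \<open>0\<close> of the former and the
  values at \<open>1\<close> of the latter determine the solution up to a small error. Hence the boundary form
  controls the solution as soon as it is coercive in these values.
\<close>

lemma boundary_value_bound:
  fixes C D :: "complex^'n^'n" and S :: "'n set"
  assumes T: "\<And>v. norm v \<le> K\<^sub>T * norm (C *v (\<chi> i. if i \<in> S then v $ i else 0) + D *v (\<chi> i. if i \<in> S then 0 else v $ i))"
  obtains K s\<^sub>0 where "0 \<le> K" "0 < s\<^sub>0"
    "\<And>\<zeta> g y x s. \<lbrakk>s\<^sub>0 \<le> s; \<And>i. i \<in> S \<Longrightarrow> Re (\<i> * of_real (a i) * \<zeta>) \<le> - s;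
        \<And>i. i \<notin> S \<Longrightarrow> s \<le> Re (\<i> * of_real (a i) * \<zeta>); g \<in> L2; sol \<zeta> g y; x \<in> {0..1}\<rbrakk>
      \<Longrightarrow> norm (y x) \<le> K * (norm (C *v y 0 + D *v y 1) + l2_norm g / sqrt s)"
proof -
  define N where "N = real CARD('n)"
  have N: "1 \<le> N" by (simp add: N_def Suc_leI)
  define K\<^sub>1 where "K\<^sub>1 = N\<^sup>2 * (norm C + norm D) * N"
  define M where "M = \<bar>K\<^sub>T\<bar> * K\<^sub>1 + 1"
  define q where "q = 1 + \<alpha> * N * l2_norm Q"
  \<comment> \<open>For s \<ge> w^2 the solution re-enters its own estimate with a coefficient of at
    most 1 / 2: this is \<open>w * \<epsilon> \<le> 1\<close> below.\<close>
  define w where "w = 2 * N * M * q"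
  have K\<^sub>1: "0 \<le> K\<^sub>1" using N by (simp add: K\<^sub>1_def)
  have M: "1 \<le> M" using K\<^sub>1 by (simp add: M_def)
  have q: "1 \<le> q" using N \<alpha>_nonneg by (simp add: q_def)
  have w: "0 < w" using N M q by (simp add: w_def)
  define K where "K = 2 * N * \<bar>K\<^sub>T\<bar> + 2 * N * M * \<alpha>"
  have "norm (y x) \<le> K * (norm (C *v y 0 + D *v y 1) + l2_norm g / sqrt s)"
    if s: "w\<^sup>2 \<le> s" and dec: "\<And>i. i \<in> S \<Longrightarrow> Re (\<i> * of_real (a i) * \<zeta>) \<le> - s"
      and inc: "\<And>i. i \<notin> S \<Longrightarrow> s \<le> Re (\<i> * of_real (a i) * \<zeta>)"
      and g: "g \<in> L2" and y: "sol \<zeta> g y" and x: "x \<in> {0..1}" for \<zeta> g y x s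
  proof -
    define \<epsilon> where "\<epsilon> = 1 / sqrt (2 * s)"
    have s0: "0 < s" using s w by (smt (verit) zero_less_power2)
    have ws: "w \<le> sqrt (2 * s)" using s w s0 by (intro real_le_rsqrt) auto
    have \<epsilon>: "0 < \<epsilon>" "w * \<epsilon> \<le> 1" "exp (- s) \<le> \<epsilon>" "\<epsilon> \<le> 1 / sqrt s"
      using s0 ws exp_minus_le_inverse_sqrt [OF s0] by (auto simp: \<epsilon>_def divide_simps)
    have cont: "continuous_on {0..1} (\<lambda>t. norm (y t))"
      by (intro continuous_intros sol_continuous [OF y])
    then obtain z where z: "z \<in> {0..1}" "\<And>t. t \<in> {0..1} \<Longrightarrow> norm (y t) \<le> norm (y z)"
      using continuous_attains_sup [of "{0..1}" "\<lambda>t. norm (y t)"] by auto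
    define m where "m = norm (y z)"
    have m: "0 \<le> m" by (simp add: m_def)
    have y_le: "norm (y t) \<le> m" if "t \<in> {0..1}" for t
      using z(2) [OF that] by (simp add: m_def)
    define p where "p = (\<lambda>t. \<alpha> * (norm (g t) + real CARD('n) * m * norm (Q t)))"
    have p: "p \<in> L2" "l2_norm p \<le> \<alpha> * (l2_norm g + N * m * l2_norm Q)"
      using weight_L2 [OF g m] by (simp_all add: p_def N_def)
    define H where "H = l2_norm p / sqrt (2 * s)"
    have H: "0 \<le> H" "H \<le> \<epsilon> * (\<alpha> * (l2_norm g + N * m * l2_norm Q))"
      using p(2) s0 by (auto simp: H_def \<epsilon>_def divide_simps)
    have yi: "continuous_on {0..1} (\<lambda>x. y x $ i)" for i
      by (intro continuous_intros sol_continuous [OF y])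
    have frc': "norm (frc g y i t) \<le> p t" if "t \<in> {0..1}" for t i
      using frc_le [of y t 1 m g i] y_le [OF that] by (simp add: p_def)
    have fwd: "norm (y t $ i) \<le> exp (- s * t) * norm (y 0 $ i) + H" if i: "i \<in> S" and t: "t \<in> {0..1}" for i t
      using Duhamel_forward_bound [OF yi frc_L2 [OF g sol_continuous [OF y]] p(1) sol_component [OF y g] t, where \<kappa> = 0 and s = s]
        dec [OF i] s0 frc' by (simp add: H_def)
    have bwd: "norm (y t $ i) \<le> exp (- s * (1 - t)) * norm (y 1 $ i) + H" if i: "i \<notin> S" and t: "t \<in> {0..1}" for i t
      using Duhamel_backward_bound [OF yi frc_L2 [OF g sol_continuous [OF y]] p(1) sol_component [OF y g] t inc [OF i] s0 frc']
      by (simp add: H_def)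
    \<comment> \<open>Bound for the values at the far ends, where a component has decayed by exp
      (-s) up to the forcing term \<open>H\<close>.\<close>
    define \<eta> where "\<eta> = \<epsilon> * m + H"
    have \<eta>: "0 \<le> \<eta>" "H \<le> \<eta>" using \<epsilon> m H by (auto simp: \<eta>_def)
    have end_le: "exp (- s) * norm (y t $ i) \<le> \<epsilon> * m" if "t \<in> {0..1}" for t i
      using \<epsilon> y_le [OF that] Finite_Cartesian_Product.norm_nth_le [of "y t" i] by (intro mult_mono) auto
    \<comment> \<open>Each component is read off at the end from which it decays. The remainders
      \<open>r\<^sub>0\<close> and \<open>r\<^sub>1\<close> hold the values at the opposite ends and
      are of size \<eta>, so the coercive matrix acts on \<open>v\<close> up to a small
      error.\<close>
    define v where "v = (\<chi> i. if i \<in> S then y 0 $ i else y 1 $ i)"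
    define r\<^sub>0 where "r\<^sub>0 = (\<chi> i. if i \<in> S then 0 else y 0 $ i)"
    define r\<^sub>1 where "r\<^sub>1 = (\<chi> i. if i \<in> S then y 1 $ i else 0)"
    have "norm (r\<^sub>0 $ i) \<le> \<eta>" for i
      using bwd [of i 0] end_le [of 1 i] \<eta>(1) by (cases "i \<in> S") (auto simp: r\<^sub>0_def \<eta>_def)
    moreover have "norm (r\<^sub>1 $ i) \<le> \<eta>" for i
      using fwd [of i 1] end_le [of 0 i] \<eta>(1) by (cases "i \<in> S") (auto simp: r\<^sub>1_def \<eta>_def)
    ultimately have r: "norm r\<^sub>0 \<le> N * \<eta>" "norm r\<^sub>1 \<le> N * \<eta>"
      unfolding N_def by (intro norm_vec_le_card; simp)+
    have split0: "y 0 = (\<chi> i. if i \<in> S then v $ i else 0) + r\<^sub>0"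
      and split1: "y 1 = (\<chi> i. if i \<in> S then 0 else v $ i) + r\<^sub>1"
      by (simp_all add: vec_eq_iff v_def r\<^sub>0_def r\<^sub>1_def)
    define u where "u = C *v y 0 + D *v y 1"
    have "C *v (\<chi> i. if i \<in> S then v $ i else 0) + D *v (\<chi> i. if i \<in> S then 0 else v $ i) = u - (C *v r\<^sub>0 + D *v r\<^sub>1)"
      unfolding u_def split0 split1 by (simp add: matrix_vector_right_distrib)
    also have "norm \<dots> \<le> norm u + (norm (C *v r\<^sub>0) + norm (D *v r\<^sub>1))"
      by (rule order_trans [OF norm_triangle_ineq4 add_left_mono [OF norm_triangle_ineq]])
    also have "\<dots> \<le> norm u + (N\<^sup>2 * (norm C * (N * \<eta>)) + N\<^sup>2 * (norm D * (N * \<eta>)))"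
      unfolding N_def
      by (intro add_left_mono add_mono order_trans [OF norm_matrix_vector_le] mult_left_mono r [unfolded N_def]) auto
    also have "\<dots> = norm u + K\<^sub>1 * \<eta>" by (simp add: K\<^sub>1_def algebra_simps)
    finally have Tv: "norm (C *v (\<chi> i. if i \<in> S then v $ i else 0) + D *v (\<chi> i. if i \<in> S then 0 else v $ i)) \<le> norm u + K\<^sub>1 * \<eta>" .
    have v: "norm v \<le> \<bar>K\<^sub>T\<bar> * (norm u + K\<^sub>1 * \<eta>)"
      by (rule order_trans [OF T mult_mono [OF abs_ge_self Tv]]) auto
    have "m \<le> N * (norm v + H)"
      unfolding m_def N_def
    proof (rule norm_vec_le_card)
      fix i
      show "norm (y z $ i) \<le> norm v + H"
      proof (cases "i \<in> S")
        case True
        have "exp (- s * z) * norm (y 0 $ i) \<le> 1 * norm (v $ i)"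
          using s0 z(1) True by (intro mult_mono) (auto simp: v_def)
        then show ?thesis using fwd [OF True z(1)] Finite_Cartesian_Product.norm_nth_le [of v i] by linarith
      next
        case False
        have "exp (- s * (1 - z)) * norm (y 1 $ i) \<le> 1 * norm (v $ i)"
          using s0 z(1) False by (intro mult_mono) (auto simp: v_def)
        then show ?thesis using bwd [OF False z(1)] Finite_Cartesian_Product.norm_nth_le [of v i] by linarith
      qed
    qed
    also have "\<dots> \<le> N * (\<bar>K\<^sub>T\<bar> * (norm u + K\<^sub>1 * \<eta>) + \<eta>)"
      using v \<eta> N by (intro mult_left_mono add_mono) auto
    also have "\<dots> = N * \<bar>K\<^sub>T\<bar> * norm u + N * M * \<eta>"
      by (simp add: M_def algebra_simps)
    also have "\<dots> \<le> N * \<bar>K\<^sub>T\<bar> * norm u + N * M * (\<epsilon> * (m * q + \<alpha> * l2_norm g))"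
    proof -
      have "\<eta> \<le> \<epsilon> * (m * q + \<alpha> * l2_norm g)"
        using H(2) by (simp add: \<eta>_def q_def algebra_simps)
      then show ?thesis using N M by (intro add_left_mono mult_left_mono) auto
    qed
    also have "\<dots> = N * \<bar>K\<^sub>T\<bar> * norm u + (w * \<epsilon>) * m / 2 + N * M * \<alpha> * (\<epsilon> * l2_norm g)"
      by (simp add: w_def algebra_simps)
    also have "\<dots> \<le> N * \<bar>K\<^sub>T\<bar> * norm u + m / 2 + N * M * \<alpha> * (l2_norm g / sqrt s)"
    proof -
      have "(w * \<epsilon>) * m \<le> 1 * m" using \<epsilon> m by (intro mult_right_mono)
      moreover have "\<epsilon> * l2_norm g \<le> l2_norm g / sqrt s"
        using mult_right_mono [OF \<epsilon>(4), of "l2_norm g"] by simp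
      then have "N * M * \<alpha> * (\<epsilon> * l2_norm g) \<le> N * M * \<alpha> * (l2_norm g / sqrt s)"
        using N M \<alpha>_nonneg by (intro mult_left_mono) auto
      ultimately show ?thesis by simp
    qed
    finally have "m \<le> 2 * N * \<bar>K\<^sub>T\<bar> * norm u + 2 * N * M * \<alpha> * (l2_norm g / sqrt s)" by simp
    also have "\<dots> \<le> K * norm u + K * (l2_norm g / sqrt s)"
      using N M \<alpha>_nonneg s0 by (intro add_mono mult_right_mono) (auto simp: K_def)
    finally show ?thesis using y_le [OF x] by (simp add: u_def distrib_left)
  qed
  moreover have "0 \<le> K" using N M \<alpha>_nonneg by (simp add: K_def)
  moreover have "0 < w\<^sup>2" using w by simp
  ultimately show ?thesis using that by blast
qed

end

section \<open>Bounds for entire functions and determinants\<close>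

lemma entire_nonzero_nearby:
  fixes f :: "complex \<Rightarrow> complex"
  assumes f: "f holomorphic_on UNIV" and nz: "f \<beta> \<noteq> 0"
  obtains r where "0 < r" "\<And>w. w \<in> cball z r - {z} \<Longrightarrow> f w \<noteq> 0"
proof -
  have "\<exists>r>0. \<forall>w. w \<in> ball z r - {z} \<longrightarrow> f w \<noteq> 0"
  proof (cases "f z = 0")
    case True
    then show ?thesis
      using isolated_zeros [OF f open_UNIV connected_UNIV UNIV_I True UNIV_I nz] by metis
  next
    case False
    have "isCont f z"
      using holomorphic_on_imp_continuous_on [OF f] continuous_on_eq_continuous_at [OF open_UNIV] by blast
    then show ?thesis
      using continuous_at_avoid [of z f 0] False by (metis DiffE mem_ball)
  qed
  then obtain r where r: "r > 0" "\<forall>w. w \<in> ball z r - {z} \<longrightarrow> f w \<noteq> 0" by blast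
  show thesis
    by (rule that [of "r / 2"]) (use r in auto)
qed

text \<open>The zeros of \<open>f\<close> are isolated, so the continuous function \<open>g\<close>
  vanishes at them as well. This extends identities obtained by division by \<open>\<Delta>\<close>
  to the zeros of \<open>\<Delta>\<close>.\<close>

lemma entire_zero_extension:
  fixes f g :: "complex \<Rightarrow> complex"
  assumes f: "f holomorphic_on UNIV" and nz: "f \<beta> \<noteq> 0" and g: "g holomorphic_on UNIV"
    and gz: "\<And>z. f z \<noteq> 0 \<Longrightarrow> g z = 0"
  shows "g z = 0"
proof -
  obtain r where r: "0 < r" "\<And>w. w \<in> cball z r - {z} \<Longrightarrow> f w \<noteq> 0"
    using entire_nonzero_nearby [OF f nz] by metis
  have "eventually (\<lambda>w. w \<in> ball z r - {z}) (at z)"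
    using eventually_at_in_open [of "ball z r" z] r(1) by simp
  then have "eventually (\<lambda>w. g w = 0) (at z)"
    by eventually_elim (use r(2) gz in auto)
  then have "g \<midarrow>z\<rightarrow> 0"
    by (simp add: tendsto_eventually)
  moreover have "isCont g z"
    using holomorphic_on_imp_continuous_on [OF g] continuous_on_eq_continuous_at [OF open_UNIV] by blast
  ultimately show ?thesis
    using LIM_unique isCont_def by blast
qed

text \<open>
  Horizontal translates of \<open>\<Delta>\<close> form a normal family whose limits do not vanish identically, so the
  zeros of \<open>\<Delta>\<close> can be surrounded by circles of a uniform size on which \<open>\<Delta>\<close> is bounded away from zero.
\<close>

lemma quotient_bounded_on_strip:
  fixes F \<Delta> \<Psi> :: "complex \<Rightarrow> complex"
  assumes F: "F holomorphic_on UNIV" and \<Delta>: "\<Delta> holomorphic_on UNIV"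
    and eq: "\<And>z. F z * \<Delta> z = \<Psi> z"
    and bounds: "\<And>T. \<exists>M. \<forall>z. \<bar>Im z\<bar> \<le> T \<longrightarrow> norm (\<Delta> z) \<le> M \<and> norm (\<Psi> z) \<le> M"
    and c: "0 < c" "\<And>z. Im z = \<tau> \<Longrightarrow> c \<le> norm (\<Delta> z)"
  shows "\<exists>M. \<forall>z. \<bar>Im z\<bar> \<le> T \<longrightarrow> norm (F z) \<le> M"
proof (rule ccontr)
  assume "\<not> ?thesis"
  then have "\<forall>n::nat. \<exists>z. \<bar>Im z\<bar> \<le> T \<and> real n < norm (F z)"
    by (meson not_le)
  then obtain Z where Z: "\<And>n. \<bar>Im (Z n)\<bar> \<le> T" "\<And>n::nat. real n < norm (F (Z n))"
    by metis
  have ZT: "\<forall>n. Im (Z n) \<in> {- T..T}"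
  proof
    show "Im (Z n) \<in> {- T..T}" for n
      using Z(1) [of n] unfolding atLeastAtMost_iff by linarith
  qed
  obtain y s where y: "strict_mono (s :: nat \<Rightarrow> nat)" "((\<lambda>n. Im (Z n)) \<circ> s) \<longlonglongrightarrow> y"
    by (rule seq_compactE [OF compact_imp_seq_compact [OF compact_Icc] ZT])
  \<comment> \<open>Real parts are translated away. The remaining imaginary parts converge to
    \<open>y\<close>, so the translated points tend to the single point \<open>p\<close> defined
    below.\<close>
  define G where "G = (\<lambda>n z. \<Delta> (z + of_real (Re (Z (s n)))))"
  have hol_shift: "(\<lambda>z. f (z + of_real t)) holomorphic_on A" if "f holomorphic_on UNIV" for f t A
    using holomorphic_on_compose [OF _ holomorphic_on_subset [OF that], of "\<lambda>z. z + of_real t" A]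
    by (simp add: o_def holomorphic_intros)
  obtain g r where g: "g holomorphic_on UNIV" and r: "strict_mono (r :: nat \<Rightarrow> nat)"
    and lim: "\<And>x. ((\<lambda>n. G (r n) x) \<longlongrightarrow> g x) sequentially"
    and unif: "\<And>K. compact K \<Longrightarrow> uniform_limit K (G \<circ> r) g sequentially"
  proof (rule Montel [of UNIV "range G" G])
    show "h holomorphic_on UNIV" if "h \<in> range G" for h
      using that hol_shift [OF \<Delta>] by (auto simp: G_def)
    show "\<exists>B. \<forall>h\<in>range G. \<forall>z\<in>K. norm (h z) \<le> B" if K: "compact K" for K
    proof -
      obtain b where b: "\<And>z. z \<in> K \<Longrightarrow> norm z \<le> b"
        using compact_imp_bounded [OF K] bounded_iff by metis
      obtain M where M: "\<And>z. \<bar>Im z\<bar> \<le> b \<Longrightarrow> norm (\<Delta> z) \<le> M"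
        using bounds by metis
      have "\<forall>h\<in>range G. \<forall>z\<in>K. norm (h z) \<le> M"
        using b abs_Im_le_cmod by (fastforce simp: G_def intro!: M elim: order_trans)
      then show ?thesis by blast
    qed
  qed (use that in auto)
  \<comment> \<open>The lower bound on the line \<open>Im z = \<tau>\<close> is invariant under
    horizontal translation and survives the limit; hence \<open>g\<close> does not vanish
    identically.\<close>
  define \<beta> where "\<beta> = Complex 0 \<tau>"
  have "c \<le> norm (g \<beta>)"
    by (rule tendsto_lowerbound [OF tendsto_norm [OF lim]])
      (auto simp: G_def \<beta>_def intro!: always_eventually c(2))
  then have "g \<beta> \<noteq> 0" using c(1) by auto
  define p where "p = Complex 0 y"
  obtain \<rho> where \<rho>: "0 < \<rho>" "\<And>w. w \<in> cball p \<rho> - {p} \<Longrightarrow> g w \<noteq> 0"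
    using entire_nonzero_nearby [OF g \<open>g \<beta> \<noteq> 0\<close>] by metis
  have "continuous_on (sphere p \<rho>) (\<lambda>z. norm (g z))"
    using g holomorphic_on_imp_continuous_on continuous_on_subset by (intro continuous_intros) blast
  then obtain q where q: "q \<in> sphere p \<rho>" "\<And>z. z \<in> sphere p \<rho> \<Longrightarrow> norm (g q) \<le> norm (g z)"
    using continuous_attains_inf [of "sphere p \<rho>" "\<lambda>z. norm (g z)"] \<rho>(1) by (auto simp: less_imp_le)
  define \<delta> where "\<delta> = norm (g q) / 2"
  have \<delta>: "0 < \<delta>" using \<rho>(2) [of q] q(1) \<rho>(1) by (auto simp: \<delta>_def)
  obtain M where M: "\<And>z. \<bar>Im z\<bar> \<le> \<bar>y\<bar> + \<rho> \<Longrightarrow> norm (\<Psi> z) \<le> M"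
    using bounds by metis
  have "\<forall>\<^sub>F n in sequentially. \<forall>z\<in>sphere p \<rho>. dist ((G \<circ> r) n z) (g z) < \<delta>"
    using uniform_limitD [OF unif \<delta>] by simp
  moreover have "(\<lambda>n. Im (Z (s (r n)))) \<longlonglongrightarrow> y"
    using LIMSEQ_subseq_LIMSEQ [OF y(2) r] by (simp add: o_def)
  then have "\<forall>\<^sub>F n in sequentially. dist (Im (Z (s (r n)))) y < \<rho>"
    using \<rho>(1) by (rule tendstoD)
  moreover have "\<forall>\<^sub>F n in sequentially. M / \<delta> < real n"
    using filterlim_real_sequentially by (simp add: filterlim_at_top_dense)
  ultimately have "\<forall>\<^sub>F n in sequentially. False"
  proof eventually_elim
    case (elim n)
    define t where "t = Re (Z (s (r n)))"
    define w where "w = Complex 0 (Im (Z (s (r n))))"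
    \<comment> \<open>On the circle around \<open>p\<close> the translate of \<open>\<Delta>\<close>
      stays above \<delta> by uniform convergence, so the quotient is at most M / \<delta> there
      and, by the maximum principle, inside. The point Z (s (r n)) lies inside, where the quotient
      exceeds \<open>n\<close>.\<close>
    have "norm (F (w + of_real t)) \<le> M / \<delta>"
    proof (rule maximum_modulus_frontier [of "\<lambda>z. F (z + of_real t)" "ball p \<rho>"])
      show "(\<lambda>z. F (z + of_real t)) holomorphic_on interior (ball p \<rho>)"
        by (rule hol_shift [OF F])
      show "continuous_on (closure (ball p \<rho>)) (\<lambda>z. F (z + of_real t))"
        by (intro holomorphic_on_imp_continuous_on hol_shift [OF F])
      have "w - p = \<i> * of_real (Im (Z (s (r n))) - y)"
        by (simp add: w_def p_def complex_eq_iff)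
      then have "norm (w - p) = \<bar>Im (Z (s (r n))) - y\<bar>"
        by (simp add: norm_mult del: of_real_diff)
      then show "w \<in> ball p \<rho>"
        using elim(2) by (simp add: dist_real_def dist_norm norm_minus_commute [of p])
      fix z assume "z \<in> frontier (ball p \<rho>)"
      then have z: "z \<in> sphere p \<rho>" using \<rho>(1) by simp
      have "2 * \<delta> \<le> norm (g z)" using q(2) [OF z] by (simp add: \<delta>_def)
      moreover have "dist (G (r n) z) (g z) < \<delta>" using elim(1) z by simp
      then have "norm (g z) \<le> norm (G (r n) z) + \<delta>"
        by (smt (verit) dist_norm norm_minus_commute norm_triangle_ineq2)
      ultimately have low: "\<delta> \<le> norm (\<Delta> (z + of_real t))"
        by (simp add: G_def t_def)
      have "\<bar>Im z - y\<bar> \<le> \<rho>"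
        using z abs_Im_le_cmod [of "z - p"] by (simp add: dist_norm norm_minus_commute p_def)
      then have "norm (F (z + of_real t)) * norm (\<Delta> (z + of_real t)) \<le> M"
        unfolding norm_mult [symmetric] eq by (intro M) auto
      moreover have "norm (F (z + of_real t)) * \<delta> \<le> norm (F (z + of_real t)) * norm (\<Delta> (z + of_real t))"
        by (intro mult_left_mono low) auto
      ultimately show "norm (F (z + of_real t)) \<le> M / \<delta>"
        using \<delta> by (simp add: pos_le_divide_eq)
    qed simp
    also have "w + of_real t = Z (s (r n))"
      by (simp add: w_def t_def complex_eq_iff)
    finally have "norm (F (Z (s (r n)))) \<le> M / \<delta>" .
    moreover have "real n \<le> real (s (r n))"
      using y(1) r by (meson of_nat_mono order_trans seq_suble strict_mono_less_eq)
    ultimately show ?case using Z(2) [of "s (r n)"] elim(3) by linarith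
  qed
  then show False by simp
qed

section \<open>Determinants with one distinguished column, and lower bounds from coercivity\<close>

lemma norm_det_le:
  fixes A :: "complex^'n^'n"
  assumes W: "\<And>i. norm (A $ i $ k) \<le> W" and K: "\<And>i j. j \<noteq> k \<Longrightarrow> norm (A $ i $ j) \<le> K" "1 \<le> K"
  shows "norm (det A) \<le> real (card {p. p permutes (UNIV :: 'n set)}) * (W * K ^ CARD('n))"
  unfolding det_def
proof (rule sum_norm_bound)
  fix p assume "p \<in> {p. p permutes (UNIV :: 'n set)}"
  then have p: "p permutes UNIV" by simp
  define i\<^sub>0 where "i\<^sub>0 = inv p k"
  have pi: "p i\<^sub>0 = k" using p by (simp add: i\<^sub>0_def permutes_inverses)
  have W0: "0 \<le> W" using W norm_ge_zero order_trans by blast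
  have "norm (of_int (sign p) * (\<Prod>i\<in>UNIV. A $ i $ p i)) = (\<Prod>i\<in>UNIV. norm (A $ i $ p i))"
    by (simp add: norm_mult prod_norm [symmetric] sign_def)
  \<comment> \<open>Each permutation meets column \<open>k\<close> in exactly one row, so its bound
    \<open>W\<close> enters linearly. In Cramer's numerators this column carries the
    inhomogeneity.\<close>
  also have "\<dots> = norm (A $ i\<^sub>0 $ k) * (\<Prod>i\<in>UNIV - {i\<^sub>0}. norm (A $ i $ p i))"
    by (subst prod.remove [of _ i\<^sub>0]) (auto simp: pi)
  also have "\<dots> \<le> W * K ^ CARD('n)"
  proof (rule mult_mono [OF W _ W0 prod_nonneg])
    have "(\<Prod>i\<in>UNIV - {i\<^sub>0}. norm (A $ i $ p i)) \<le> (\<Prod>i\<in>UNIV - {i\<^sub>0}. K)"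
    proof (rule prod_mono)
      fix i assume "i \<in> UNIV - {i\<^sub>0}"
      then have "p i \<noteq> k" using permutes_inj [OF p] pi by (auto dest: injD)
      then show "0 \<le> norm (A $ i $ p i) \<and> norm (A $ i $ p i) \<le> K" using K(1) by simp
    qed
    also have "\<dots> \<le> K ^ CARD('n)"
      using K(2) by (auto simp: intro!: power_increasing)
    finally show "(\<Prod>i\<in>UNIV - {i\<^sub>0}. norm (A $ i $ p i)) \<le> K ^ CARD('n)" .
  qed simp
  finally show "norm (of_int (sign p) * (\<Prod>i\<in>UNIV. A $ i $ p i)) \<le> W * K ^ CARD('n)" .
qed

lemma det_nonzero_iff_kernel:
  fixes A :: "complex^'n^'n"
  shows "det A \<noteq> 0 \<longleftrightarrow> (\<forall>v. A *v v = 0 \<longrightarrow> v = 0)"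
  using invertible_det_nz [of A] invertible_left_inverse [of A] matrix_left_invertible_ker [of A] by simp

text \<open>Coercivity bounds the entries of the inverse matrix uniformly, hence its determinant
  from above; the two determinants have product 1.\<close>

lemma det_bounded_below:
  fixes A :: "'a \<Rightarrow> complex^'n^'n"
  assumes A: "\<And>z v. z \<in> S \<Longrightarrow> norm v \<le> K * norm (A z *v v)"
  obtains c where "0 < c" "\<And>z. z \<in> S \<Longrightarrow> c \<le> norm (det (A z))"
proof -
  define L where "L = max 1 K"
  define c where "c = real (card {p. p permutes (UNIV :: 'n set)}) * (L * L ^ CARD('n))"
  have "{p. p permutes (UNIV :: 'n set)} \<noteq> {}" using permutes_id by blast
  then have "0 < card {p. p permutes (UNIV :: 'n set)}"
    using finite_permutations [of "UNIV :: 'n set"] by (simp add: card_gt_0_iff)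
  then have c: "0 < c" by (simp add: c_def L_def)
  have "1 / c \<le> norm (det (A z))" if z: "z \<in> S" for z
  proof -
    have "det (A z) \<noteq> 0"
      unfolding det_nonzero_iff_kernel
    proof (intro allI impI)
      fix v assume "A z *v v = 0"
      then show "v = 0" using A [OF z, of v] by simp
    qed
    then obtain B where B: "A z ** B = mat 1"
      using invertible_det_nz invertible_def by blast
    have B_le: "norm (B $ i $ j) \<le> L" for i j
    proof -
      have "norm (B *v axis j 1) \<le> K * norm (A z *v (B *v axis j 1))"
        by (rule A [OF z])
      also have "A z *v (B *v axis j 1) = axis j 1"
        by (simp add: matrix_vector_mul_assoc B)
      finally have "norm (B *v axis j 1) \<le> L"
        by (simp add: L_def)
      moreover have "(B *v axis j 1) $ i = B $ i $ j"
        by (simp add: matrix_vector_mult_def axis_def if_distrib cong: if_cong)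
      ultimately show ?thesis
        using Finite_Cartesian_Product.norm_nth_le [of "B *v axis j 1" i] by simp
    qed
    have "norm (det B) \<le> c"
      unfolding c_def by (rule norm_det_le [where k = undefined]) (auto simp: B_le, simp add: L_def)
    moreover have "det (A z) * det B = 1"
      by (simp add: det_mul [symmetric] B)
    then have "norm (det (A z)) * norm (det B) = 1"
      by (metis norm_mult norm_one)
    ultimately have "1 \<le> norm (det (A z)) * c"
      by (metis mult_left_mono norm_ge_zero)
    then show ?thesis using c by (simp add: pos_divide_le_eq)
  qed
  then show thesis using that [of "1 / c"] c by auto
qed

lemma holomorphic_on_det:
  fixes A :: "complex \<Rightarrow> complex^'n^'n"
  assumes "\<And>i j. (\<lambda>z. A z $ i $ j) holomorphic_on S"
  shows "(\<lambda>z. det (A z)) holomorphic_on S"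
  unfolding det_def by (intro holomorphic_intros assms)

section \<open>Dependence on the spectral parameter\<close>

text \<open>Covers both kinds of functional applied to solutions: components of the boundary form,
  which use point values, and restrictions of continuous functionals on L2. Analyticity in \<zeta>
  is proved once for the whole class.\<close>

definition sup_functional :: "((real \<Rightarrow> complex^'n) \<Rightarrow> complex) \<Rightarrow> bool" where
  "sup_functional \<psi> \<longleftrightarrow>
    (\<forall>y\<in>C0. \<forall>z\<in>C0. \<psi> (y + z) = \<psi> y + \<psi> z) \<and> (\<forall>c. \<forall>y\<in>C0. \<psi> (fscale c y) = c * \<psi> y) \<and>
    (\<exists>K\<ge>0. \<forall>y\<in>C0. \<forall>M. (\<forall>x\<in>{0..1}. norm (y x) \<le> M) \<longrightarrow> norm (\<psi> y) \<le> K * M)"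

lemma sup_functional_add: "sup_functional \<psi> \<Longrightarrow> y \<in> C0 \<Longrightarrow> z \<in> C0 \<Longrightarrow> \<psi> (y + z) = \<psi> y + \<psi> z"
  and sup_functional_fscale: "sup_functional \<psi> \<Longrightarrow> y \<in> C0 \<Longrightarrow> \<psi> (fscale c y) = c * \<psi> y"
  by (simp_all add: sup_functional_def)

lemma sup_functional_bound:
  assumes "sup_functional \<psi>"
  obtains K where "0 \<le> K" "\<And>y M. y \<in> C0 \<Longrightarrow> (\<And>x. x \<in> {0..1} \<Longrightarrow> norm (y x) \<le> M) \<Longrightarrow> norm (\<psi> y) \<le> K * M"
  using assms unfolding sup_functional_def by metis

lemma sup_functional_zero: "sup_functional \<psi> \<Longrightarrow> \<psi> 0 = 0"
  using sup_functional_fscale [of \<psi> 0 0] by simp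

lemma C0_sum: "(\<And>i. i \<in> I \<Longrightarrow> y i \<in> C0) \<Longrightarrow> sum y I \<in> C0"
  by (induction I rule: infinite_finite_induct) (auto intro: C0_add)

lemma sup_functional_sum:
  "sup_functional \<psi> \<Longrightarrow> (\<And>i. i \<in> I \<Longrightarrow> y i \<in> C0) \<Longrightarrow> \<psi> (sum y I) = (\<Sum>i\<in>I. \<psi> (y i))"
proof (induction I rule: infinite_finite_induct)
  case (insert i I)
  have "\<psi> (y i + sum y I) = \<psi> (y i) + \<psi> (sum y I)"
    by (intro sup_functional_add insert.prems C0_sum) auto
  with insert show ?case by (simp only: sum.insert insert_iff simp_thms)
qed (simp_all add: sup_functional_zero)

context first_order_system
begin

definition solve :: "complex \<Rightarrow> (real \<Rightarrow> complex^'n) \<Rightarrow> complex^'n \<Rightarrow> real \<Rightarrow> complex^'n" where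
  "solve \<zeta> g v = (THE y. sol \<zeta> g y \<and> y 0 = v)"

text \<open>The solution operator with zero initial value, a right inverse of the differential
  expression minus \<zeta>. Taylor series of solutions in the spectral parameter are Neumann series
  in it.\<close>

abbreviation volterra :: "complex \<Rightarrow> (real \<Rightarrow> complex^'n) \<Rightarrow> real \<Rightarrow> complex^'n" where
  "volterra \<zeta> g \<equiv> solve \<zeta> g 0"

lemma
  assumes "g \<in> L2"
  shows sol_solve: "sol \<zeta> g (solve \<zeta> g v)" and solve_initial: "solve \<zeta> g v 0 = v"
proof -
  have "\<exists>!y. sol \<zeta> g y \<and> y 0 = v"
    using sol_exists [OF assms] sol_unique [OF _ _ assms] by (metis (full_types))
  from theI' [OF this] show "sol \<zeta> g (solve \<zeta> g v)" "solve \<zeta> g v 0 = v"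
    by (simp_all add: solve_def)
qed

lemma solve_C0: "g \<in> L2 \<Longrightarrow> solve \<zeta> g v \<in> C0"
  using sol_solve sol_C0 by blast

lemma solve_unique: "sol \<zeta> g y \<Longrightarrow> g \<in> L2 \<Longrightarrow> y 0 = v \<Longrightarrow> solve \<zeta> g v = y"
  by (rule sol_unique) (simp_all add: sol_solve solve_initial)

lemma solve_add:
  "g \<in> L2 \<Longrightarrow> h \<in> L2 \<Longrightarrow> solve \<zeta> (g + h) (v + w) = solve \<zeta> g v + solve \<zeta> h w"
  by (intro solve_unique sol_add sol_solve L2_fplus) (simp_all add: solve_initial)

lemma solve_fscale:
  "g \<in> L2 \<Longrightarrow> solve \<zeta> (fscale c g) (c *s v) = fscale c (solve \<zeta> g v)"
  by (intro solve_unique sol_fscale sol_solve L2_fscale) (simp_all add: solve_initial fscale_def)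

lemma solve_split: "g \<in> L2 \<Longrightarrow> solve \<zeta> g v = volterra \<zeta> g + solve \<zeta> 0 v"
  using solve_add [of g 0 \<zeta> 0 v] by simp

lemma solve_zero: "solve \<zeta> 0 0 = 0"
  by (rule solve_unique [OF sol_zero]) simp_all

text \<open>A solution for \<zeta> + z solves the equation for \<zeta> with the additional
  inhomogeneity \<open>z\<close> times itself.\<close>

lemma solve_shift:
  assumes g: "g \<in> L2"
  shows "solve (\<zeta> + z) g v = solve \<zeta> g v + fscale z (volterra \<zeta> (solve (\<zeta> + z) g v))"
proof -
  define y where "y = solve (\<zeta> + z) g v"
  have y: "sol (\<zeta> + z) g y" "y 0 = v" "y \<in> L2"
    using sol_solve [OF g] solve_initial [OF g] C0_L2 [OF solve_C0 [OF g]] by (auto simp: y_def)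
  have "sol \<zeta> (g + fscale z y) y"
    using y(1) sol_shift [of "\<zeta> + z" g y \<zeta>] by simp
  then have "y = solve \<zeta> (g + fscale z y) (v + z *s 0)"
    using y g by (intro solve_unique [symmetric]) (auto intro: L2_fplus L2_fscale)
  also have "\<dots> = solve \<zeta> g v + fscale z (volterra \<zeta> y)"
    using solve_add [OF g L2_fscale [OF y(3)], of \<zeta> z v "z *s 0"] solve_fscale [OF y(3), of \<zeta> z 0] by simp
  finally show ?thesis by (simp add: y_def)
qed

lemma volterra_power_C0: "y \<in> C0 \<Longrightarrow> (volterra \<zeta> ^^ k) y \<in> C0"
  by (induction k) (auto intro: solve_C0 C0_L2)

lemma volterra_add: "g \<in> L2 \<Longrightarrow> h \<in> L2 \<Longrightarrow> volterra \<zeta> (g + h) = volterra \<zeta> g + volterra \<zeta> h"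
  using solve_add [of g h \<zeta> 0 0] by simp

lemma volterra_fscale: "g \<in> L2 \<Longrightarrow> volterra \<zeta> (fscale c g) = fscale c (volterra \<zeta> g)"
  using solve_fscale [of g \<zeta> c 0] by simp

lemma volterra_power_add:
  "y \<in> C0 \<Longrightarrow> z \<in> C0 \<Longrightarrow> (volterra \<zeta> ^^ k) (y + z) = (volterra \<zeta> ^^ k) y + (volterra \<zeta> ^^ k) z"
  by (induction k) (auto simp: volterra_add C0_L2 volterra_power_C0)

lemma volterra_power_fscale:
  "y \<in> C0 \<Longrightarrow> (volterra \<zeta> ^^ k) (fscale c y) = fscale c ((volterra \<zeta> ^^ k) y)"
  by (induction k) (auto simp: volterra_fscale C0_L2 volterra_power_C0)

text \<open>\<open>solve_shift\<close> iterated \<open>n\<close> times. The remainder is exact and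
  contains the solution at the shifted parameter, so it can be estimated without knowing that the
  series converges.\<close>

lemma solve_taylor:
  assumes g: "g \<in> L2"
  shows "solve (\<zeta> + z) g v = (\<Sum>k<n. fscale (z ^ k) ((volterra \<zeta> ^^ k) (solve \<zeta> g v))) +
    fscale (z ^ n) ((volterra \<zeta> ^^ n) (solve (\<zeta> + z) g v))"
proof (induction n)
  case 0
  then show ?case by (simp add: fscale_def)
next
  case (Suc n)
  let ?y = "solve (\<zeta> + z) g v" and ?u = "solve \<zeta> g v"
  have C: "?y \<in> C0" "?u \<in> C0" "volterra \<zeta> ?y \<in> C0"
    using g by (auto intro!: solve_C0 C0_L2)
  have "(volterra \<zeta> ^^ n) ?y = (volterra \<zeta> ^^ n) (?u + fscale z (volterra \<zeta> ?y))"
    using arg_cong [OF solve_shift [OF g, of \<zeta> z v], of "volterra \<zeta> ^^ n"] .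
  also have "\<dots> = (volterra \<zeta> ^^ n) ?u + fscale z ((volterra \<zeta> ^^ n) (volterra \<zeta> ?y))"
    using C by (simp add: volterra_power_add volterra_power_fscale C0_fscale)
  also have "(volterra \<zeta> ^^ n) (volterra \<zeta> ?y) = (volterra \<zeta> ^^ Suc n) ?y"
    using funpow_swap1 [of "volterra \<zeta>" n ?y] by simp
  finally have step: "fscale (z ^ n) ((volterra \<zeta> ^^ n) ?y) =
      fscale (z ^ n) ((volterra \<zeta> ^^ n) ?u) + fscale (z ^ Suc n) ((volterra \<zeta> ^^ Suc n) ?y)"
    by (simp only: fun_vs.scale_right_distrib fun_vs.scale_scale power_Suc2)
  show ?case
    unfolding sum.lessThan_Suc add.assoc step [symmetric] by (rule Suc.IH)
qed

lemma volterra_bound: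
  obtains K where "0 \<le> K" "\<And>\<zeta> g x. \<lbrakk>\<bar>Im \<zeta>\<bar> \<le> T; g \<in> L2; x \<in> {0..1}\<rbrakk> \<Longrightarrow> norm (volterra \<zeta> g x) \<le> K * l2_norm g"
proof (rule initial_value_bound [of T])
  fix K assume "0 \<le> K" and
    K: "\<And>\<zeta> g y x. \<lbrakk>\<bar>Im \<zeta>\<bar> \<le> T; g \<in> L2; sol \<zeta> g y; x \<in> {0..1}\<rbrakk> \<Longrightarrow> norm (y x) \<le> K * (norm (y 0) + l2_norm g)"
  show thesis
  proof (rule that [OF \<open>0 \<le> K\<close>])
    show "norm (volterra \<zeta> g x) \<le> K * l2_norm g" if "\<bar>Im \<zeta>\<bar> \<le> T" "g \<in> L2" "x \<in> {0..1}" for \<zeta> g x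
      using K [OF that(1,2) sol_solve [OF that(2)] that(3), of 0] by (simp add: solve_initial that(2))
  qed
qed

text \<open>With \<open>K\<close> the bound of the Volterra operator, the remainder in
  \<open>solve_taylor\<close> is at most a constant times (|z| K)^n, which tends to zero for |z| < 1
  / (K + 1). Besides analyticity this identifies every coefficient.\<close>

lemma solve_expansion:
  assumes \<psi>: "sup_functional \<psi>" and g: "g \<in> L2"
  shows "(\<lambda>z. \<psi> (solve (\<zeta> + z) g v)) has_fps_expansion Abs_fps (\<lambda>k. \<psi> ((volterra \<zeta> ^^ k) (solve \<zeta> g v)))"
proof (rule volterra_bound [of "\<bar>Im \<zeta>\<bar>"])
  fix K assume K0: "0 \<le> K" and
    K: "\<And>\<mu> g x. \<lbrakk>\<bar>Im \<mu>\<bar> \<le> \<bar>Im \<zeta>\<bar>; g \<in> L2; x \<in> {0..1}\<rbrakk> \<Longrightarrow> norm (volterra \<mu> g x) \<le> K * l2_norm g"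
  obtain K' where K': "0 \<le> K'" "\<And>y M. y \<in> C0 \<Longrightarrow> (\<And>x. x \<in> {0..1} \<Longrightarrow> norm (y x) \<le> M) \<Longrightarrow> norm (\<psi> y) \<le> K' * M"
    using sup_functional_bound [OF \<psi>] by blast
  have pow: "norm ((volterra \<zeta> ^^ k) y x) \<le> K ^ k * M"
    if y: "y \<in> C0" "\<And>x. x \<in> {0..1} \<Longrightarrow> norm (y x) \<le> M" and x: "x \<in> {0..1}" for k y M x
    using x
  proof (induction k arbitrary: x)
    case (Suc k)
    let ?u = "(volterra \<zeta> ^^ k) y"
    have u: "?u \<in> L2" by (intro C0_L2 volterra_power_C0 y)
    have "norm (volterra \<zeta> ?u x) \<le> K * l2_norm ?u" by (intro K u Suc) simp
    also have "\<dots> \<le> K * (K ^ k * M)"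
      by (intro mult_left_mono l2_norm_le_sup L2_measurable u Suc.IH K0)
    finally show ?case by simp
  qed (use y in auto)
  show ?thesis
  proof (rule has_fps_expansionI)
    have "eventually (\<lambda>z::complex. z \<in> ball 0 (1 / (K + 1))) (nhds 0)"
      using K0 by (intro eventually_nhds_in_open) (auto simp: add_nonneg_pos)
    then show "\<forall>\<^sub>F z in nhds 0. (\<lambda>n. fps_nth (Abs_fps (\<lambda>k. \<psi> ((volterra \<zeta> ^^ k) (solve \<zeta> g v)))) n * z ^ n)
        sums \<psi> (solve (\<zeta> + z) g v)"
    proof eventually_elim
      case (elim z)
      define y where "y = solve (\<zeta> + z) g v"
      define u where "u = (\<lambda>k. (volterra \<zeta> ^^ k) (solve \<zeta> g v))"
      have y: "y \<in> C0" and u: "u k \<in> C0" for k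
        using g by (auto simp: y_def u_def intro!: solve_C0 volterra_power_C0)
      have "bounded (y ` {0..1})"
        using y by (intro compact_imp_bounded compact_continuous_image) (auto simp: C0_def)
      \<comment> \<open>This bound may depend on \<open>z\<close>: the remainder is sent to zero for
        each fixed \<open>z\<close>.\<close>
      then obtain M where M: "\<And>x. x \<in> {0..1} \<Longrightarrow> norm (y x) \<le> M"
        unfolding bounded_iff by blast
      have "0 \<le> M" using M [of 0] norm_ge_zero [of "y 0"] by (simp del: norm_ge_zero)
      have zK: "norm z * K < 1"
      proof -
        have "norm z * (K + 1) < 1" using elim K0 by (simp add: field_simps)
        then show ?thesis using norm_ge_zero [of z] unfolding distrib_left by linarith
      qed
      have "(\<Sum>k<n. \<psi> (u k) * z ^ k) = \<psi> y - z ^ n * \<psi> ((volterra \<zeta> ^^ n) y)" for n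
      proof -
        have "\<psi> y = \<psi> ((\<Sum>k<n. fscale (z ^ k) (u k)) + fscale (z ^ n) ((volterra \<zeta> ^^ n) y))"
          unfolding y_def u_def by (subst solve_taylor [OF g, of _ _ _ n]) simp
        also have "\<dots> = (\<Sum>k<n. z ^ k * \<psi> (u k)) + z ^ n * \<psi> ((volterra \<zeta> ^^ n) y)"
          by (simp add: sup_functional_add [OF \<psi>] sup_functional_sum [OF \<psi>] sup_functional_fscale [OF \<psi>]
              C0_sum C0_fscale volterra_power_C0 u y)
        finally show ?thesis by (simp add: mult.commute)
      qed
      moreover have "(\<lambda>n. \<psi> y - z ^ n * \<psi> ((volterra \<zeta> ^^ n) y)) \<longlonglongrightarrow> \<psi> y - 0"
      proof (intro tendsto_diff tendsto_const)
        have "(\<lambda>n. K' * M * (norm z * K) ^ n) \<longlonglongrightarrow> K' * M * 0"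
          using zK K0 by (intro tendsto_mult tendsto_const LIMSEQ_power_zero) auto
        then have "(\<lambda>n. K' * M * (norm z * K) ^ n) \<longlonglongrightarrow> 0" by simp
        then show "(\<lambda>n. z ^ n * \<psi> ((volterra \<zeta> ^^ n) y)) \<longlonglongrightarrow> 0"
        proof (rule Lim_null_comparison [rotated])
          have "norm (z ^ n * \<psi> ((volterra \<zeta> ^^ n) y)) \<le> K' * M * (norm z * K) ^ n" for n
          proof -
            have "norm (\<psi> ((volterra \<zeta> ^^ n) y)) \<le> K' * (K ^ n * M)"
              using y M by (intro K' volterra_power_C0 pow) auto
            then have "norm z ^ n * norm (\<psi> ((volterra \<zeta> ^^ n) y)) \<le> norm z ^ n * (K' * (K ^ n * M))"
              by (intro mult_left_mono) auto
            then show ?thesis by (simp add: norm_mult norm_power power_mult_distrib mult_ac)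
          qed
          then show "\<forall>\<^sub>F n in sequentially. norm (z ^ n * \<psi> ((volterra \<zeta> ^^ n) y)) \<le> K' * M * (norm z * K) ^ n"
            by (intro always_eventually allI)
        qed
      qed
      ultimately have "(\<lambda>n. \<Sum>k<n. \<psi> (u k) * z ^ k) \<longlonglongrightarrow> \<psi> y" by simp
      then show ?case by (simp add: sums_def u_def y_def)
    qed
  qed
qed

lemma solve_holomorphic:
  assumes "sup_functional \<psi>" "g \<in> L2"
  shows "(\<lambda>\<zeta>. \<psi> (solve \<zeta> g v)) holomorphic_on A"
proof -
  have "(\<lambda>\<zeta>. \<psi> (solve \<zeta> g v)) analytic_on {\<zeta>}" for \<zeta>
    by (rule has_fps_expansion_imp_analytic [OF solve_expansion [OF assms]])
  then have "(\<lambda>\<zeta>. \<psi> (solve \<zeta> g v)) analytic_on A"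
    using analytic_on_analytic_at by blast
  then show ?thesis by (rule analytic_imp_holomorphic)
qed

end

section \<open>The boundary value problem\<close>

lemma injective_imp_coercive:
  fixes f :: "'a::euclidean_space \<Rightarrow> 'b::euclidean_space"
  assumes "linear f" "\<And>v. f v = 0 \<Longrightarrow> v = 0"
  obtains K where "\<And>v. norm v \<le> K * norm (f v)"
proof -
  obtain B where "B > 0" "\<And>v. B * norm v \<le> norm (f v)"
    using linear_inj_bounded_below_pos [OF assms(1)] linear_injective_0 [OF assms(1)] assms(2) by blast
  then have "norm v \<le> (1 / B) * norm (f v)" for v
    by (simp add: field_simps)
  then show thesis using that by blast
qed

text \<open>By linearity and the norm bound the values at functions of L2 that agree almost
  everywhere coincide, so these are the continuous functionals on the space of classes.\<close>

definition l2_functional :: "((real \<Rightarrow> complex^'n) \<Rightarrow> complex) \<Rightarrow> bool" where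
  "l2_functional \<phi> \<longleftrightarrow>
    (\<forall>y\<in>L2. \<forall>z\<in>L2. \<phi> (y + z) = \<phi> y + \<phi> z) \<and> (\<forall>c. \<forall>y\<in>L2. \<phi> (fscale c y) = c * \<phi> y) \<and>
    (\<exists>K\<ge>0. \<forall>y\<in>L2. norm (\<phi> y) \<le> K * l2_norm y)"

lemma l2_functional_add: "l2_functional \<phi> \<Longrightarrow> y \<in> L2 \<Longrightarrow> z \<in> L2 \<Longrightarrow> \<phi> (y + z) = \<phi> y + \<phi> z"
  and l2_functional_fscale: "l2_functional \<phi> \<Longrightarrow> y \<in> L2 \<Longrightarrow> \<phi> (fscale c y) = c * \<phi> y"
  by (simp_all add: l2_functional_def)

lemma l2_functional_bound:
  assumes "l2_functional \<phi>"
  obtains K where "0 \<le> K" "\<And>y. y \<in> L2 \<Longrightarrow> norm (\<phi> y) \<le> K * l2_norm y"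
  using assms unfolding l2_functional_def by metis

lemma l2_functional_diff:
  assumes "l2_functional \<phi>" "y \<in> L2" "z \<in> L2"
  shows "\<phi> (y - z) = \<phi> y - \<phi> z"
  using l2_functional_add [OF assms(1) L2_fdiff [OF assms(2,3)] assms(3)] by simp

lemma l2_functional_imp_sup_functional:
  assumes "l2_functional \<phi>"
  shows "sup_functional \<phi>"
proof -
  obtain K where K: "0 \<le> K" "\<And>y. y \<in> L2 \<Longrightarrow> norm (\<phi> y) \<le> K * l2_norm y"
    using l2_functional_bound [OF assms] by blast
  have "norm (\<phi> y) \<le> K * M" if "y \<in> C0" "\<forall>x\<in>{0..1}. norm (y x) \<le> M" for y M
  proof -
    have "l2_norm y \<le> M"
      using that by (intro l2_norm_le_sup L2_measurable C0_L2) auto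
    then show ?thesis
      using K(2) [OF C0_L2 [OF that(1)]] mult_left_mono [OF _ K(1)] by (meson order_trans)
  qed
  with K(1) show ?thesis
    using assms unfolding sup_functional_def by (auto intro!: l2_functional_add l2_functional_fscale C0_L2)
qed

text \<open>Vanishing at both ends puts the approximants into the domain of the operator whatever
  \<open>C\<close> and \<open>D\<close> are; this gives density of the range of the
  resolvent.\<close>

lemma polynomial_dense_L2:
  fixes g :: "real \<Rightarrow> complex^'n"
  assumes g: "g \<in> L2" and e: "0 < e"
  obtains p p' where "\<And>x. (p has_vector_derivative p' x) (at x)" "continuous_on UNIV p'"
    "p 0 = 0" "p 1 = 0" "l2_norm (\<lambda>x. g x - p x) < e"
proof -
  obtain k where k: "continuous_on UNIV k" "l2_norm (\<lambda>x. g x - k x) < e / 3"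
    using continuous_dense_L2 [OF g, of "e / 3"] e by auto
  have k01: "continuous_on {0..1} k" using k(1) continuous_on_subset by blast
  obtain q where q: "polynomial_function q" "\<And>x. x \<in> {0..1} \<Longrightarrow> norm (k x - q x) < e / 3"
    using Stone_Weierstrass_polynomial_function [OF compact_Icc k01, of "e / 3"] e by auto
  obtain q' where q': "polynomial_function q'" "\<And>x. (q has_vector_derivative q' x) (at x)"
    using has_vector_derivative_polynomial_function [OF q(1)] by blast
  have cq: "continuous_on A q" "continuous_on A q'" for A
    using q(1) q'(1) by (auto intro: continuous_on_polymonial_function)
  \<comment> \<open>A polynomial cut-off that tends to 1 inside the interval. The exponent
    \<open>Suc n\<close> rather than \<open>n\<close> makes it vanish at 0 and 1 for every
    \<open>n\<close>, including 0.\<close>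
  define \<eta> :: "nat \<Rightarrow> real \<Rightarrow> real" where "\<eta> = (\<lambda>n x. 1 - (1 - x) ^ Suc n - x ^ Suc n)"
  define \<eta>' :: "nat \<Rightarrow> real \<Rightarrow> real" where "\<eta>' = (\<lambda>n x. real (Suc n) * (1 - x) ^ n - real (Suc n) * x ^ n)"
  have d\<eta>: "(\<eta> n has_real_derivative \<eta>' n x) (at x)" for n x
    unfolding \<eta>_def \<eta>'_def by (rule derivative_eq_intros refl | simp add: algebra_simps)+
  have cont\<eta>: "continuous_on A (\<eta> n)" for n A
    unfolding \<eta>_def by (intro continuous_intros)
  define P where "P = (\<lambda>n x. \<eta> n x *\<^sub>R q x)"
  define P' where "P' = (\<lambda>n x. \<eta> n x *\<^sub>R q' x + \<eta>' n x *\<^sub>R q x)"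
  have dP: "(P n has_vector_derivative P' n x) (at x)" for n x
    unfolding P_def P'_def by (rule has_vector_derivative_scaleR [OF d\<eta> q'(2)])
  have cP': "continuous_on UNIV (P' n)" for n
    unfolding P'_def \<eta>_def \<eta>'_def by (intro continuous_intros cq)
  have cP: "continuous_on A (P n)" for n A
    unfolding P_def by (intro continuous_intros cq cont\<eta>)
  have qL: "q \<in> L2" and PL: "P n \<in> L2" for n
    by (intro continuous_imp_L2 cq cP)+
  have "(\<lambda>n. l2_norm (\<lambda>x. q x - P n x)) \<longlonglongrightarrow> 0"
  proof (rule l2_norm_tendsto_0 [where g = "\<lambda>x. 2 *\<^sub>R q x"])
    show "(\<lambda>x. 2 *\<^sub>R q x) \<in> L2"
      by (intro continuous_imp_L2 continuous_intros cq)
    have eq: "q x - P n x = ((1 - x) ^ Suc n + x ^ Suc n) *\<^sub>R q x" for n x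
      by (simp add: P_def \<eta>_def algebra_simps)
    define Z where "Z = {0, 1 :: real}"
    have "negligible Z" by (simp add: Z_def negligible_finite)
    then have "AE x in lebesgue. x \<notin> Z"
      by (simp add: negligible_iff_null_sets AE_not_in)
    then have "AE x in lebesgue_on {0..1}. x \<notin> Z"
      by (auto simp: AE_restrict_space_iff)
    then show "AE x in lebesgue_on {0..1}. (\<lambda>n. q x - P n x) \<longlonglongrightarrow> 0"
    proof (rule AE_mp, intro AE_I2 impI)
      fix x :: real assume "x \<in> space (lebesgue_on {0..1})" "x \<notin> Z"
      then have x: "0 < x" "x < 1" by (auto simp: Z_def)
      have "(\<lambda>n. ((1 - x) ^ Suc n + x ^ Suc n) *\<^sub>R q x) \<longlonglongrightarrow> (0 + 0) *\<^sub>R q x"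
        using x by (intro tendsto_intros LIMSEQ_Suc LIMSEQ_power_zero) auto
      then show "(\<lambda>n. q x - P n x) \<longlonglongrightarrow> 0" unfolding eq by simp
    qed
    show "norm (q x - P n x) \<le> norm (2 *\<^sub>R q x)" if "x \<in> {0..1}" for n x
    proof -
      have "(1 - x) ^ Suc n \<le> 1" "x ^ Suc n \<le> 1" "0 \<le> (1 - x) ^ Suc n" "0 \<le> x ^ Suc n"
        using that by (auto intro!: power_le_one simp del: power_Suc)
      then show ?thesis unfolding eq norm_scaleR by (intro mult_right_mono) (auto simp del: power_Suc)
    qed
  qed (intro L2_measurable L2_diff qL PL)
  then have "\<forall>\<^sub>F n in sequentially. l2_norm (\<lambda>x. q x - P n x) < e / 3"
    by (rule order_tendstoD) (use e in simp)
  then obtain n where n: "l2_norm (\<lambda>x. q x - P n x) < e / 3"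
    using eventually_happens' [OF sequentially_bot] by blast
  have kL: "k \<in> L2" by (intro continuous_imp_L2 k01)
  have "l2_norm (\<lambda>x. k x - q x) \<le> e / 3"
    using q(2) by (intro l2_norm_le_sup L2_measurable L2_diff kL qL) (auto intro: less_imp_le)
  moreover have "l2_norm (\<lambda>x. (k x - q x) + (q x - P n x)) \<le> l2_norm (\<lambda>x. k x - q x) + l2_norm (\<lambda>x. q x - P n x)"
    by (intro l2_norm_triangle L2_diff kL qL PL)
  moreover have "l2_norm (\<lambda>x. (g x - k x) + (k x - P n x)) \<le> l2_norm (\<lambda>x. g x - k x) + l2_norm (\<lambda>x. k x - P n x)"
    by (intro l2_norm_triangle L2_diff kL g PL)
  ultimately have "l2_norm (\<lambda>x. g x - P n x) < e"
    using k(2) n by simp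
  then show thesis
    by (intro that [of "P n" "P' n"] dP cP') (auto simp: P_def \<eta>_def)
qed

lemma fps_mult_nth_less_subdegree:
  fixes F G :: "'a::comm_ring_1 fps"
  assumes "k < subdegree F"
  shows "fps_nth (F * G) k = 0"
  unfolding fps_mult_nth
proof (intro sum.neutral ballI)
  fix i assume "i \<in> {0..k}"
  then have "fps_nth F i = 0"
    using assms by (intro nth_less_subdegree_zero) simp
  then show "fps_nth F i * fps_nth G (k - i) = 0" by simp
qed

context first_order_system
begin

lemma sol_sum:
  "(\<And>i. i \<in> I \<Longrightarrow> sol \<zeta> (g i) (y i)) \<Longrightarrow> (\<And>i. i \<in> I \<Longrightarrow> g i \<in> L2) \<Longrightarrow> sol \<zeta> (sum g I) (sum y I)"
proof (induction I rule: infinite_finite_induct)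
  case (insert i I)
  have "sol \<zeta> (g i + sum g I) (y i + sum y I)"
    using insert by (intro sol_add) (auto intro!: fun_vs.subspace_sum [OF subspace_L2])
  then show ?case unfolding sum.insert [OF insert.hyps] .
qed (simp_all add: sol_zero)

lemma solve_sum:
  "finite I \<Longrightarrow> solve \<zeta> 0 (\<Sum>j\<in>I. c j *s v j) = (\<Sum>j\<in>I. fscale (c j) (solve \<zeta> 0 (v j)))"
proof (induction I rule: finite_induct)
  case empty
  then show ?case by (simp only: sum.empty solve_zero)
next
  case (insert i I)
  have "solve \<zeta> (0 + 0) (c i *s v i + (\<Sum>j\<in>I. c j *s v j)) =
      solve \<zeta> 0 (c i *s v i) + solve \<zeta> 0 (\<Sum>j\<in>I. c j *s v j)"
    by (rule solve_add) simp_all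
  moreover have "solve \<zeta> (fscale (c i) 0) (c i *s v i) = fscale (c i) (solve \<zeta> 0 (v i))"
    by (rule solve_fscale) simp
  ultimately show ?case
    using insert.IH unfolding sum.insert [OF insert.hyps] by (simp only: add_0 fun_vs.scale_zero_right)
qed

lemma sup_functional_solve:
  assumes "sup_functional \<psi>"
  shows "\<psi> (solve \<zeta> 0 v) = (\<Sum>j\<in>UNIV. v $ j * \<psi> (solve \<zeta> 0 (axis j 1)))"
proof -
  have "\<psi> (solve \<zeta> 0 v) = \<psi> (\<Sum>j\<in>UNIV. fscale (v $ j) (solve \<zeta> 0 (axis j 1)))"
    by (subst basis_expansion [of v, symmetric]) (simp only: solve_sum finite)
  also have "\<dots> = (\<Sum>j\<in>UNIV. v $ j * \<psi> (solve \<zeta> 0 (axis j 1)))"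
    by (subst sup_functional_sum [OF assms])
      (auto intro!: C0_fscale solve_C0 sum.cong sup_functional_fscale [OF assms])
  finally show ?thesis .
qed

lemma sup_functional_solve_bound:
  assumes "sup_functional \<psi>"
  obtains K where "0 \<le> K"
    "\<And>\<zeta> g v. \<lbrakk>\<bar>Im \<zeta>\<bar> \<le> T; g \<in> L2\<rbrakk> \<Longrightarrow> norm (\<psi> (solve \<zeta> g v)) \<le> K * (norm v + l2_norm g)"
proof (rule initial_value_bound [of T])
  fix K assume K0: "0 \<le> K" and
    K: "\<And>\<zeta> g y x. \<lbrakk>\<bar>Im \<zeta>\<bar> \<le> T; g \<in> L2; sol \<zeta> g y; x \<in> {0..1}\<rbrakk> \<Longrightarrow> norm (y x) \<le> K * (norm (y 0) + l2_norm g)"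
  obtain K' where K': "0 \<le> K'" "\<And>y M. y \<in> C0 \<Longrightarrow> (\<And>x. x \<in> {0..1} \<Longrightarrow> norm (y x) \<le> M) \<Longrightarrow> norm (\<psi> y) \<le> K' * M"
    using sup_functional_bound [OF assms] by blast
  show thesis
  proof (rule that)
    show "0 \<le> K' * K" using K0 K' by simp
    fix \<zeta> v and g :: "real \<Rightarrow> complex^'n"
    assume *: "\<bar>Im \<zeta>\<bar> \<le> T" "g \<in> L2"
    have "norm (\<psi> (solve \<zeta> g v)) \<le> K' * (K * (norm v + l2_norm g))"
      using K [OF * sol_solve [OF *(2)], of _ v]
      by (intro K' solve_C0 *) (simp add: solve_initial [OF *(2)])
    then show "norm (\<psi> (solve \<zeta> g v)) \<le> K' * K * (norm v + l2_norm g)"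
      by (simp add: mult.assoc)
  qed
qed

end

text \<open>The two assumptions are the injectivity of T_+ and T_-, with the spectral projectors
  written as coordinate cut-offs according to the sign of \<open>a i\<close>.\<close>

locale boundary_value_problem = first_order_system a Q
  for a :: "'n::finite \<Rightarrow> real" and Q :: "real \<Rightarrow> complex^'n^'n" +
  fixes C D :: "complex^'n^'n"
  assumes regular_plus:
      "C *v (\<chi> i. if 0 < a i then v $ i else 0) + D *v (\<chi> i. if 0 < a i then 0 else v $ i) = 0 \<Longrightarrow> v = 0"
    and regular_minus:
      "C *v (\<chi> i. if a i < 0 then v $ i else 0) + D *v (\<chi> i. if a i < 0 then 0 else v $ i) = 0 \<Longrightarrow> v = 0"
begin

section \<open>The boundary form and the resolvent bound away from the real axis\<close>

definition bdry :: "(real \<Rightarrow> complex^'n) \<Rightarrow> complex^'n" where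
  "bdry y = C *v y 0 + D *v y 1"

lemma bdry_add: "bdry (y + z) = bdry y + bdry z"
  by (simp add: bdry_def matrix_vector_right_distrib)

lemma bdry_fscale: "bdry (fscale c y) = c *s bdry y"
  by (simp add: bdry_def fscale_def vector_scalar_commute vector_add_ldistrib)

lemma sup_functional_bdry: "sup_functional (\<lambda>y. bdry y $ i)"
proof -
  have "norm (bdry y $ i) \<le> real CARD('n) * (norm C + norm D) * M"
    if "\<forall>x\<in>{0..1}. norm (y x) \<le> M" for y M
  proof -
    have "norm (bdry y $ i) \<le> norm ((C *v y 0) $ i) + norm ((D *v y 1) $ i)"
      by (simp add: bdry_def norm_triangle_ineq)
    also have "\<dots> \<le> real CARD('n) * (norm C * M) + real CARD('n) * (norm D * M)"
      using that by (intro add_mono order_trans [OF norm_matrix_vector_nth_le] mult_left_mono) auto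
    finally show ?thesis by (simp add: algebra_simps)
  qed
  moreover have "0 \<le> real CARD('n) * (norm C + norm D)" by simp
  ultimately show ?thesis
    unfolding sup_functional_def
    by (intro conjI ballI allI exI [of _ "real CARD('n) * (norm C + norm D)"] impI) (simp_all add: bdry_add bdry_fscale)
qed

text \<open>The real part of \<i> \<open>a i\<close> \<zeta> is -\<open>a i\<close>
  \<open>Im \<zeta>\<close>. So in the upper half plane the components with positive
  \<open>a i\<close> decay and \<open>regular_plus\<close> applies; in the lower one
  \<open>regular_minus\<close> does. The smallest |\<open>a i\<close>| converts
  |\<open>Im \<zeta>\<close>| into the rate of decay.\<close>

lemma resolvent_bound:
  obtains K \<tau> where "0 \<le> K" "0 < \<tau>"
    "\<And>\<zeta> g y x. \<lbrakk>\<tau> \<le> \<bar>Im \<zeta>\<bar>; g \<in> L2; sol \<zeta> g y; x \<in> {0..1}\<rbrakk> \<Longrightarrow>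
      norm (y x) \<le> K * (norm (bdry y) + l2_norm g / sqrt \<bar>Im \<zeta>\<bar>)"
proof -
  define \<delta> where "\<delta> = Min (range (\<lambda>i. \<bar>a i\<bar>))"
  have \<delta>: "0 < \<delta>" "\<delta> \<le> \<bar>a i\<bar>" for i
    using a_nonzero by (auto simp: \<delta>_def)
  have lin: "linear (\<lambda>v :: complex^'n. C *v (\<chi> i. if P i then v $ i else 0) + D *v (\<chi> i. if P i then 0 else v $ i))"
    for P :: "'n \<Rightarrow> bool"
    by (rule linearI) (auto simp: matrix_vector_mult_def vec_eq_iff sum.distrib [symmetric] scaleR_sum_right
        algebra_simps intro!: sum.cong)
  obtain K1 where K1: "\<And>v. norm v \<le> K1 * norm (C *v (\<chi> i. if i \<in> {i. 0 < a i} then v $ i else 0) + D *v (\<chi> i. if i \<in> {i. 0 < a i} then 0 else v $ i))"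
    using injective_imp_coercive [OF lin [of "\<lambda>i. 0 < a i"]] regular_plus unfolding mem_Collect_eq by blast
  obtain K2 where K2: "\<And>v. norm v \<le> K2 * norm (C *v (\<chi> i. if i \<in> {i. a i < 0} then v $ i else 0) + D *v (\<chi> i. if i \<in> {i. a i < 0} then 0 else v $ i))"
    using injective_imp_coercive [OF lin [of "\<lambda>i. a i < 0"]] regular_minus unfolding mem_Collect_eq by blast
  obtain L1 s1 where L1: "0 \<le> L1" "0 < s1" and b1:
    "\<And>\<zeta> g y x s. \<lbrakk>s1 \<le> s; \<And>i. i \<in> {i. 0 < a i} \<Longrightarrow> Re (\<i> * of_real (a i) * \<zeta>) \<le> - s;
        \<And>i. i \<notin> {i. 0 < a i} \<Longrightarrow> s \<le> Re (\<i> * of_real (a i) * \<zeta>); g \<in> L2; sol \<zeta> g y; x \<in> {0..1}\<rbrakk>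
      \<Longrightarrow> norm (y x) \<le> L1 * (norm (C *v y 0 + D *v y 1) + l2_norm g / sqrt s)"
    using boundary_value_bound [OF K1] by metis
  obtain L2' s2 where L2': "0 \<le> L2'" "0 < s2" and b2:
    "\<And>\<zeta> g y x s. \<lbrakk>s2 \<le> s; \<And>i. i \<in> {i. a i < 0} \<Longrightarrow> Re (\<i> * of_real (a i) * \<zeta>) \<le> - s;
        \<And>i. i \<notin> {i. a i < 0} \<Longrightarrow> s \<le> Re (\<i> * of_real (a i) * \<zeta>); g \<in> L2; sol \<zeta> g y; x \<in> {0..1}\<rbrakk>
      \<Longrightarrow> norm (y x) \<le> L2' * (norm (C *v y 0 + D *v y 1) + l2_norm g / sqrt s)"
    using boundary_value_bound [OF K2] by metis
  define L where "L = L1 + L2'"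
  define \<tau> where "\<tau> = (s1 + s2) / \<delta>"
  define K where "K = L * (1 + 1 / sqrt \<delta>)"
  have "norm (y x) \<le> K * (norm (bdry y) + l2_norm g / sqrt \<bar>Im \<zeta>\<bar>)"
    if \<zeta>: "\<tau> \<le> \<bar>Im \<zeta>\<bar>" and g: "g \<in> L2" and y: "sol \<zeta> g y" and x: "x \<in> {0..1}" for \<zeta> g y x
  proof -
    define s where "s = \<delta> * \<bar>Im \<zeta>\<bar>"
    have s: "s1 \<le> s" "s2 \<le> s"
      using \<zeta> \<delta>(1) L1 L2' by (auto simp: s_def \<tau>_def field_simps)
    have Re_eq: "Re (\<i> * of_real (a i) * \<zeta>) = - (a i * Im \<zeta>)" for i by simp
    have prod: "s \<le> \<bar>a i * Im \<zeta>\<bar>" for i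
      unfolding s_def abs_mult by (intro mult_right_mono \<delta>) auto
    have "norm (y x) \<le> L * (norm (bdry y) + l2_norm g / sqrt s)"
    proof (cases "0 < Im \<zeta>")
      case True
      have "norm (y x) \<le> L1 * (norm (C *v y 0 + D *v y 1) + l2_norm g / sqrt s)"
      proof (rule b1 [OF s(1) _ _ g y x])
        show "Re (\<i> * of_real (a i) * \<zeta>) \<le> - s" if "i \<in> {i. 0 < a i}" for i
          using prod [of i] that True unfolding Re_eq by (simp add: abs_mult)
        show "s \<le> Re (\<i> * of_real (a i) * \<zeta>)" if "i \<notin> {i. 0 < a i}" for i
          using prod [of i] that True unfolding Re_eq by (simp add: abs_mult)
      qed
      also have "\<dots> \<le> L * (norm (C *v y 0 + D *v y 1) + l2_norm g / sqrt s)"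
        using L1 L2' s by (intro mult_right_mono) (auto simp: L_def)
      finally show ?thesis by (simp add: bdry_def)
    next
      case False
      then have neg: "Im \<zeta> < 0" using s(1) L1(2) by (auto simp: s_def not_less order_le_less)
      have "norm (y x) \<le> L2' * (norm (C *v y 0 + D *v y 1) + l2_norm g / sqrt s)"
      proof (rule b2 [OF s(2) _ _ g y x])
        show "Re (\<i> * of_real (a i) * \<zeta>) \<le> - s" if "i \<in> {i. a i < 0}" for i
          using prod [of i] that neg unfolding Re_eq by (simp add: abs_mult)
        show "s \<le> Re (\<i> * of_real (a i) * \<zeta>)" if "i \<notin> {i. a i < 0}" for i
          using prod [of i] that neg unfolding Re_eq by (simp add: abs_mult)
      qed
      also have "\<dots> \<le> L * (norm (C *v y 0 + D *v y 1) + l2_norm g / sqrt s)"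
        using L1 L2' s by (intro mult_right_mono) (auto simp: L_def)
      finally show ?thesis by (simp add: bdry_def)
    qed
    also have "\<dots> \<le> L * ((1 + 1 / sqrt \<delta>) * (norm (bdry y) + l2_norm g / sqrt \<bar>Im \<zeta>\<bar>))"
    proof (rule mult_left_mono)
      have "sqrt s = sqrt \<delta> * sqrt \<bar>Im \<zeta>\<bar>" by (simp add: s_def real_sqrt_mult)
      then have "l2_norm g / sqrt s = 1 / sqrt \<delta> * (l2_norm g / sqrt \<bar>Im \<zeta>\<bar>)" by simp
      moreover have "0 \<le> l2_norm g / sqrt \<bar>Im \<zeta>\<bar>" "0 \<le> 1 / sqrt \<delta> * norm (bdry y)" using \<delta>(1) by simp_all
      ultimately show "norm (bdry y) + l2_norm g / sqrt s \<le> (1 + 1 / sqrt \<delta>) * (norm (bdry y) + l2_norm g / sqrt \<bar>Im \<zeta>\<bar>)"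
        unfolding distrib_left distrib_right by linarith
    qed (use L1 L2' in \<open>simp add: L_def\<close>)
    finally show ?thesis by (simp add: K_def mult.assoc)
  qed
  moreover have "0 \<le> K" "0 < \<tau>" using L1 L2' \<delta>(1) by (auto simp: K_def L_def \<tau>_def)
  ultimately show thesis using that by blast
qed

section \<open>The characteristic determinant and Cramer's rule for the resolvent\<close>

definition char_matrix :: "complex \<Rightarrow> complex^'n^'n" where
  "char_matrix \<zeta> = (\<chi> i j. bdry (solve \<zeta> 0 (axis j 1)) $ i)"

definition \<Delta> :: "complex \<Rightarrow> complex" where
  "\<Delta> \<zeta> = det (char_matrix \<zeta>)"

text \<open>The numerators of Cramer's rule for \<open>char_matrix \<zeta> *v c = bdry (volterra \<zeta> g)\<close>.\<close>

definition num :: "complex \<Rightarrow> (real \<Rightarrow> complex^'n) \<Rightarrow> complex^'n" where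
  "num \<zeta> g = (\<chi> k. det (\<chi> i j. if j = k then bdry (volterra \<zeta> g) $ i else char_matrix \<zeta> $ i $ j))"

text \<open>At a zero of \<open>\<Delta>\<close> the quotient is 0 by convention and the value is
  merely \<open>volterra \<zeta> g\<close>; the boundary condition is solved where
  \<open>\<Delta> \<zeta> \<noteq> 0\<close>.\<close>

definition resolvent :: "complex \<Rightarrow> (real \<Rightarrow> complex^'n) \<Rightarrow> real \<Rightarrow> complex^'n" where
  "resolvent \<zeta> g = solve \<zeta> g (\<chi> k. - (num \<zeta> g $ k / \<Delta> \<zeta>))"

text \<open>In terms of the fundamental matrix \<Phi> with \<Phi>(0) = I, the characteristic matrix
  is C + D \<Phi>(1), and its kernel consists of the initial values of eigenfunctions.\<close>

lemma bdry_solve_zero: "bdry (solve \<zeta> 0 v) = char_matrix \<zeta> *v v"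
  using sup_functional_solve [OF sup_functional_bdry, where \<zeta> = \<zeta> and v = v]
  by (simp add: vec_eq_iff matrix_vector_mult_def char_matrix_def mult.commute)

lemma bdry_solve: "g \<in> L2 \<Longrightarrow> bdry (solve \<zeta> g v) = bdry (volterra \<zeta> g) + char_matrix \<zeta> *v v"
  by (subst solve_split) (simp_all add: bdry_add bdry_solve_zero)

lemma char_matrix_holomorphic: "(\<lambda>\<zeta>. char_matrix \<zeta> $ i $ j) holomorphic_on A"
  unfolding char_matrix_def vec_lambda_beta
  by (rule solve_holomorphic [OF sup_functional_bdry L2_zero(1)])

lemma \<Delta>_holomorphic: "\<Delta> holomorphic_on A"
  unfolding \<Delta>_def [abs_def] by (intro holomorphic_on_det char_matrix_holomorphic)

lemma num_holomorphic:
  assumes "g \<in> L2"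
  shows "(\<lambda>\<zeta>. num \<zeta> g $ k) holomorphic_on A"
proof -
  have "(\<lambda>\<zeta>. (\<chi> i j. if j = k then bdry (volterra \<zeta> g) $ i else char_matrix \<zeta> $ i $ j) $ i $ j) holomorphic_on A" for i j
    using solve_holomorphic [OF sup_functional_bdry assms] char_matrix_holomorphic by (cases "j = k") simp_all
  then show ?thesis
    unfolding num_def by (simp add: holomorphic_on_det)
qed

text \<open>Solutions correspond to their initial values, so the boundary condition is a linear
  system for \<open>y 0\<close> with matrix \<open>char_matrix \<zeta>\<close> and right-hand side
  minus the boundary value of the Volterra solution.\<close>

lemma sol_bdry_zero_iff:
  assumes g: "g \<in> L2" and \<Delta>: "\<Delta> \<zeta> \<noteq> 0"
  shows "sol \<zeta> g y \<and> bdry y = 0 \<longleftrightarrow> y = resolvent \<zeta> g"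
proof -
  define c where "c = (\<chi> k. num \<zeta> g $ k / \<Delta> \<zeta>)"
  have c: "char_matrix \<zeta> *v v = bdry (volterra \<zeta> g) \<longleftrightarrow> v = c" for v
    using cramer [of "char_matrix \<zeta>" v "bdry (volterra \<zeta> g)"] \<Delta> by (simp add: \<Delta>_def num_def c_def)
  have res: "resolvent \<zeta> g = solve \<zeta> g (- c)"
    unfolding resolvent_def by (rule arg_cong [where f = "solve \<zeta> g"]) (simp add: c_def vec_eq_iff)
  have neg: "char_matrix \<zeta> *v (- v) = - (char_matrix \<zeta> *v v)" for v
    by (simp add: matrix_vector_mult_def vec_eq_iff sum_negf)
  have "bdry (solve \<zeta> g (- c)) = 0"
    unfolding bdry_solve [OF g, where v = "- c"] neg using c [of c] by simp
  moreover have "y = solve \<zeta> g (- c)" if y: "sol \<zeta> g y" "bdry y = 0"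
  proof -
    have y': "solve \<zeta> g (y 0) = y" by (rule solve_unique [OF y(1) g refl])
    have "bdry (volterra \<zeta> g) + char_matrix \<zeta> *v (y 0) = 0"
      using y(2) bdry_solve [OF g, where \<zeta> = \<zeta> and v = "y 0"] by (simp add: y')
    then have "char_matrix \<zeta> *v (- y 0) = bdry (volterra \<zeta> g)"
      unfolding neg by (simp add: add_eq_0_iff)
    then have "y 0 = - c" using c by (metis add.inverse_inverse)
    then show ?thesis using y' by simp
  qed
  ultimately show ?thesis
    unfolding res using sol_solve [OF g] by blast
qed

text \<open>For \<open>g = 0\<close> and \<open>x = 0\<close> the resolvent bound says that
  \<open>char_matrix \<zeta>\<close> is coercive, with a constant independent of \<zeta>.\<close>

lemma \<Delta>_bounded_below:
  obtains c \<tau> where "0 < c" "0 < \<tau>" "\<And>\<zeta>. \<tau> \<le> \<bar>Im \<zeta>\<bar> \<Longrightarrow> c \<le> norm (\<Delta> \<zeta>)"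
proof (rule resolvent_bound)
  fix K \<tau> assume K0: "0 \<le> K" and \<tau>: "0 < \<tau>" and
    K: "\<And>\<zeta> g y x. \<lbrakk>\<tau> \<le> \<bar>Im \<zeta>\<bar>; g \<in> L2; sol \<zeta> g y; x \<in> {0..1}\<rbrakk> \<Longrightarrow>
      norm (y x) \<le> K * (norm (bdry y) + l2_norm g / sqrt \<bar>Im \<zeta>\<bar>)"
  have "norm v \<le> K * norm (char_matrix \<zeta> *v v)" if "\<zeta> \<in> {\<zeta>. \<tau> \<le> \<bar>Im \<zeta>\<bar>}" for \<zeta> v
    using K [OF _ L2_zero(1) sol_solve [OF L2_zero(1)], of \<zeta> 0 v] that
    by (simp add: solve_initial bdry_solve_zero l2_norm_def)
  then obtain c where "0 < c" "\<And>\<zeta>. \<zeta> \<in> {\<zeta>. \<tau> \<le> \<bar>Im \<zeta>\<bar>} \<Longrightarrow> c \<le> norm (det (char_matrix \<zeta>))"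
    using det_bounded_below [of "{\<zeta>. \<tau> \<le> \<bar>Im \<zeta>\<bar>}" K char_matrix] by blast
  then show thesis using \<tau> by (intro that [of c \<tau>]) (auto simp: \<Delta>_def)
qed

lemma \<Delta>_nontrivial: obtains \<beta> where "\<Delta> \<beta> \<noteq> 0"
proof (rule \<Delta>_bounded_below)
  fix c \<tau> assume c: "0 < c" and \<tau>: "0 < \<tau>" and le: "\<And>\<zeta>. \<tau> \<le> \<bar>Im \<zeta>\<bar> \<Longrightarrow> c \<le> norm (\<Delta> \<zeta>)"
  have "\<Delta> (Complex 0 \<tau>) \<noteq> 0" using le [of "Complex 0 \<tau>"] c \<tau> by auto
  then show thesis by (rule that)
qed

text \<open>Cramer's rule with the denominator cleared. Both sides are entire, so it persists at the
  zeros of \<open>\<Delta>\<close>, where it is put to use.\<close>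

lemma char_matrix_num:
  assumes g: "g \<in> L2"
  shows "(\<Sum>k\<in>UNIV. num \<zeta> g $ k * char_matrix \<zeta> $ i $ k) = \<Delta> \<zeta> * bdry (volterra \<zeta> g) $ i"
proof -
  obtain \<beta> where \<beta>: "\<Delta> \<beta> \<noteq> 0" by (rule \<Delta>_nontrivial)
  have "(\<Sum>k\<in>UNIV. num \<zeta> g $ k * char_matrix \<zeta> $ i $ k) - \<Delta> \<zeta> * bdry (volterra \<zeta> g) $ i = 0"
  proof (rule entire_zero_extension [OF \<Delta>_holomorphic \<beta>, where z = \<zeta>
        and g = "\<lambda>\<zeta>. (\<Sum>k\<in>UNIV. num \<zeta> g $ k * char_matrix \<zeta> $ i $ k) - \<Delta> \<zeta> * bdry (volterra \<zeta> g) $ i"])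
    show "(\<lambda>\<zeta>. (\<Sum>k\<in>UNIV. num \<zeta> g $ k * char_matrix \<zeta> $ i $ k) - \<Delta> \<zeta> * bdry (volterra \<zeta> g) $ i) holomorphic_on UNIV"
      by (intro holomorphic_intros num_holomorphic g char_matrix_holomorphic \<Delta>_holomorphic
          solve_holomorphic [OF sup_functional_bdry])
    fix \<zeta> assume \<Delta>: "\<Delta> \<zeta> \<noteq> 0"
    have "char_matrix \<zeta> *v (\<chi> k. num \<zeta> g $ k / \<Delta> \<zeta>) = bdry (volterra \<zeta> g)"
      using cramer [of "char_matrix \<zeta>" _ "bdry (volterra \<zeta> g)"] \<Delta> by (simp add: \<Delta>_def num_def)
    from arg_cong [OF this, of "\<lambda>v. \<Delta> \<zeta> * v $ i"]
    show "(\<Sum>k\<in>UNIV. num \<zeta> g $ k * char_matrix \<zeta> $ i $ k) - \<Delta> \<zeta> * bdry (volterra \<zeta> g) $ i = 0"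
      using \<Delta> by (simp add: matrix_vector_mult_def sum_distrib_left mult.commute)
  qed
  then show ?thesis by simp
qed

lemma strip_bounds:
  obtains K where "0 \<le> K" "\<And>\<zeta>. \<bar>Im \<zeta>\<bar> \<le> T \<Longrightarrow> norm (\<Delta> \<zeta>) \<le> K"
    "\<And>\<zeta> g k. \<bar>Im \<zeta>\<bar> \<le> T \<Longrightarrow> g \<in> L2 \<Longrightarrow> norm (num \<zeta> g $ k) \<le> K * l2_norm g"
proof -
  have "\<exists>K\<ge>0. \<forall>\<zeta> g v. \<bar>Im \<zeta>\<bar> \<le> T \<longrightarrow> g \<in> L2 \<longrightarrow> norm (bdry (solve \<zeta> g v) $ i) \<le> K * (norm v + l2_norm g)" for i
    by (rule sup_functional_solve_bound [OF sup_functional_bdry, of T i]) blast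
  then obtain Ki where Ki: "\<And>i. 0 \<le> Ki i"
    "\<And>i \<zeta> g v. \<bar>Im \<zeta>\<bar> \<le> T \<Longrightarrow> g \<in> L2 \<Longrightarrow> norm (bdry (solve \<zeta> g v) $ i) \<le> Ki i * (norm v + l2_norm g)"
    by metis
  define L where "L = 1 + sum Ki UNIV"
  have L: "1 \<le> L" "Ki i \<le> L" for i
    using sum_nonneg [of UNIV Ki] member_le_sum [of i UNIV Ki] Ki(1) by (auto simp: L_def)
  have M: "norm (char_matrix \<zeta> $ i $ j) \<le> L" if "\<bar>Im \<zeta>\<bar> \<le> T" for \<zeta> i j
  proof -
    have "norm (char_matrix \<zeta> $ i $ j) \<le> Ki i * (norm (axis j 1 :: complex^'n) + l2_norm (0 :: real \<Rightarrow> complex^'n))"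
      unfolding char_matrix_def using Ki(2) [OF that L2_zero(1), of "axis j 1" i] by simp
    also have "\<dots> = Ki i" by (simp add: l2_norm_def)
    finally show ?thesis using L(2) [of i] by linarith
  qed
  have W: "norm (bdry (volterra \<zeta> g) $ i) \<le> L * l2_norm g" if "\<bar>Im \<zeta>\<bar> \<le> T" "g \<in> L2" for \<zeta> g i
    using Ki(2) [OF that, of 0 i] mult_right_mono [OF L(2) [of i] l2_norm_nonneg [of g]] by simp
  define P where "P = real (card {p. p permutes (UNIV :: 'n set)})"
  define K where "K = P * (L * L ^ CARD('n))"
  have "norm (\<Delta> \<zeta>) \<le> K" if "\<bar>Im \<zeta>\<bar> \<le> T" for \<zeta>
    unfolding \<Delta>_def K_def P_def by (rule norm_det_le [where k = undefined]) (use M that L in auto)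
  moreover have "norm (num \<zeta> g $ k) \<le> K * l2_norm g" if "\<bar>Im \<zeta>\<bar> \<le> T" "g \<in> L2" for \<zeta> g k
  proof -
    have "norm (num \<zeta> g $ k) \<le> P * ((L * l2_norm g) * L ^ CARD('n))"
      unfolding num_def P_def vec_lambda_beta by (rule norm_det_le [where k = k]) (use M W that L in auto)
    then show ?thesis by (simp add: K_def mult_ac)
  qed
  moreover have "0 \<le> K" using L by (simp add: K_def P_def)
  ultimately show thesis using that by blast
qed

section \<open>Root functions as Taylor coefficients\<close>

definition rel :: "complex \<Rightarrow> ((real \<Rightarrow> complex^'n) \<times> (real \<Rightarrow> complex^'n)) set" where
  "rel \<zeta> = {(y, f). f \<in> L2 \<and> sol \<zeta> f y \<and> bdry y = 0}"

definition root_set :: "complex \<Rightarrow> (real \<Rightarrow> complex^'n) set" where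
  "root_set \<zeta> = {y. \<exists>k. (y, 0) \<in> rel \<zeta> ^^ k}"

text \<open>
  The Taylor coefficients at \<open>\<zeta>\<close> of \<open>\<Sum>c. num (\<zeta> + z) g $ c * solve (\<zeta> + z) 0 (axis c 1)\<close>; up to sign these
  are the first coefficients of \<open>\<Delta> (\<zeta> + z) * resolvent (\<zeta> + z) g\<close>.
\<close>

definition chain :: "complex \<Rightarrow> (real \<Rightarrow> complex^'n) \<Rightarrow> nat \<Rightarrow> real \<Rightarrow> complex^'n" where
  "chain \<zeta> g k = (\<Sum>i=0..k. \<Sum>c\<in>UNIV. fscale (fps_nth (fps_expansion (\<lambda>z. num (\<zeta> + z) g $ c) 0) i)
     ((volterra \<zeta> ^^ (k - i)) (solve \<zeta> 0 (axis c 1))))"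

lemma holomorphic_shift_fps:
  assumes "f holomorphic_on UNIV"
  shows "(\<lambda>z. f (\<zeta> + z)) has_fps_expansion fps_expansion (\<lambda>z. f (\<zeta> + z)) 0"
proof (rule has_fps_expansion_fps_expansion [of UNIV])
  show "(\<lambda>z. f (\<zeta> + z)) holomorphic_on UNIV"
    using holomorphic_on_compose [OF _ holomorphic_on_subset [OF assms], of "\<lambda>z. \<zeta> + z" UNIV]
    by (simp add: o_def holomorphic_intros)
qed auto

lemma chain_C0: "chain \<zeta> g k \<in> C0"
  unfolding chain_def by (intro C0_sum C0_fscale volterra_power_C0 solve_C0) simp

text \<open>The chain is the Cauchy product of the expansions of the numerators and of the
  fundamental solutions. It is tested with an arbitrary functional: once with components of the
  boundary form, once with the functional to be annihilated.\<close>

lemma chain_fps: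
  assumes \<psi>: "sup_functional \<psi>" and g: "g \<in> L2"
  shows "(\<lambda>z. \<Sum>c\<in>UNIV. num (\<zeta> + z) g $ c * \<psi> (solve (\<zeta> + z) 0 (axis c 1)))
    has_fps_expansion Abs_fps (\<lambda>k. \<psi> (chain \<zeta> g k))"
proof (rule has_fps_expansion_schematicI)
  let ?F = "\<lambda>c. fps_expansion (\<lambda>z. num (\<zeta> + z) g $ c) 0"
  let ?G = "\<lambda>c. Abs_fps (\<lambda>k. \<psi> ((volterra \<zeta> ^^ k) (solve \<zeta> 0 (axis c 1))))"
  show "(\<lambda>z. \<Sum>c\<in>UNIV. num (\<zeta> + z) g $ c * \<psi> (solve (\<zeta> + z) 0 (axis c 1)))
      has_fps_expansion (\<Sum>c\<in>UNIV. ?F c * ?G c)"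
    by (intro has_fps_expansion_sum has_fps_expansion_mult holomorphic_shift_fps num_holomorphic g
        solve_expansion [OF \<psi>]) simp
  have C: "(volterra \<zeta> ^^ k) (solve \<zeta> 0 (axis c 1)) \<in> C0" for k c
    by (intro volterra_power_C0 solve_C0) simp
  have "\<psi> (chain \<zeta> g k) = (\<Sum>i=0..k. \<Sum>c\<in>UNIV. fps_nth (?F c) i * fps_nth (?G c) (k - i))" for k
    unfolding chain_def
    by (simp add: sup_functional_sum [OF \<psi>] C0_sum C0_fscale C sup_functional_fscale [OF \<psi>])
  also have "(\<Sum>i=0..k. \<Sum>c\<in>UNIV. fps_nth (?F c) i * fps_nth (?G c) (k - i)) = fps_nth (\<Sum>c\<in>UNIV. ?F c * ?G c) k" for k
    by (subst sum.swap) (simp add: fps_sum_nth fps_mult_nth)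
  finally show "(\<Sum>c\<in>UNIV. ?F c * ?G c) = Abs_fps (\<lambda>k. \<psi> (chain \<zeta> g k))"
    by (simp add: fps_eq_iff)
qed

text \<open>The differential expression minus \<zeta> undoes one application of
  \<open>volterra\<close> and annihilates the homogeneous solutions; on the coefficients it lowers
  the index by one. The auxiliary \<open>h\<close> is this image for a single power.\<close>

lemma chain_sol: "sol \<zeta> (case k of 0 \<Rightarrow> 0 | Suc l \<Rightarrow> chain \<zeta> g l) (chain \<zeta> g k)"
proof -
  let ?F = "\<lambda>c. fps_nth (fps_expansion (\<lambda>z. num (\<zeta> + z) g $ c) 0)"
  let ?u = "\<lambda>c j. (volterra \<zeta> ^^ j) (solve \<zeta> 0 (axis c 1))"
  define h where "h = (\<lambda>c j. case j of 0 \<Rightarrow> 0 | Suc l \<Rightarrow> ?u c l)"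
  have u: "?u c j \<in> L2" for c j
    by (intro C0_L2 volterra_power_C0 solve_C0) simp
  have h: "h c j \<in> L2" for c j
    by (cases j) (simp_all only: h_def nat.case u L2_zero)
  have "sol \<zeta> (h c j) (?u c j)" for c j
  proof (cases j)
    case 0
    then show ?thesis by (simp add: h_def sol_solve)
  next
    case (Suc l)
    then show ?thesis using sol_solve [OF u, of \<zeta> l c 0] by (simp add: h_def)
  qed
  then have "sol \<zeta> (\<Sum>i=0..k. \<Sum>c\<in>UNIV. fscale (?F c i) (h c (k - i))) (chain \<zeta> g k)"
    unfolding chain_def
    by (intro sol_sum sol_fscale) (auto intro!: h L2_fscale fun_vs.subspace_sum [OF subspace_L2])
  also have "(\<Sum>i=0..k. \<Sum>c\<in>UNIV. fscale (?F c i) (h c (k - i))) = (case k of 0 \<Rightarrow> 0 | Suc l \<Rightarrow> chain \<zeta> g l)"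
  proof (cases k)
    case 0
    then show ?thesis by (simp add: h_def)
  next
    case (Suc l)
    have "(\<Sum>i=0..l. \<Sum>c\<in>UNIV. fscale (?F c i) (h c (Suc l - i))) = chain \<zeta> g l"
      unfolding chain_def by (intro sum.cong refl) (simp add: h_def Suc_diff_le)
    moreover have "(\<Sum>c\<in>UNIV. fscale (?F c (Suc l)) (h c (Suc l - Suc l))) = 0"
      by (simp add: h_def)
    ultimately show ?thesis
      by (simp only: Suc sum.atLeast0_atMost_Suc nat.case add_0_right)
  qed
  finally show ?thesis .
qed

definition zero_order :: "complex \<Rightarrow> nat" where
  "zero_order \<zeta> = subdegree (fps_expansion (\<lambda>z. \<Delta> (\<zeta> + z)) 0)"

lemma \<Delta>_fps: "(\<lambda>z. \<Delta> (\<zeta> + z)) has_fps_expansion fps_expansion (\<lambda>z. \<Delta> (\<zeta> + z)) 0"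
  by (intro holomorphic_shift_fps \<Delta>_holomorphic)

lemma \<Delta>_fps_nonzero: "fps_expansion (\<lambda>z. \<Delta> (\<zeta> + z)) 0 \<noteq> 0"
proof
  assume eq: "fps_expansion (\<lambda>z. \<Delta> (\<zeta> + z)) 0 = 0"
  obtain \<beta> where \<beta>: "\<Delta> \<beta> \<noteq> 0" by (rule \<Delta>_nontrivial)
  obtain r where r: "0 < r" "\<And>w. w \<in> cball \<zeta> r - {\<zeta>} \<Longrightarrow> \<Delta> w \<noteq> 0"
    using entire_nonzero_nearby [OF \<Delta>_holomorphic \<beta>] by metis
  have "eventually (\<lambda>z. eval_fps 0 z = \<Delta> (\<zeta> + z)) (nhds 0)"
    using \<Delta>_fps [of \<zeta>] unfolding eq has_fps_expansion_def by blast
  then have "eventually (\<lambda>z. \<Delta> (\<zeta> + z) = 0) (nhds 0)"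
    by eventually_elim simp
  then obtain e where e: "0 < e" "\<And>z. dist z 0 < e \<Longrightarrow> \<Delta> (\<zeta> + z) = 0"
    unfolding eventually_nhds_metric by blast
  define z where "z = complex_of_real (min r e / 2)"
  have "norm z = min r e / 2" using r(1) e(1) by (simp add: z_def)
  then have "dist z 0 < e" "\<zeta> + z \<in> cball \<zeta> r - {\<zeta>}"
    using r(1) e(1) by (auto simp: dist_norm)
  then show False using r(2) e(2) by blast
qed

text \<open>By \<open>char_matrix_num\<close> the boundary value of the generating function is
  \<open>\<Delta>\<close> times a power series, so its coefficients vanish below the order of the
  zero.\<close>

lemma chain_bdry:
  assumes g: "g \<in> L2" and k: "k < zero_order \<zeta>"
  shows "bdry (chain \<zeta> g k) = 0"
proof -
  have "bdry (chain \<zeta> g k) $ i = 0" for i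
  proof -
    let ?W = "Abs_fps (\<lambda>k. bdry ((volterra \<zeta> ^^ k) (volterra \<zeta> g)) $ i)"
    let ?D = "fps_expansion (\<lambda>z. \<Delta> (\<zeta> + z)) 0"
    have "(\<lambda>z. \<Delta> (\<zeta> + z) * bdry (volterra (\<zeta> + z) g) $ i) has_fps_expansion ?D * ?W"
      by (intro has_fps_expansion_mult \<Delta>_fps solve_expansion [OF sup_functional_bdry g])
    moreover have "(\<lambda>z. \<Delta> (\<zeta> + z) * bdry (volterra (\<zeta> + z) g) $ i) has_fps_expansion Abs_fps (\<lambda>k. bdry (chain \<zeta> g k) $ i)"
      using chain_fps [OF sup_functional_bdry [of i] g, of \<zeta>]
      by (simp add: char_matrix_num [OF g, symmetric] char_matrix_def)
    ultimately have "?D * ?W = Abs_fps (\<lambda>k. bdry (chain \<zeta> g k) $ i)"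
      by (rule fps_expansion_unique_complex)
    then have "bdry (chain \<zeta> g k) $ i = fps_nth (?D * ?W) k"
      by simp
    also have "\<dots> = 0"
      using k unfolding zero_order_def by (rule fps_mult_nth_less_subdegree)
    finally show ?thesis .
  qed
  then show ?thesis by (simp add: vec_eq_iff)
qed

text \<open>Below the order of the zero the coefficients form a Jordan chain; from index
  \<open>k\<close> it takes \<open>Suc k\<close> steps to reach 0.\<close>

lemma chain_root:
  assumes g: "g \<in> L2" and k: "k < zero_order \<zeta>"
  shows "chain \<zeta> g k \<in> root_set \<zeta>"
proof -
  have step: "(chain \<zeta> g k, case k of 0 \<Rightarrow> 0 | Suc l \<Rightarrow> chain \<zeta> g l) \<in> rel \<zeta>" if "k < zero_order \<zeta>" for k
  proof -
    have "(case k of 0 \<Rightarrow> 0 | Suc l \<Rightarrow> chain \<zeta> g l) \<in> L2"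
      by (cases k) (simp_all add: C0_L2 [OF chain_C0])
    then show ?thesis
      using chain_sol chain_bdry [OF g that] by (simp add: rel_def)
  qed
  have "(chain \<zeta> g k, 0) \<in> rel \<zeta> ^^ Suc k" using k
  proof (induction k)
    case 0
    have "(chain \<zeta> g 0, 0) \<in> rel \<zeta>" using step [OF 0] by (simp only: nat.case)
    then show ?case by (rule relpow_Suc_I2 [OF _ relpow_0_I])
  next
    case (Suc k)
    have "(chain \<zeta> g (Suc k), chain \<zeta> g k) \<in> rel \<zeta>"
      using step [OF Suc.prems] by (simp only: nat.case)
    moreover have "(chain \<zeta> g k, 0) \<in> rel \<zeta> ^^ Suc k"
      using Suc.prems by (intro Suc.IH) simp
    ultimately show ?case by (rule relpow_Suc_I2)
  qed
  then show ?thesis unfolding root_set_def by blast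
qed

section \<open>Functionals that vanish on all root functions\<close>

lemma functional_vanishes:
  assumes \<phi>: "l2_functional \<phi>" and root: "\<And>\<zeta> y. \<Delta> \<zeta> = 0 \<Longrightarrow> y \<in> root_set \<zeta> \<Longrightarrow> \<phi> y = 0"
    and g: "g \<in> L2" and \<zeta>: "\<Delta> \<zeta> \<noteq> 0"
  shows "\<phi> (resolvent \<zeta> g) = 0"
proof -
  note sup = l2_functional_imp_sup_functional [OF \<phi>]
  \<comment> \<open>The functional of the resolvent multiplied by \<open>\<Delta>\<close>; in this
    form it is entire without any assumption on the root functions.\<close>
  define \<Psi> where "\<Psi> = (\<lambda>\<zeta>. \<Delta> \<zeta> * \<phi> (volterra \<zeta> g) - (\<Sum>c\<in>UNIV. num \<zeta> g $ c * \<phi> (solve \<zeta> 0 (axis c 1))))"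
  have \<Psi>_hol: "\<Psi> holomorphic_on UNIV"
    unfolding \<Psi>_def by (intro holomorphic_intros \<Delta>_holomorphic num_holomorphic g solve_holomorphic [OF sup]) simp_all
  have \<Psi>_eq: "\<Psi> \<zeta> = \<Delta> \<zeta> * \<phi> (resolvent \<zeta> g)" if "\<Delta> \<zeta> \<noteq> 0" for \<zeta>
  proof -
    have "\<phi> (resolvent \<zeta> g) = \<phi> (volterra \<zeta> g) + \<phi> (solve \<zeta> 0 (\<chi> k. - (num \<zeta> g $ k / \<Delta> \<zeta>)))"
      unfolding resolvent_def by (subst solve_split [OF g])
        (simp add: sup_functional_add [OF sup] solve_C0 g)
    also have "\<phi> (solve \<zeta> 0 (\<chi> k. - (num \<zeta> g $ k / \<Delta> \<zeta>))) = (\<Sum>j\<in>UNIV. - (num \<zeta> g $ j / \<Delta> \<zeta>) * \<phi> (solve \<zeta> 0 (axis j 1)))"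
      by (subst sup_functional_solve [OF sup]) simp
    finally show ?thesis
      using that by (simp add: \<Psi>_def right_diff_distrib sum_distrib_left sum_negf)
  qed
  \<comment> \<open>Removability at every point: below the order of \<open>\<Delta>\<close> the
    coefficients of \<open>\<Psi>\<close> vanish, since the product \<open>?D * ?V\<close> starts at
    that order and the remaining coefficients are values of \<phi> at root functions.\<close>
  have "\<exists>c. (\<lambda>z. if z = 0 then c else \<Psi> (\<zeta> + z) / \<Delta> (\<zeta> + z)) analytic_on {0}" for \<zeta>
  proof -
    let ?D = "fps_expansion (\<lambda>z. \<Delta> (\<zeta> + z)) 0"
    let ?V = "Abs_fps (\<lambda>k. \<phi> ((volterra \<zeta> ^^ k) (volterra \<zeta> g)))"
    let ?P = "?D * ?V - Abs_fps (\<lambda>k. \<phi> (chain \<zeta> g k))"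
    have P: "(\<lambda>z. \<Psi> (\<zeta> + z)) has_fps_expansion ?P"
      unfolding \<Psi>_def by (intro has_fps_expansion_diff has_fps_expansion_mult \<Delta>_fps solve_expansion sup g chain_fps)
    have "fps_nth ?P k = 0" if "k < subdegree ?D" for k
    proof -
      have "fps_nth (?D * ?V) k = 0"
        using that by (rule fps_mult_nth_less_subdegree)
      \<comment> \<open>An index below the order exists only if \<zeta> is a zero, so the hypothesis
        on root functions becomes available.\<close>
      moreover have "\<Delta> \<zeta> = 0"
      proof -
        have "fps_nth ?D 0 = 0" using that by (intro nth_less_subdegree_zero) simp
        then show ?thesis using fps_nth_fps_expansion [OF \<Delta>_fps, of \<zeta> 0] by simp
      qed
      then have "\<phi> (chain \<zeta> g k) = 0"
        using that by (intro root [of \<zeta>] chain_root g) (simp_all add: zero_order_def)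
      ultimately show ?thesis by simp
    qed
    note coeff = this
    show ?thesis
    \<comment> \<open>The zero series has subdegree 0 by convention, so the comparison of subdegrees
      behind the division may fail for it.\<close>
    proof (cases "?P = 0")
      case False
      then have "subdegree ?D \<le> subdegree ?P"
        by (rule subdegree_geI) (rule coeff)
      note quotient = has_fps_expansion_divide [OF P \<Delta>_fps this \<Delta>_fps_nonzero]
      define d where "d = fps_nth ?P (subdegree ?D) / fps_nth ?D (subdegree ?D)"
      have "(\<lambda>z. if z = 0 then d else \<Psi> (\<zeta> + z) / \<Delta> (\<zeta> + z)) analytic_on {0}"
        by (rule has_fps_expansion_imp_analytic_0, rule quotient, rule d_def)
      then show ?thesis by (rule exI [of _ d])
    next
      case P0: True
      have "eventually (\<lambda>z. eval_fps 0 z = \<Psi> (\<zeta> + z)) (nhds 0)"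
        using P unfolding P0 has_fps_expansion_def by blast
      then have "eventually (\<lambda>z. 0 = (if z = 0 then 0 else \<Psi> (\<zeta> + z) / \<Delta> (\<zeta> + z))) (nhds 0)"
        by eventually_elim simp
      from analytic_at_cong [OF this refl] have "(\<lambda>z. if z = 0 then 0 else \<Psi> (\<zeta> + z) / \<Delta> (\<zeta> + z)) analytic_on {0}"
        by simp
      then show ?thesis by blast
    qed
  qed
  then obtain c where c: "\<And>\<zeta>. (\<lambda>z. if z = 0 then c \<zeta> else \<Psi> (\<zeta> + z) / \<Delta> (\<zeta> + z)) analytic_on {0}"
    by metis
  define F where "F = (\<lambda>\<zeta>. if \<Delta> \<zeta> = 0 then c \<zeta> else \<Psi> \<zeta> / \<Delta> \<zeta>)"
  obtain \<beta> where \<beta>: "\<Delta> \<beta> \<noteq> 0" by (rule \<Delta>_nontrivial)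
  have "F analytic_on {\<zeta>}" for \<zeta>
  proof (cases "\<Delta> \<zeta> = 0")
    case True
    obtain r where r: "0 < r" "\<And>w. w \<in> cball \<zeta> r - {\<zeta>} \<Longrightarrow> \<Delta> w \<noteq> 0"
      using entire_nonzero_nearby [OF \<Delta>_holomorphic \<beta>] by metis
    define G where "G = (\<lambda>z. if z = 0 then c \<zeta> else \<Psi> (\<zeta> + z) / \<Delta> (\<zeta> + z))"
    have "(G \<circ> (\<lambda>w. w - \<zeta>)) analytic_on {\<zeta>}"
      using c [of \<zeta>] by (intro analytic_on_compose_gen [where T = "{0}"] analytic_intros) (auto simp: G_def)
    moreover have "eventually (\<lambda>w. (G \<circ> (\<lambda>w. w - \<zeta>)) w = F w) (nhds \<zeta>)"
    proof -
      have "eventually (\<lambda>w. w \<in> ball \<zeta> r) (nhds \<zeta>)"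
        using r(1) by (intro eventually_nhds_in_open) auto
      then show ?thesis
      proof eventually_elim
        case (elim w)
        then show ?case
          using r(2) [of w] True by (cases "w = \<zeta>") (auto simp: G_def F_def)
      qed
    qed
    ultimately show ?thesis
      using analytic_at_cong [OF _ refl] by blast
  next
    case False
    have cont: "continuous_on UNIV \<Delta>"
      by (rule holomorphic_on_imp_continuous_on [OF \<Delta>_holomorphic])
    have op: "open {w. \<Delta> w \<noteq> 0}"
      using open_Collect_neq [OF cont, of "\<lambda>_. 0"] by simp
    have "(\<lambda>w. \<Psi> w / \<Delta> w) holomorphic_on {w. \<Delta> w \<noteq> 0}"
      by (intro holomorphic_intros holomorphic_on_subset [OF \<Psi>_hol] \<Delta>_holomorphic) auto
    then have "F holomorphic_on {w. \<Delta> w \<noteq> 0}"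
      by (rule holomorphic_transform) (simp add: F_def)
    then have "F analytic_on {w. \<Delta> w \<noteq> 0}"
      using op by (simp add: analytic_on_open)
    then show ?thesis using False by (auto intro: analytic_on_subset)
  qed
  then have F: "F holomorphic_on UNIV"
    using analytic_on_analytic_at analytic_imp_holomorphic by blast
  have F_eq: "F \<zeta> * \<Delta> \<zeta> = \<Psi> \<zeta>" for \<zeta>
  proof -
    have "F \<zeta> * \<Delta> \<zeta> - \<Psi> \<zeta> = 0"
      by (rule entire_zero_extension [OF \<Delta>_holomorphic \<beta>, where z = \<zeta> and g = "\<lambda>\<zeta>. F \<zeta> * \<Delta> \<zeta> - \<Psi> \<zeta>"])
        (intro holomorphic_intros F \<Delta>_holomorphic \<Psi>_hol, simp add: F_def)
    then show ?thesis by simp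
  qed
  have F_res: "F \<zeta> = \<phi> (resolvent \<zeta> g)" if "\<Delta> \<zeta> \<noteq> 0" for \<zeta>
    using that \<Psi>_eq [OF that] by (simp add: F_def)
  obtain K\<^sub>\<phi> where K\<^sub>\<phi>: "0 \<le> K\<^sub>\<phi>" "\<And>y M. y \<in> C0 \<Longrightarrow> (\<And>x. x \<in> {0..1} \<Longrightarrow> norm (y x) \<le> M) \<Longrightarrow> norm (\<phi> y) \<le> K\<^sub>\<phi> * M"
    using sup_functional_bound [OF sup] by blast
  obtain d \<tau>\<^sub>1 where d: "0 < d" "0 < \<tau>\<^sub>1" "\<And>\<zeta>. \<tau>\<^sub>1 \<le> \<bar>Im \<zeta>\<bar> \<Longrightarrow> d \<le> norm (\<Delta> \<zeta>)"
    using \<Delta>_bounded_below by metis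
  obtain K \<tau>\<^sub>2 where K: "0 \<le> K" "0 < \<tau>\<^sub>2"
    "\<And>\<zeta> g y x. \<lbrakk>\<tau>\<^sub>2 \<le> \<bar>Im \<zeta>\<bar>; g \<in> L2; sol \<zeta> g y; x \<in> {0..1}\<rbrakk> \<Longrightarrow>
      norm (y x) \<le> K * (norm (bdry y) + l2_norm g / sqrt \<bar>Im \<zeta>\<bar>)"
    using resolvent_bound by metis
  define \<tau> where "\<tau> = max \<tau>\<^sub>1 \<tau>\<^sub>2"
  have \<tau>: "0 < \<tau>" using d(2) by (simp add: \<tau>_def)
  have F_le: "norm (F \<zeta>) \<le> K\<^sub>\<phi> * (K * (l2_norm g / sqrt \<bar>Im \<zeta>\<bar>))" if "\<tau> \<le> \<bar>Im \<zeta>\<bar>" for \<zeta>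
  proof -
    have nz: "\<Delta> \<zeta> \<noteq> 0" using d(1) d(3) [of \<zeta>] that by (auto simp: \<tau>_def)
    have "sol \<zeta> g (resolvent \<zeta> g)" "bdry (resolvent \<zeta> g) = 0"
      using sol_bdry_zero_iff [OF g nz] by blast+
    then show ?thesis
      unfolding F_res [OF nz] using K(3) [of \<zeta> g "resolvent \<zeta> g"] that g
      by (intro K\<^sub>\<phi> sol_C0 [of \<zeta> g]) (auto simp: \<tau>_def)
  qed
  have bounds: "\<exists>M. \<forall>z. \<bar>Im z\<bar> \<le> T \<longrightarrow> norm (\<Delta> z) \<le> M \<and> norm (\<Psi> z) \<le> M" for T
  proof (rule strip_bounds [of T])
    fix L assume L: "0 \<le> L" "\<And>\<zeta>. \<bar>Im \<zeta>\<bar> \<le> T \<Longrightarrow> norm (\<Delta> \<zeta>) \<le> L"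
      "\<And>\<zeta> g k. \<bar>Im \<zeta>\<bar> \<le> T \<Longrightarrow> g \<in> L2 \<Longrightarrow> norm (num \<zeta> g $ k) \<le> L * l2_norm g"
    obtain K' where K': "0 \<le> K'"
      "\<And>\<zeta> g v. \<lbrakk>\<bar>Im \<zeta>\<bar> \<le> T; g \<in> L2\<rbrakk> \<Longrightarrow> norm (\<phi> (solve \<zeta> g v)) \<le> K' * (norm v + l2_norm g)"
      using sup_functional_solve_bound [OF sup, of T] by metis
    define M where "M = L + (L * (K' * l2_norm g) + real CARD('n) * ((L * l2_norm g) * K'))"
    have "norm (\<Psi> z) \<le> L * (K' * l2_norm g) + real CARD('n) * ((L * l2_norm g) * K')" if z: "\<bar>Im z\<bar> \<le> T" for z
    proof -
      have "norm (\<Delta> z * \<phi> (volterra z g)) \<le> L * (K' * l2_norm g)"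
        unfolding norm_mult using L(1,2) K'(2) [OF z g, of 0] z by (intro mult_mono) auto
      moreover have "norm (num z g $ c * \<phi> (solve z 0 (axis c 1))) \<le> (L * l2_norm g) * K'" for c
        unfolding norm_mult using L(1) L(3) [OF z g, of c] K'(2) [OF z L2_zero(1), of "axis c 1"]
        by (intro mult_mono) (auto simp: l2_norm_def)
      then have "norm (\<Sum>c\<in>UNIV. num z g $ c * \<phi> (solve z 0 (axis c 1))) \<le> real CARD('n) * ((L * l2_norm g) * K')"
        by (rule sum_norm_bound)
      ultimately show ?thesis
        unfolding \<Psi>_def by (intro order_trans [OF norm_triangle_ineq4] add_mono)
    qed
    moreover have "0 \<le> L * (K' * l2_norm g) + real CARD('n) * ((L * l2_norm g) * K')"
      using L(1) K'(1) by simp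
    ultimately have "\<forall>z. \<bar>Im z\<bar> \<le> T \<longrightarrow> norm (\<Delta> z) \<le> M \<and> norm (\<Psi> z) \<le> M"
      using L(1,2) by (fastforce simp: M_def)
    then show ?thesis by blast
  qed
  obtain M where M: "\<And>z. \<bar>Im z\<bar> \<le> \<tau> \<Longrightarrow> norm (F z) \<le> M"
    using quotient_bounded_on_strip [OF F \<Delta>_holomorphic F_eq bounds d(1), of \<tau> \<tau>] d(3) \<tau> by (auto simp: \<tau>_def)
  define A where "A = K\<^sub>\<phi> * (K * l2_norm g)"
  have A: "0 \<le> A" using K\<^sub>\<phi> K by (simp add: A_def)
  have F_le': "norm (F z) \<le> A / sqrt \<bar>Im z\<bar>" if "\<tau> \<le> \<bar>Im z\<bar>" for z
    using F_le [OF that] by (simp add: A_def)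
  have "norm (F z) \<le> max M (A / sqrt \<tau>)" for z
  proof (cases "\<bar>Im z\<bar> \<le> \<tau>")
    case True
    then show ?thesis using M [OF True] by simp
  next
    case False
    have "A / sqrt \<bar>Im z\<bar> \<le> A / sqrt \<tau>"
      using False \<tau> A by (intro divide_left_mono) auto
    then show ?thesis using F_le' [of z] False by simp
  qed
  then have "bounded (range F)" unfolding bounded_iff by blast
  then obtain w where w: "\<And>z. F z = w"
    using Liouville_theorem [OF F] unfolding constant_on_def by blast
  have "w = 0"
  proof (rule ccontr)
    assume "w \<noteq> 0"
    \<comment> \<open>At this height on the imaginary axis the decay bound forces sqrt t \<le> A /
      |w|, whereas sqrt t \<ge> A / |w| + 1.\<close>
    define t where "t = max \<tau> ((A / norm w + 1)\<^sup>2)"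
    have t: "\<tau> \<le> t" "(A / norm w + 1)\<^sup>2 \<le> t" by (auto simp: t_def)
    have "A / norm w + 1 \<le> sqrt t" using t A by (intro real_le_rsqrt) auto
    moreover have "norm w \<le> A / sqrt t"
      using F_le' [of "Complex 0 t"] w t \<tau> by simp
    then have "norm w * sqrt t \<le> A" using t \<tau> by (simp add: pos_le_divide_eq)
    then have "sqrt t \<le> A / norm w" using \<open>w \<noteq> 0\<close> by (simp add: pos_le_divide_eq mult.commute)
    ultimately show False by simp
  qed
  then show ?thesis using F_res [OF \<zeta>] w by simp
qed

text \<open>At a point \<beta> with \<open>\<Delta> \<beta> \<noteq> 0\<close>, every continuously
  differentiable function vanishing at both ends is a value of the resolvent. Hence \<phi> is zero
  on a dense set, and the norm bound does the rest.\<close>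

lemma functional_zero:
  assumes \<phi>: "l2_functional \<phi>" and root: "\<And>\<zeta> y. \<Delta> \<zeta> = 0 \<Longrightarrow> y \<in> root_set \<zeta> \<Longrightarrow> \<phi> y = 0"
    and g: "g \<in> L2"
  shows "\<phi> g = 0"
proof -
  obtain K where K: "0 \<le> K" "\<And>y. y \<in> L2 \<Longrightarrow> norm (\<phi> y) \<le> K * l2_norm y"
    using l2_functional_bound [OF \<phi>] by blast
  obtain \<beta> where \<beta>: "\<Delta> \<beta> \<noteq> 0" by (rule \<Delta>_nontrivial)
  have le: "norm (\<phi> g) \<le> K * e" if e: "0 < e" for e
  proof -
    obtain p p' where p: "\<And>x. (p has_vector_derivative p' x) (at x)" "continuous_on UNIV p'"
      "p 0 = 0" "p 1 = 0" "l2_norm (\<lambda>x. g x - p x) < e"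
      using polynomial_dense_L2 [OF g e] by blast
    define y where "y = (\<lambda>x. if x \<in> {0..1} then p x else 0)"
    \<comment> \<open>The image of \<open>y\<close> under the differential expression minus \<beta>,
      with derivative p' on the interval; division by \<i> \<open>a i\<close> is multiplication by
      -\<i> / \<open>a i\<close>.\<close>
    define f where "f = (\<lambda>t. (\<chi> i. p' t $ i / (\<i> * of_real (a i))) - \<beta> *s y t + Q t *v y t)"
    have "continuous_on {0..1} p"
      using p(1) by (meson continuous_on_vector_derivative has_vector_derivative_at_within)
    then have "continuous_on {0..1} y"
      by (rule continuous_on_eq) (simp add: y_def)
    then have y: "y \<in> C0" by (simp add: C0_def y_def)
    have p'01: "continuous_on {0..1} p'" using p(2) continuous_on_subset by blast
    have "(\<lambda>t. \<chi> i. p' t $ i / (\<i> * of_real (a i))) \<in> L2"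
      using a_nonzero by (intro continuous_imp_L2 continuous_intros p'01) auto
    then have f: "f \<in> L2"
      unfolding f_def using y L2_fscale [OF C0_L2 [OF y], of \<beta>]
      by (intro L2_add L2_diff L2_matrix_vector_mult Q) (auto simp: C0_def fscale_def)
    have rhs_eq: "rhs \<beta> f y = p'"
      using a_nonzero by (simp add: rhs_def f_def fun_eq_iff vec_eq_iff)
    have "sol \<beta> f y"
      unfolding sol_def rhs_eq
    proof (intro conjI ballI y)
      fix x :: real assume x: "x \<in> {0..1}"
      have "(p' has_integral p x - p 0) {0..x}"
        using x p(1) by (intro fundamental_theorem_of_calculus) (auto intro: has_vector_derivative_at_within)
      then show "y x = y 0 + integral {0..x} p'"
        using x by (simp add: y_def integral_unique)
    qed
    moreover have "bdry y = 0"
      using p(3,4) by (simp add: bdry_def y_def)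
    ultimately have "y = resolvent \<beta> f"
      using sol_bdry_zero_iff [OF f \<beta>] by blast
    then have "\<phi> y = 0"
      using functional_vanishes [OF \<phi> root f \<beta>] by simp
    then have "norm (\<phi> g) = norm (\<phi> (g - y))"
      using l2_functional_diff [OF \<phi> g C0_L2 [OF y]] by simp
    also have "\<dots> \<le> K * l2_norm (g - y)"
      by (intro K L2_fdiff g C0_L2 y)
    also have "l2_norm (g - y) = l2_norm (\<lambda>x. g x - p x)"
      unfolding l2_norm_def by (rule arg_cong [where f = sqrt], rule Bochner_Integration.integral_cong)
        (auto simp: y_def)
    also have "K * \<dots> \<le> K * e" using p(5) K(1) by (intro mult_left_mono) auto
    finally show ?thesis .
  qed
  have *: "norm (\<phi> g) \<le> K * (1 / real (Suc n))" for n
    by (rule le) simp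
  have "(\<lambda>n. K * (1 / real (Suc n))) \<longlonglongrightarrow> K * 0"
    by (intro tendsto_intros LIMSEQ_Suc lim_1_over_n)
  then have "norm (\<phi> g) \<le> K * 0"
    by (rule LIMSEQ_le_const) (use * in blast)
  then show ?thesis by simp
qed

end

section \<open>Completeness and minimality\<close>

lemma norm_diff_square_complex_vec:
  fixes u v :: "complex^'n"
  shows "(norm (u - v))\<^sup>2 = (norm u)\<^sup>2 + (norm v)\<^sup>2 - 2 * Re (\<Sum>i\<in>UNIV. v $ i * cnj (u $ i))"
proof -
  have "(norm (u - v))\<^sup>2 = (norm u)\<^sup>2 + (norm v)\<^sup>2 - 2 * (v \<bullet> u)"
    by (simp add: power2_norm_eq_inner inner_diff_left inner_diff_right inner_commute)
  moreover have "v \<bullet> u = Re (\<Sum>i\<in>UNIV. v $ i * cnj (u $ i))"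
    by (simp add: inner_vec_def inner_complex_def)
  ultimately show ?thesis by simp
qed

lemma norm_inner_sum_le:
  fixes u v :: "complex^'n"
  shows "norm (\<Sum>i\<in>UNIV. u $ i * cnj (v $ i)) \<le> norm u * norm v"
proof -
  have "norm (\<Sum>i\<in>UNIV. u $ i * cnj (v $ i)) \<le> (\<Sum>i\<in>UNIV. \<bar>norm (u $ i)\<bar> * \<bar>norm (v $ i)\<bar>)"
    using norm_sum [of "\<lambda>i. u $ i * cnj (v $ i)" UNIV] by (simp add: norm_mult)
  also have "\<dots> \<le> norm u * norm v"
    unfolding norm_vec_def by (rule L2_set_mult_ineq)
  finally show ?thesis .
qed

lemma l2_inner_integrable:
  fixes f g :: "real \<Rightarrow> complex^'n"
  assumes f: "f \<in> L2" and g: "g \<in> L2"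
  shows "integrable (lebesgue_on {0..1}) (\<lambda>x. \<Sum>i\<in>UNIV. f x $ i * cnj (g x $ i))"
proof (rule Bochner_Integration.integrable_bound [OF integrable_norm_mult [OF f g] _ AE_I2])
  have "(\<lambda>x. f x $ i) \<in> borel_measurable (lebesgue_on {0..1})" "(\<lambda>x. cnj (g x $ i)) \<in> borel_measurable (lebesgue_on {0..1})" for i
    using L2_measurable [OF L2_bounded_linear [OF bounded_linear_vec_nth f]]
      L2_measurable [OF L2_bounded_linear [OF bounded_linear_cnj L2_bounded_linear [OF bounded_linear_vec_nth g]]]
    by simp_all
  then show "(\<lambda>x. \<Sum>i\<in>UNIV. f x $ i * cnj (g x $ i)) \<in> borel_measurable (lebesgue_on {0..1})"
    by (intro borel_measurable_sum borel_measurable_times)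
  show "norm (\<Sum>i\<in>UNIV. f x $ i * cnj (g x $ i)) \<le> norm (norm (f x) * norm (g x))" for x
    using norm_inner_sum_le [of "f x" "g x"] by simp
qed

lemma l2_inner_add_left:
  "f \<in> L2 \<Longrightarrow> g \<in> L2 \<Longrightarrow> h \<in> L2 \<Longrightarrow> l2_inner (f + g) h = l2_inner f h + l2_inner g h"
  using Bochner_Integration.integral_add [OF l2_inner_integrable [of f h] l2_inner_integrable [of g h]]
  by (simp add: l2_inner_def distrib_right sum.distrib)

lemma l2_inner_diff_right:
  "f \<in> L2 \<Longrightarrow> g \<in> L2 \<Longrightarrow> h \<in> L2 \<Longrightarrow> l2_inner f (g - h) = l2_inner f g - l2_inner f h"
  using Bochner_Integration.integral_diff [OF l2_inner_integrable [of f g] l2_inner_integrable [of f h]]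
  by (simp add: l2_inner_def right_diff_distrib sum_subtractf)

lemma l2_inner_fscale_left: "l2_inner (fscale c f) g = c * l2_inner f g"
  by (simp add: l2_inner_def fscale_def mult.assoc sum_distrib_left [symmetric])

lemma l2_inner_norm_le:
  fixes f g :: "real \<Rightarrow> complex^'n"
  assumes f: "f \<in> L2" and g: "g \<in> L2"
  shows "norm (l2_inner f g) \<le> l2_norm f * l2_norm g"
proof -
  have "norm (l2_inner f g) \<le> (LINT x|lebesgue_on {0..1}. norm (f x) * norm (g x))"
    unfolding l2_inner_def
    by (rule Bochner_Integration.integral_norm_bound_integral) (intro l2_inner_integrable integrable_norm_mult f g norm_inner_sum_le)+
  also have "\<dots> \<le> l2_norm f * l2_norm g" by (rule Cauchy_Schwarz_L2 [OF f g])
  finally show ?thesis .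
qed

lemma l2_norm_diff_square:
  fixes f g :: "real \<Rightarrow> complex^'n"
  assumes f: "f \<in> L2" and g: "g \<in> L2"
  shows "(l2_norm (f - g))\<^sup>2 = (l2_norm f)\<^sup>2 + (l2_norm g)\<^sup>2 - 2 * Re (l2_inner g f)"
proof -
  have int: "integrable (lebesgue_on {0..1}) (\<lambda>x. Re (\<Sum>i\<in>UNIV. g x $ i * cnj (f x $ i)))"
    by (intro integrable_Re l2_inner_integrable f g)
  have "(l2_norm (f - g))\<^sup>2 = (LINT x|lebesgue_on {0..1}. (norm (f x))\<^sup>2 + (norm (g x))\<^sup>2 - 2 * Re (\<Sum>i\<in>UNIV. g x $ i * cnj (f x $ i)))"
    unfolding l2_norm_power2 by (simp only: fun_diff_def norm_diff_square_complex_vec)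
  also have "\<dots> = (l2_norm f)\<^sup>2 + (l2_norm g)\<^sup>2 - 2 * (LINT x|lebesgue_on {0..1}. Re (\<Sum>i\<in>UNIV. g x $ i * cnj (f x $ i)))"
    using int L2_square_integrable [OF f] L2_square_integrable [OF g]
    by (subst Bochner_Integration.integral_diff) (simp_all add: l2_norm_power2 del: Re_sum)
  also have "(LINT x|lebesgue_on {0..1}. Re (\<Sum>i\<in>UNIV. g x $ i * cnj (f x $ i))) = Re (l2_inner g f)"
    unfolding l2_inner_def by (rule integral_Re [OF l2_inner_integrable [OF g f]])
  finally show ?thesis .
qed

lemma l2_inner_self: "l2_inner f f = complex_of_real ((l2_norm f)\<^sup>2)" for f :: "real \<Rightarrow> complex^'n"
proof -
  have "(\<Sum>i\<in>UNIV. f x $ i * cnj (f x $ i)) = complex_of_real ((norm (f x))\<^sup>2)" for x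
    by (simp add: norm_vec_def L2_set_def sum_nonneg complex_norm_square [symmetric])
  then have "l2_inner f f = (LINT x|lebesgue_on {0..1}. complex_of_real ((norm (f x))\<^sup>2))"
    unfolding l2_inner_def by (simp only:)
  then show ?thesis unfolding l2_norm_power2 by (simp only: integral_complex_of_real)
qed

lemma l2_norm_fscale: "l2_norm (fscale c f) = norm c * l2_norm f"
  by (simp add: l2_norm_def fscale_def norm_smult power_mult_distrib real_sqrt_mult)

text \<open>
  The functional is the limit of the inner products with \<open>g\<^sub>0 - g k\<close> for a sequence \<open>g k\<close> in \<open>M\<close>
  minimizing the distance to \<open>g\<^sub>0\<close>; taking the limit of the functionals, rather than of the sequence,
  spares the completeness of \<open>L\<^sup>2\<close>.
\<close>

lemma separating_functional:
  fixes M :: "(real \<Rightarrow> complex^'n) set"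
  assumes M: "fun_vs.subspace M" "M \<subseteq> L2" and g0: "g\<^sub>0 \<in> L2"
    and far: "0 < \<epsilon>" "\<And>g. g \<in> M \<Longrightarrow> \<epsilon> \<le> l2_norm (g\<^sub>0 - g)"
  obtains \<phi> where "l2_functional \<phi>" "\<And>y. y \<in> M \<Longrightarrow> \<phi> y = 0" "\<phi> g\<^sub>0 \<noteq> 0"
proof -
  define d where "d = (INF g\<in>M. (l2_norm (g\<^sub>0 - g))\<^sup>2)"
  have M0: "0 \<in> M" using M(1) by (rule fun_vs.subspace_0)
  then have ne: "M \<noteq> {}" by blast
  have bdd: "bdd_below ((\<lambda>g. (l2_norm (g\<^sub>0 - g))\<^sup>2) ` M)"
    by (rule bdd_belowI [of _ 0]) auto
  have d_le: "d \<le> (l2_norm (g\<^sub>0 - g))\<^sup>2" if "g \<in> M" for g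
    unfolding d_def by (rule cINF_lower [OF bdd that])
  have "\<epsilon>\<^sup>2 \<le> d"
    unfolding d_def using ne far by (intro cINF_greatest power_mono) auto
  then have d: "0 < d" using far(1) by (smt (verit) zero_less_power2)
  define e where "e = (\<lambda>k. 1 / real (Suc k))"
  have e: "0 < e k" "e k \<le> 1" for k by (auto simp: e_def)
  have "\<exists>g\<in>M. (l2_norm (g\<^sub>0 - g))\<^sup>2 < d + e k" for k
    using cInf_lessD [of "(\<lambda>g. (l2_norm (g\<^sub>0 - g))\<^sup>2) ` M" "d + e k"] ne e(1) [of k] by (auto simp: d_def)
  then obtain g where g: "\<And>k. g k \<in> M" "\<And>k. (l2_norm (g\<^sub>0 - g k))\<^sup>2 < d + e k"
    by metis
  define h where "h = (\<lambda>k. g\<^sub>0 - g k)"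
  have gL: "g k \<in> L2" and h: "h k \<in> L2" for k
    using g(1) M(2) g0 by (auto simp: h_def intro!: L2_fdiff)
  \<comment> \<open>Adding \<open>fscale c s\<close> to \<open>g k\<close> cannot lower the squared
    distance below \<open>d\<close>, while \<open>h k\<close> is within \<open>e k\<close> of it.
    The phase of \<open>c\<close> makes the inner product term real and equal to \<open>t\<close>
    times its modulus; \<open>t\<close> stays free for three different uses.\<close>
  have almost_orth: "2 * t * norm (l2_inner s (h k)) \<le> e k + t\<^sup>2 * (l2_norm s)\<^sup>2" if s: "s \<in> M" for s t k
  proof -
    define z where "z = l2_inner s (h k)"
    define c where "c = of_real t * cnj (sgn z)"
    have sL: "s \<in> L2" using s M(2) by blast
    have cs: "fscale c s \<in> M" using M(1) s by (rule fun_vs.subspace_scale)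
    have eq: "g\<^sub>0 - (g k + fscale c s) = h k - fscale c s" by (simp add: h_def algebra_simps)
    have "d \<le> (l2_norm (h k - fscale c s))\<^sup>2"
      unfolding eq [symmetric] by (rule d_le [OF fun_vs.subspace_add [OF M(1) g(1) cs]])
    also have "\<dots> = (l2_norm (h k))\<^sup>2 + (norm c * l2_norm s)\<^sup>2 - 2 * Re (c * z)"
      by (simp add: l2_norm_diff_square h L2_fscale sL l2_norm_fscale l2_inner_fscale_left z_def)
    also have "c * z = of_real (t * norm z)"
    proof -
      have "cnj (sgn z) * z = of_real (norm z)"
      proof (cases "z = 0")
        case False
        have "cnj (sgn z) * z = cnj z * z / of_real (norm z)" by (simp add: sgn_eq)
        also have "\<dots> = of_real (norm z)"
          using False by (simp add: mult.commute [of "cnj z"] complex_norm_square [symmetric] power2_eq_square)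
        finally show ?thesis .
      qed simp
      then show ?thesis by (simp add: c_def mult.assoc)
    qed
    also have "(norm c * l2_norm s)\<^sup>2 \<le> t\<^sup>2 * (l2_norm s)\<^sup>2"
    proof -
      have "norm c \<le> \<bar>t\<bar>" by (simp add: c_def norm_mult norm_sgn)
      then have "(norm c)\<^sup>2 \<le> t\<^sup>2" by (simp add: abs_le_square_iff [symmetric])
      then show ?thesis by (simp add: power_mult_distrib mult_right_mono)
    qed
    finally have "d \<le> (l2_norm (h k))\<^sup>2 + t\<^sup>2 * (l2_norm s)\<^sup>2 - 2 * (t * norm z)" by simp
    then show ?thesis using g(2) [of k] by (simp add: z_def h_def)
  qed
  \<comment> \<open>The difference \<open>s\<close> lies in the subspace itself. With t = 1 / 2 the
    two inner products contribute only half of the squared norm of \<open>s\<close>, which is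
    absorbed.\<close>
  have h_diff: "(l2_norm (h k - h l))\<^sup>2 \<le> 2 * (e k + e l)" for k l
  proof -
    define s where "s = h k - h l"
    have s: "s \<in> M"
      using fun_vs.subspace_diff [OF M(1) g(1) [of l] g(1) [of k]] by (simp add: s_def h_def)
    have sL: "s \<in> L2" using s M(2) by blast
    have "l2_inner s s = l2_inner s (h k) - l2_inner s (h l)"
      using l2_inner_diff_right [OF sL h h] by (simp add: s_def)
    then have "norm (l2_inner s s) \<le> norm (l2_inner s (h k)) + norm (l2_inner s (h l))"
      by (metis norm_triangle_ineq4)
    moreover have "norm (l2_inner s s) = (l2_norm s)\<^sup>2"
      unfolding l2_inner_self norm_of_real by simp
    ultimately have "(l2_norm s)\<^sup>2 \<le> norm (l2_inner s (h k)) + norm (l2_inner s (h l))"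
      by simp
    moreover have "norm (l2_inner s (h k)) \<le> e k + (l2_norm s)\<^sup>2 / 4" for k
      using almost_orth [OF s, of "1 / 2" k] by (simp add: power2_eq_square)
    from this [of k] this [of l] have "norm (l2_inner s (h k)) + norm (l2_inner s (h l)) \<le> e k + e l + (l2_norm s)\<^sup>2 / 2"
      by simp
    ultimately have "(l2_norm s)\<^sup>2 \<le> 2 * (e k + e l)" by simp
    then show ?thesis by (simp add: s_def)
  qed
  have e_lim: "e \<longlonglongrightarrow> 0"
    unfolding e_def by (intro LIMSEQ_Suc lim_1_over_n)
  have conv: "convergent (\<lambda>k. l2_inner y (h k))" if y: "y \<in> L2" for y
  proof (rule Cauchy_convergent, rule CauchyI)
    fix \<delta> :: real assume \<delta>: "0 < \<delta>"
    define \<gamma> where "\<gamma> = (\<delta> / (l2_norm y + 1))\<^sup>2 / 4"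
    have y1: "0 < l2_norm y + 1" using l2_norm_nonneg [of y] by linarith
    have \<gamma>: "0 < \<gamma>" using \<delta> y1 by (simp add: \<gamma>_def)
    obtain N where N: "\<And>k. N \<le> k \<Longrightarrow> e k < \<gamma>"
      using order_tendstoD(2) [OF e_lim \<gamma>] unfolding eventually_sequentially by blast
    have "norm (l2_inner y (h k) - l2_inner y (h l)) < \<delta>" if "N \<le> k" "N \<le> l" for k l
    proof -
      have "(l2_norm (h k - h l))\<^sup>2 < (\<delta> / (l2_norm y + 1))\<^sup>2"
        using h_diff [of k l] N [OF that(1)] N [OF that(2)] by (simp add: \<gamma>_def)
      then have "l2_norm (h k - h l) < \<delta> / (l2_norm y + 1)"
        by (rule power2_less_imp_less) (use \<delta> y1 in simp)
      then have *: "l2_norm (h k - h l) * (l2_norm y + 1) < \<delta>"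
        using y1 by (simp add: pos_less_divide_eq)
      have "norm (l2_inner y (h k) - l2_inner y (h l)) \<le> l2_norm y * l2_norm (h k - h l)"
        unfolding l2_inner_diff_right [OF y h h, symmetric] by (intro l2_inner_norm_le y L2_fdiff h)
      also have "\<dots> \<le> l2_norm (h k - h l) * (l2_norm y + 1)"
        by (simp add: algebra_simps)
      finally show ?thesis using * by linarith
    qed
    then show "\<exists>M. \<forall>m\<ge>M. \<forall>n\<ge>M. norm (l2_inner y (h m) - l2_inner y (h n)) < \<delta>" by blast
  qed
  define \<phi> where "\<phi> = (\<lambda>y. lim (\<lambda>k. l2_inner y (h k)))"
  have \<phi>: "(\<lambda>k. l2_inner y (h k)) \<longlonglongrightarrow> \<phi> y" if "y \<in> L2" for y
    unfolding \<phi>_def using conv [OF that] by (simp add: convergent_LIMSEQ_iff)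
  have h_norm: "l2_norm (h k) \<le> sqrt (d + 1)" for k
    using g(2) [of k] e(2) [of k] by (intro real_le_rsqrt) (simp add: h_def)
  have "l2_functional \<phi>"
    unfolding l2_functional_def
  proof (intro conjI ballI allI)
    fix y z :: "real \<Rightarrow> complex^'n" and c :: complex assume y: "y \<in> L2"
    show "\<phi> (fscale c y) = c * \<phi> y"
      by (rule LIMSEQ_unique [OF \<phi> [OF L2_fscale [OF y]]])
        (simp only: l2_inner_fscale_left tendsto_mult_left [OF \<phi> [OF y]])
    assume z: "z \<in> L2"
    show "\<phi> (y + z) = \<phi> y + \<phi> z"
      by (rule LIMSEQ_unique [OF \<phi> [OF L2_fplus [OF y z]]])
        (simp only: l2_inner_add_left [OF y z h] tendsto_add [OF \<phi> [OF y] \<phi> [OF z]])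
  next
    have "norm (\<phi> y) \<le> sqrt (d + 1) * l2_norm y" if y: "y \<in> L2" for y
    proof (rule tendsto_upperbound [OF tendsto_norm [OF \<phi> [OF y]]])
      show "\<forall>\<^sub>F k in sequentially. norm (l2_inner y (h k)) \<le> sqrt (d + 1) * l2_norm y"
      proof (intro always_eventually allI)
        fix k
        have "norm (l2_inner y (h k)) \<le> l2_norm y * l2_norm (h k)" by (rule l2_inner_norm_le [OF y h])
        also have "\<dots> \<le> l2_norm y * sqrt (d + 1)" by (intro mult_left_mono h_norm) simp
        finally show "norm (l2_inner y (h k)) \<le> sqrt (d + 1) * l2_norm y" by (simp add: mult.commute)
      qed
    qed simp
    then show "\<exists>K\<ge>0. \<forall>y\<in>L2. norm (\<phi> y) \<le> K * l2_norm y"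
      using d by (intro exI [of _ "sqrt (d + 1)"]) auto
  qed
  \<comment> \<open>The choice t = sqrt (e k) balances both terms and yields a bound that tends to
    zero.\<close>
  moreover have orth: "norm (l2_inner s (h k)) \<le> sqrt (e k) * (1 + (l2_norm s)\<^sup>2)" if "s \<in> M" for s k
  proof -
    have "sqrt (e k) * (2 * norm (l2_inner s (h k))) \<le> e k + e k * (l2_norm s)\<^sup>2"
      using almost_orth [OF that, of "sqrt (e k)" k] e(1) [of k] by (simp add: mult_ac)
    also have "\<dots> = sqrt (e k) * (sqrt (e k) * (1 + (l2_norm s)\<^sup>2))"
      using e(1) [of k] by (simp add: mult.assoc [symmetric] distrib_left)
    finally have "2 * norm (l2_inner s (h k)) \<le> sqrt (e k) * (1 + (l2_norm s)\<^sup>2)"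
      using e(1) [of k] by simp
    then show ?thesis using norm_ge_zero [of "l2_inner s (h k)"] by linarith
  qed
  have sqrt_e: "(\<lambda>k. sqrt (e k) * c) \<longlonglongrightarrow> 0" for c
    using tendsto_mult [OF tendsto_real_sqrt [OF e_lim] tendsto_const [of c]] by simp
  have "\<phi> y = 0" if y: "y \<in> M" for y
  proof (rule LIMSEQ_unique [OF \<phi>])
    show "y \<in> L2" using y M(2) by blast
    show "(\<lambda>k. l2_inner y (h k)) \<longlonglongrightarrow> 0"
      by (rule Lim_null_comparison [OF always_eventually sqrt_e]) (use orth [OF y] in blast)
  qed
  \<comment> \<open>In \<open>g\<^sub>0 = h k + g k\<close> the part \<open>h k\<close> contributes
    at least \<open>d\<close> to the inner product with \<open>h k\<close>, and the part
    \<open>g k\<close> tends to zero because its norms are bounded by \<open>G\<close>.\<close>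
  moreover have "\<phi> g\<^sub>0 \<noteq> 0"
  proof -
    define G where "G = l2_norm g\<^sub>0 + sqrt (d + 1)"
    have g_le: "l2_norm (g k) \<le> G" for k
    proof -
      have "g k = g\<^sub>0 + fscale (- 1) (h k)" by (simp add: h_def)
      then have "l2_norm (g k) \<le> l2_norm g\<^sub>0 + l2_norm (fscale (- 1) (h k))"
        using l2_norm_triangle [OF g0 L2_fscale [OF h, of "- 1" k]] by (simp only: plus_fun_def)
      moreover have "l2_norm (fscale (- 1) (h k)) = l2_norm (h k)"
        unfolding l2_norm_fscale by simp
      ultimately show ?thesis using h_norm [of k] unfolding G_def by linarith
    qed
    have "d - sqrt (e k) * (1 + G\<^sup>2) \<le> Re (l2_inner g\<^sub>0 (h k))" for k
    proof -
      have "g\<^sub>0 = h k + g k" by (simp add: h_def)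
      then have "l2_inner g\<^sub>0 (h k) = l2_inner (h k) (h k) + l2_inner (g k) (h k)"
        using l2_inner_add_left [OF h gL h, of k k k] by simp
      then have "Re (l2_inner g\<^sub>0 (h k)) = (l2_norm (h k))\<^sup>2 + Re (l2_inner (g k) (h k))"
        by (simp add: l2_inner_self del: of_real_power)
      moreover have "d \<le> (l2_norm (h k))\<^sup>2" using d_le [OF g(1)] by (simp add: h_def)
      moreover have "\<bar>Re (l2_inner (g k) (h k))\<bar> \<le> sqrt (e k) * (1 + G\<^sup>2)"
      proof -
        have "\<bar>Re (l2_inner (g k) (h k))\<bar> \<le> sqrt (e k) * (1 + (l2_norm (g k))\<^sup>2)"
          using orth [OF g(1)] abs_Re_le_cmod order_trans by blast
        also have "\<dots> \<le> sqrt (e k) * (1 + G\<^sup>2)"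
          using e(1) [of k] g_le [of k] by (intro mult_left_mono add_left_mono power_mono) auto
        finally show ?thesis .
      qed
      ultimately show ?thesis by linarith
    qed
    moreover have "(\<lambda>k. d - sqrt (e k) * (1 + G\<^sup>2)) \<longlonglongrightarrow> d - 0"
      by (intro tendsto_diff tendsto_const sqrt_e)
    ultimately have "d \<le> Re (\<phi> g\<^sub>0)"
      using LIMSEQ_le [OF _ tendsto_Re [OF \<phi> [OF g0]]] by (metis (no_types, lifting) diff_zero)
    then show ?thesis using d by auto
  qed
  ultimately show thesis using that by blast
qed

section \<open>Criteria for completeness and minimality through functionals\<close>

lemma span_subset_L2: "S \<subseteq> L2 \<Longrightarrow> fun_vs.span S \<subseteq> L2"
  by (rule fun_vs.span_minimal [OF _ subspace_L2])

lemma complete_systemI: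
  fixes S :: "(real \<Rightarrow> complex^'n) set"
  assumes S: "S \<subseteq> L2"
    and zero: "\<And>\<phi> g. l2_functional \<phi> \<Longrightarrow> (\<And>y. y \<in> fun_vs.span S \<Longrightarrow> \<phi> y = 0) \<Longrightarrow> g \<in> L2 \<Longrightarrow> \<phi> g = 0"
  shows "complete_system S"
proof -
  have "g \<in> closed_span S" if g: "g \<in> L2" for g
  proof (rule ccontr)
    assume "g \<notin> closed_span S"
    then obtain \<epsilon> where \<epsilon>: "0 < \<epsilon>" "\<And>h. h \<in> fun_vs.span S \<Longrightarrow> \<epsilon> \<le> l2_norm (g - h)"
      using g unfolding closed_span_def by (auto simp: not_less)
    obtain \<phi> where "l2_functional \<phi>" "\<And>y. y \<in> fun_vs.span S \<Longrightarrow> \<phi> y = 0" "\<phi> g \<noteq> 0"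
      using separating_functional [OF fun_vs.subspace_span span_subset_L2 [OF S] g \<epsilon>] by blast
    then show False using zero g by blast
  qed
  then show ?thesis unfolding complete_system_def closed_span_def by blast
qed

lemma l2_functional_zero: "l2_functional \<phi> \<Longrightarrow> \<phi> 0 = 0"
  using l2_functional_fscale [of \<phi> 0 0] by simp

lemma l2_functional_linear_combination:
  assumes "finite I" "\<And>i. i \<in> I \<Longrightarrow> l2_functional (\<psi> i)"
  shows "l2_functional (\<lambda>y. \<Sum>i\<in>I. c i * \<psi> i y)"
proof -
  have "\<exists>K\<ge>0. \<forall>y\<in>L2. norm (\<psi> i y) \<le> K * l2_norm y" if "i \<in> I" for i
    using assms(2) [OF that] unfolding l2_functional_def by blast
  then obtain K where K: "\<And>i. i \<in> I \<Longrightarrow> 0 \<le> K i" "\<And>i y. i \<in> I \<Longrightarrow> y \<in> L2 \<Longrightarrow> norm (\<psi> i y) \<le> K i * l2_norm y"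
    by metis
  have "norm (\<Sum>i\<in>I. c i * \<psi> i y) \<le> (\<Sum>i\<in>I. norm (c i) * K i) * l2_norm y" if y: "y \<in> L2" for y
  proof -
    have "norm (c i * \<psi> i y) \<le> norm (c i) * K i * l2_norm y" if "i \<in> I" for i
      using mult_left_mono [OF K(2) [OF that y], of "norm (c i)"] by (simp add: norm_mult mult.assoc)
    then show ?thesis
      unfolding sum_distrib_right by (rule sum_norm_le)
  qed
  moreover have "0 \<le> (\<Sum>i\<in>I. norm (c i) * K i)"
    using K(1) by (intro sum_nonneg) auto
  ultimately show ?thesis
    unfolding l2_functional_def using assms(2)
    by (auto simp: l2_functional_add l2_functional_fscale distrib_left sum.distrib sum_distrib_left mult.left_commute
        intro!: sum.cong)
qed

text \<open>A functional equal to 1 at \<open>f\<close> and 0 at the other elements keeps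
  \<open>f\<close> at a positive distance from their span.\<close>

lemma minimal_systemI:
  fixes S :: "(real \<Rightarrow> complex^'n) set"
  assumes S: "S \<subseteq> L2"
    and dual: "\<And>f. f \<in> S \<Longrightarrow> \<exists>\<phi>. l2_functional \<phi> \<and> \<phi> f = 1 \<and> (\<forall>h\<in>S - {f}. \<phi> h = 0)"
  shows "minimal_system S"
  unfolding minimal_system_def
proof (intro ballI notI)
  fix f assume f: "f \<in> S" "f \<in> closed_span (S - {f})"
  obtain \<phi> where \<phi>: "l2_functional \<phi>" "\<phi> f = 1" "\<And>h. h \<in> S - {f} \<Longrightarrow> \<phi> h = 0"
    using dual [OF f(1)] by blast
  obtain K where K: "0 \<le> K" "\<And>y. y \<in> L2 \<Longrightarrow> norm (\<phi> y) \<le> K * l2_norm y"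
    using l2_functional_bound [OF \<phi>(1)] by blast
  have "0 < 1 / (K + 1)" using K(1) by simp
  then obtain g where g: "g \<in> fun_vs.span (S - {f})" "l2_norm (f - g) < 1 / (K + 1)"
    using f(2) unfolding closed_span_def by blast
  have span: "fun_vs.span (S - {f}) \<subseteq> {y \<in> L2. \<phi> y = 0}"
  proof (rule fun_vs.span_minimal)
    show "S - {f} \<subseteq> {y \<in> L2. \<phi> y = 0}" using S \<phi>(3) by blast
    show "fun_vs.subspace {y \<in> L2. \<phi> y = 0}"
      using \<phi>(1) by (auto simp: fun_vs.subspace_def l2_functional_zero l2_functional_add l2_functional_fscale L2_fplus L2_fscale)
  qed
  have L: "f \<in> L2" "g \<in> L2" "\<phi> g = 0" using f(1) S g(1) span by auto
  have "1 = norm (\<phi> (f - g))"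
    using l2_functional_diff [OF \<phi>(1) L(1,2)] \<phi>(2) L(3) by simp
  also have "\<dots> \<le> K * l2_norm (f - g)" by (intro K L2_fdiff L)
  also have "\<dots> \<le> K * (1 / (K + 1))" using g(2) K(1) by (intro mult_left_mono) auto
  also have "\<dots> < 1" using K(1) by simp
  finally show False by simp
qed

text \<open>Linear algebra by duality: inclusion of kernels forces linear dependence. Since
  \<open>V\<close> may be any subspace, finite dimension of root subspaces need not be known
  beforehand. By induction, subtracting a multiple of the new functional reduces to the smaller
  family.\<close>

lemma functional_in_span:
  fixes \<psi> :: "'i \<Rightarrow> (real \<Rightarrow> complex^'n) \<Rightarrow> complex"
  assumes "finite I" and V: "fun_vs.subspace V"
    and lin: "\<And>i x y. i \<in> I \<Longrightarrow> x \<in> V \<Longrightarrow> y \<in> V \<Longrightarrow> \<psi> i (x + y) = \<psi> i x + \<psi> i y"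
      "\<And>i c x. i \<in> I \<Longrightarrow> x \<in> V \<Longrightarrow> \<psi> i (fscale c x) = c * \<psi> i x"
      "\<And>x y. x \<in> V \<Longrightarrow> y \<in> V \<Longrightarrow> \<phi> (x + y) = \<phi> x + \<phi> y"
      "\<And>c x. x \<in> V \<Longrightarrow> \<phi> (fscale c x) = c * \<phi> x"
    and ker: "\<And>x. x \<in> V \<Longrightarrow> (\<And>i. i \<in> I \<Longrightarrow> \<psi> i x = 0) \<Longrightarrow> \<phi> x = 0"
  shows "\<exists>c. \<forall>x\<in>V. \<phi> x = (\<Sum>i\<in>I. c i * \<psi> i x)"
  using assms(1) lin ker
proof (induction I arbitrary: \<phi> rule: finite_induct)
  case empty
  then show ?case by auto
next
  case (insert k I)
  have combine: "\<exists>c. \<forall>x\<in>V. \<phi> x = (\<Sum>i\<in>insert k I. c i * \<psi> i x)"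
    if c: "\<And>x. x \<in> V \<Longrightarrow> \<phi> x - t * \<psi> k x = (\<Sum>i\<in>I. c i * \<psi> i x)" for c t
  proof (intro exI ballI)
    fix x assume x: "x \<in> V"
    have "(\<Sum>i\<in>I. (c(k := t)) i * \<psi> i x) = (\<Sum>i\<in>I. c i * \<psi> i x)"
      using insert.hyps by (intro sum.cong) auto
    then show "\<phi> x = (\<Sum>i\<in>insert k I. (c(k := t)) i * \<psi> i x)"
      using c [OF x] insert.hyps by (simp add: diff_eq_eq add.commute)
  qed
  show ?case
  proof (cases "\<exists>v\<in>V. (\<forall>i\<in>I. \<psi> i v = 0) \<and> \<phi> v \<noteq> 0")
    case False
    have "\<exists>c. \<forall>x\<in>V. \<phi> x = (\<Sum>i\<in>I. c i * \<psi> i x)"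
    proof (rule insert.IH)
      show "\<phi> x = 0" if "x \<in> V" "\<And>i. i \<in> I \<Longrightarrow> \<psi> i x = 0" for x
        using False that by blast
    qed (use insert.prems in blast)+
    then obtain c where "\<And>x. x \<in> V \<Longrightarrow> \<phi> x = (\<Sum>i\<in>I. c i * \<psi> i x)" by blast
    then show ?thesis by (intro combine [of 0 c]) simp
  next
    case True
    then obtain v where v: "v \<in> V" "\<And>i. i \<in> I \<Longrightarrow> \<psi> i v = 0" "\<phi> v \<noteq> 0" by blast
    then have kv: "\<psi> k v \<noteq> 0" using insert.prems(5) [OF v(1)] by auto
    define t where "t = \<phi> v / \<psi> k v"
    have "\<exists>c. \<forall>x\<in>V. \<phi> x - t * \<psi> k x = (\<Sum>i\<in>I. c i * \<psi> i x)"
    proof (rule insert.IH)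
      fix x assume x: "x \<in> V" "\<And>i. i \<in> I \<Longrightarrow> \<psi> i x = 0"
      \<comment> \<open>Moves \<open>x\<close> along \<open>v\<close> into the kernel of \<psi>
        \<open>k\<close>; the other functionals are unaffected because they vanish at
        \<open>v\<close>.\<close>
      define s where "s = - (\<psi> k x / \<psi> k v)"
      have sv: "fscale s v \<in> V" using V v(1) by (rule fun_vs.subspace_scale)
      have "\<phi> (x + fscale s v) = 0"
      proof (rule insert.prems(5))
        show "x + fscale s v \<in> V" by (rule fun_vs.subspace_add [OF V x(1) sv])
        fix i assume i: "i \<in> insert k I"
        have "\<psi> i (x + fscale s v) = \<psi> i x + s * \<psi> i v"
          by (simp only: insert.prems(1) [OF i x(1) sv] insert.prems(2) [OF i v(1)])
        also have "\<dots> = 0" using i x(2) [of i] v(2) [of i] kv by (auto simp: s_def)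
        finally show "\<psi> i (x + fscale s v) = 0" .
      qed
      moreover have "\<phi> (x + fscale s v) = \<phi> x + s * \<phi> v"
        by (simp only: insert.prems(3) [OF x(1) sv] insert.prems(4) [OF v(1)])
      ultimately show "\<phi> x - t * \<psi> k x = 0"
        using kv by (simp add: s_def t_def)
    next
      fix x y assume xy: "x \<in> V" "y \<in> V"
      show "\<psi> i (x + y) = \<psi> i x + \<psi> i y" if "i \<in> I" for i
        using that by (intro insert.prems(1) xy) simp
      show "\<psi> i (fscale c x) = c * \<psi> i x" if "i \<in> I" for i c
        using that by (intro insert.prems(2) xy) simp
      have "\<phi> (x + y) = \<phi> x + \<phi> y" "\<psi> k (x + y) = \<psi> k x + \<psi> k y"
        by (intro insert.prems xy insertI1)+
      then show "\<phi> (x + y) - t * \<psi> k (x + y) = (\<phi> x - t * \<psi> k x) + (\<phi> y - t * \<psi> k y)"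
        by (simp only: ring_distribs) simp
      have "\<phi> (fscale c x) = c * \<phi> x" "\<psi> k (fscale c x) = c * \<psi> k x" for c
        by (intro insert.prems xy insertI1)+
      then show "\<phi> (fscale c x) - t * \<psi> k (fscale c x) = c * (\<phi> x - t * \<psi> k x)" for c
        by (simp only: right_diff_distrib mult.left_commute)
    qed
    then show ?thesis using combine by blast
  qed
qed

context boundary_value_problem
begin

section \<open>Linear structure of root subspaces and the resolvent on Jordan chains\<close>

lemma rel_add: "(y, f) \<in> rel \<zeta> \<Longrightarrow> (z, g) \<in> rel \<zeta> \<Longrightarrow> (y + z, f + g) \<in> rel \<zeta>"
  by (simp add: rel_def L2_fplus sol_add bdry_add)

lemma rel_fscale: "(y, f) \<in> rel \<zeta> \<Longrightarrow> (fscale c y, fscale c f) \<in> rel \<zeta>"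
  by (simp add: rel_def L2_fscale sol_fscale bdry_fscale)

lemma rel_zero: "(0, 0) \<in> rel \<zeta>"
  using rel_fscale [of _ _ \<zeta> 0] by (simp add: rel_def sol_zero bdry_def)

lemma relpow_rel_add: "(y, f) \<in> rel \<zeta> ^^ k \<Longrightarrow> (z, g) \<in> rel \<zeta> ^^ k \<Longrightarrow> (y + z, f + g) \<in> rel \<zeta> ^^ k"
proof (induction k arbitrary: f g)
  case (Suc k)
  from Suc.prems obtain f' g' where "(y, f') \<in> rel \<zeta> ^^ k" "(f', f) \<in> rel \<zeta>" "(z, g') \<in> rel \<zeta> ^^ k" "(g', g) \<in> rel \<zeta>"
    by (meson relpow_Suc_E)
  then show ?case by (meson Suc.IH rel_add relpow_Suc_I)
qed simp

lemma relpow_rel_fscale: "(y, f) \<in> rel \<zeta> ^^ k \<Longrightarrow> (fscale c y, fscale c f) \<in> rel \<zeta> ^^ k"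
proof (induction k arbitrary: f)
  case (Suc k)
  from Suc.prems obtain f' where "(y, f') \<in> rel \<zeta> ^^ k" "(f', f) \<in> rel \<zeta>"
    by (meson relpow_Suc_E)
  then show ?case by (meson Suc.IH rel_fscale relpow_Suc_I)
qed simp

lemma relpow_rel_zero_mono: "(y, 0) \<in> rel \<zeta> ^^ k \<Longrightarrow> (y, 0) \<in> rel \<zeta> ^^ (k + l)"
  by (induction l) (auto intro: rel_zero)

lemma subspace_root_set: "fun_vs.subspace (root_set \<zeta>)"
proof (rule fun_vs.subspaceI)
  show "0 \<in> root_set \<zeta>" unfolding root_set_def using relpow_0_I [of 0 "rel \<zeta>"] by blast
  fix y z :: "real \<Rightarrow> complex^'n" and c
  assume "y \<in> root_set \<zeta>"
  then obtain k where k: "(y, 0) \<in> rel \<zeta> ^^ k" unfolding root_set_def by blast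
  from relpow_rel_fscale [OF k, of c] show "fscale c y \<in> root_set \<zeta>"
    unfolding root_set_def fun_vs.scale_zero_right by blast
  assume "z \<in> root_set \<zeta>"
  then obtain l where l: "(z, 0) \<in> rel \<zeta> ^^ l" unfolding root_set_def by blast
  have "(y + z, 0 + 0) \<in> rel \<zeta> ^^ (k + l)"
    using relpow_rel_zero_mono [OF k, of l] relpow_rel_zero_mono [OF l, of k]
    by (intro relpow_rel_add) (simp_all only: add.commute)
  then show "y + z \<in> root_set \<zeta>"
    unfolding root_set_def add_0 by blast
qed

lemma root_setE:
  assumes "y \<in> root_set \<zeta>"
  obtains u k where "u 0 = y" "u k = 0" "\<And>l. l < k \<Longrightarrow> (u l, u (Suc l)) \<in> rel \<zeta>"
proof -
  obtain u k where "u 0 = y" "u k = 0" "\<forall>l<k. (u l, u (Suc l)) \<in> rel \<zeta>"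
    using assms unfolding root_set_def relpow_fun_conv mem_Collect_eq by blast
  then show thesis by (intro that [of u k]) auto
qed

lemma root_set_C0: "root_set \<zeta> \<subseteq> C0"
proof
  fix y assume y: "y \<in> root_set \<zeta>"
  obtain u k where "u 0 = y" "u k = 0" "\<And>l. l < k \<Longrightarrow> (u l, u (Suc l)) \<in> rel \<zeta>"
    using root_setE [OF y] by blast
  then show "y \<in> C0"
    by (cases k) (auto simp: rel_def dest: sol_C0)
qed

lemma resolvent_initial: "g \<in> L2 \<Longrightarrow> num \<zeta> g $ i / \<Delta> \<zeta> = - (resolvent \<zeta> g 0 $ i)"
  by (simp add: resolvent_def solve_initial)

text \<open>On a Jordan chain at \<mu> the resolvent is the finite sum of the terms -u_l / (\<zeta>
  - \<mu>)^(l+1), verified by telescoping. The quotient \<open>num / \<Delta>\<close> is minus its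
  value at 0.\<close>

lemma resolvent_root:
  assumes u: "u k = 0" "\<And>l. l < k \<Longrightarrow> (u l, u (Suc l)) \<in> rel \<mu>" and \<Delta>: "\<Delta> \<zeta> \<noteq> 0" and ne: "\<zeta> \<noteq> \<mu>"
    and k: "0 < k"
  shows "num \<zeta> (u 0) $ i / \<Delta> \<zeta> = (\<Sum>l<k. u l 0 $ i / (\<zeta> - \<mu>) ^ Suc l)"
proof -
  define p where "p = inverse (\<zeta> - \<mu>)"
  have p: "p * (\<zeta> - \<mu>) = 1" using ne by (simp add: p_def)
  define y where "y = (\<Sum>l<k. fscale (- (p ^ Suc l)) (u l))"
  define f where "f = (\<Sum>l<k. fscale (- (p ^ Suc l)) (u (Suc l) + fscale (\<mu> - \<zeta>) (u l)))"
  have uL: "u l \<in> L2" "u (Suc l) \<in> L2" if "l < k" for l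
    using u(2) [OF that] by (auto simp: rel_def dest: sol_C0 C0_L2)
  have "sol \<zeta> f y"
    unfolding f_def y_def
  proof (intro sol_sum)
    fix l assume "l \<in> {..<k}"
    then have l: "l < k" by simp
    have "sol \<zeta> (u (Suc l) + fscale (\<mu> - \<zeta>) (u l)) (u l)"
      using u(2) [OF l] sol_shift [of \<mu> "u (Suc l)" "u l" \<zeta>] by (simp add: rel_def)
    then show "sol \<zeta> (fscale (- (p ^ Suc l)) (u (Suc l) + fscale (\<mu> - \<zeta>) (u l))) (fscale (- (p ^ Suc l)) (u l))"
      using uL [OF l] by (intro sol_fscale L2_fplus L2_fscale)
    show "fscale (- (p ^ Suc l)) (u (Suc l) + fscale (\<mu> - \<zeta>) (u l)) \<in> L2"
      using uL [OF l] by (intro L2_fplus L2_fscale)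
  qed
  moreover have "f = u 0"
  proof -
    have "fscale (- (p ^ Suc l)) (u (Suc l) + fscale (\<mu> - \<zeta>) (u l)) = fscale (p ^ l) (u l) - fscale (p ^ Suc l) (u (Suc l))" for l
    proof -
      have "- (p ^ Suc l) * (\<mu> - \<zeta>) = p ^ l * (p * (\<zeta> - \<mu>))" by (simp add: algebra_simps)
      then have "- (p ^ Suc l) * (\<mu> - \<zeta>) = p ^ l" by (simp only: p mult_1_right)
      then show ?thesis
        by (simp only: fun_vs.scale_right_distrib fun_vs.scale_scale) (simp add: algebra_simps)
    qed
    then have "f = (\<Sum>l<k. fscale (p ^ l) (u l) - fscale (p ^ Suc l) (u (Suc l)))"
      unfolding f_def by (intro sum.cong refl)
    also have "\<dots> = fscale (p ^ 0) (u 0) - fscale (p ^ k) (u k)"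
      by (rule sum_lessThan_telescope')
    finally show ?thesis using u(1) by simp
  qed
  moreover have "bdry y = 0"
  proof -
    have zero: "bdry (fscale c (u l)) = 0" if "l < k" for c l
      using u(2) [OF that] by (simp add: rel_def bdry_fscale)
    have bdry_sum: "finite A \<Longrightarrow> bdry (\<Sum>l\<in>A. v l) = (\<Sum>l\<in>A. bdry (v l))" for A and v :: "nat \<Rightarrow> real \<Rightarrow> complex^'n"
    proof (induction A rule: finite_induct)
      case empty
      then show ?case by (simp add: bdry_def)
    next
      case (insert j A)
      then show ?case unfolding sum.insert [OF insert.hyps] by (simp only: bdry_add)
    qed
    show ?thesis
      unfolding y_def bdry_sum [OF finite_lessThan] by (intro sum.neutral ballI zero) simp
  qed
  ultimately have "y = resolvent \<zeta> (u 0)"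
    using sol_bdry_zero_iff [OF uL(1) [OF k] \<Delta>] by blast
  then have "num \<zeta> (u 0) $ i / \<Delta> \<zeta> = - (y 0 $ i)"
    using resolvent_initial [OF uL(1) [OF k]] by simp
  also have "y 0 $ i = (\<Sum>l<k. - (p ^ Suc l) * u l 0 $ i)"
  proof -
    have "finite A \<Longrightarrow> (\<Sum>l\<in>A. v l) 0 $ i = (\<Sum>l\<in>A. v l 0 $ i)" for A and v :: "nat \<Rightarrow> real \<Rightarrow> complex^'n"
    proof (induction A rule: finite_induct)
      case (insert j A)
      then show ?case unfolding sum.insert [OF insert.hyps] by simp
    qed simp
    then show ?thesis by (simp add: y_def fscale_def)
  qed
  finally show ?thesis
    by (simp add: p_def sum_negf power_inverse divide_inverse mult.commute)
qed

text \<open>On a small circle this is, up to the factor -2 pi \<i>, the value at x = 0 of a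
  component of the Laurent coefficient of order -(j+1) of the resolvent. Evaluation at 0 is not
  continuous on L2, but after the resolvent it is, through the bound for \<open>num\<close>.\<close>

definition residue_functional :: "complex \<Rightarrow> real \<Rightarrow> nat \<Rightarrow> 'n \<Rightarrow> (real \<Rightarrow> complex^'n) \<Rightarrow> complex" where
  "residue_functional \<zeta> r j i g =
    contour_integral (circlepath \<zeta> r) (\<lambda>z. (z - \<zeta>) ^ j * (num z g $ i / \<Delta> z))"

section \<open>Residue functionals around a point isolated from the other zeros of the
  determinant\<close>

context
  fixes \<zeta>\<^sub>0 :: complex and r :: real
  assumes r: "0 < r" and nonzero: "\<And>w. w \<in> cball \<zeta>\<^sub>0 (2 * r) - {\<zeta>\<^sub>0} \<Longrightarrow> \<Delta> w \<noteq> 0"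
begin

lemma circle_nonzero: "z \<in> sphere \<zeta>\<^sub>0 r \<Longrightarrow> \<Delta> z \<noteq> 0"
  using r by (intro nonzero) auto

lemma residue_integrable:
  assumes "g \<in> L2"
  shows "(\<lambda>z. (z - \<zeta>\<^sub>0) ^ j * (num z g $ i / \<Delta> z)) contour_integrable_on circlepath \<zeta>\<^sub>0 r"
proof (rule contour_integrable_continuous_circlepath)
  have "continuous_on (sphere \<zeta>\<^sub>0 r) (\<lambda>z. (z - \<zeta>\<^sub>0) ^ j * (num z g $ i / \<Delta> z))"
    using circle_nonzero
    by (intro continuous_intros holomorphic_on_imp_continuous_on num_holomorphic assms \<Delta>_holomorphic) auto
  then show "continuous_on (path_image (circlepath \<zeta>\<^sub>0 r)) (\<lambda>z. (z - \<zeta>\<^sub>0) ^ j * (num z g $ i / \<Delta> z))"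
    using r by simp
qed

lemma resolvent_sol:
  assumes "\<Delta> \<zeta> \<noteq> 0" "g \<in> L2"
  shows "sol \<zeta> g (resolvent \<zeta> g)" "bdry (resolvent \<zeta> g) = 0"
  using sol_bdry_zero_iff [OF assms(2,1)] by blast+

lemma resolvent_add:
  assumes "\<Delta> \<zeta> \<noteq> 0" "g \<in> L2" "h \<in> L2"
  shows "resolvent \<zeta> (g + h) = resolvent \<zeta> g + resolvent \<zeta> h"
proof -
  have "sol \<zeta> (g + h) (resolvent \<zeta> g + resolvent \<zeta> h) \<and> bdry (resolvent \<zeta> g + resolvent \<zeta> h) = 0"
    by (simp add: sol_add bdry_add resolvent_sol assms)
  then show ?thesis
    using sol_bdry_zero_iff [OF L2_fplus [OF assms(2,3)] assms(1)] by simp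
qed

lemma resolvent_fscale:
  assumes "\<Delta> \<zeta> \<noteq> 0" "g \<in> L2"
  shows "resolvent \<zeta> (fscale c g) = fscale c (resolvent \<zeta> g)"
proof -
  have "sol \<zeta> (fscale c g) (fscale c (resolvent \<zeta> g)) \<and> bdry (fscale c (resolvent \<zeta> g)) = 0"
    by (simp add: sol_fscale bdry_fscale resolvent_sol assms)
  then show ?thesis
    using sol_bdry_zero_iff [OF L2_fscale [OF assms(2)] assms(1)] by simp
qed

text \<open>Linearity comes from uniqueness of the resolvent on the circle, continuity from
  \<open>strip_bounds\<close> and the positive minimum of |\<open>\<Delta>\<close>| on the
  circle.\<close>

lemma residue_functional_l2: "l2_functional (residue_functional \<zeta>\<^sub>0 r j i)"
proof -
  have sphere: "path_image (circlepath \<zeta>\<^sub>0 r) = sphere \<zeta>\<^sub>0 r" using r by simp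
  have "residue_functional \<zeta>\<^sub>0 r j i (y + z) = residue_functional \<zeta>\<^sub>0 r j i y + residue_functional \<zeta>\<^sub>0 r j i z"
    if y: "y \<in> L2" and z: "z \<in> L2" for y z
    unfolding residue_functional_def contour_integral_add [OF residue_integrable [OF y] residue_integrable [OF z], symmetric]
  proof (rule contour_integral_eq)
    fix w assume "w \<in> path_image (circlepath \<zeta>\<^sub>0 r)"
    then have "\<Delta> w \<noteq> 0" using circle_nonzero sphere by blast
    then show "(w - \<zeta>\<^sub>0) ^ j * (num w (y + z) $ i / \<Delta> w) =
        (w - \<zeta>\<^sub>0) ^ j * (num w y $ i / \<Delta> w) + (w - \<zeta>\<^sub>0) ^ j * (num w z $ i / \<Delta> w)"
      by (simp add: resolvent_initial resolvent_add L2_fplus y z right_diff_distrib del: times_divide_eq_right)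
  qed
  moreover have "residue_functional \<zeta>\<^sub>0 r j i (fscale c y) = c * residue_functional \<zeta>\<^sub>0 r j i y"
    if y: "y \<in> L2" for c y
    unfolding residue_functional_def contour_integral_lmul [OF residue_integrable [OF y], symmetric]
  proof (rule contour_integral_eq)
    fix w assume "w \<in> path_image (circlepath \<zeta>\<^sub>0 r)"
    then have nz: "\<Delta> w \<noteq> 0" using circle_nonzero sphere by blast
    show "(w - \<zeta>\<^sub>0) ^ j * (num w (fscale c y) $ i / \<Delta> w) = c * ((w - \<zeta>\<^sub>0) ^ j * (num w y $ i / \<Delta> w))"
      unfolding resolvent_initial [OF L2_fscale [OF y]] resolvent_initial [OF y] resolvent_fscale [OF nz y]
      by (simp add: fscale_def)
  qed
  moreover have "\<exists>K\<ge>0. \<forall>y\<in>L2. norm (residue_functional \<zeta>\<^sub>0 r j i y) \<le> K * l2_norm y"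
  proof (rule strip_bounds [of "\<bar>Im \<zeta>\<^sub>0\<bar> + r"])
    fix K assume K: "0 \<le> K" "\<And>\<zeta> g k. \<bar>Im \<zeta>\<bar> \<le> \<bar>Im \<zeta>\<^sub>0\<bar> + r \<Longrightarrow> g \<in> L2 \<Longrightarrow> norm (num \<zeta> g $ k) \<le> K * l2_norm g"
    have "continuous_on (sphere \<zeta>\<^sub>0 r) (\<lambda>z. norm (\<Delta> z))"
      by (intro continuous_intros holomorphic_on_imp_continuous_on \<Delta>_holomorphic)
    then obtain q where q: "q \<in> sphere \<zeta>\<^sub>0 r" "\<And>z. z \<in> sphere \<zeta>\<^sub>0 r \<Longrightarrow> norm (\<Delta> q) \<le> norm (\<Delta> z)"
      using continuous_attains_inf [of "sphere \<zeta>\<^sub>0 r" "\<lambda>z. norm (\<Delta> z)"] r by (auto simp: less_imp_le)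
    have q0: "0 < norm (\<Delta> q)" using circle_nonzero [OF q(1)] by simp
    have "norm (residue_functional \<zeta>\<^sub>0 r j i y) \<le> r ^ j * (K * l2_norm y / norm (\<Delta> q)) * (2 * pi * r)" if y: "y \<in> L2" for y
      unfolding residue_functional_def
    proof (rule has_contour_integral_bound_circlepath [OF has_contour_integral_integral [OF residue_integrable [OF y]]])
      show "0 \<le> r ^ j * (K * l2_norm y / norm (\<Delta> q))" using r K by simp
      fix z assume z: "norm (z - \<zeta>\<^sub>0) = r"
      have "\<bar>Im z\<bar> \<le> \<bar>Im \<zeta>\<^sub>0\<bar> + r" using abs_Im_le_cmod [of "z - \<zeta>\<^sub>0"] z by simp
      from K(2) [OF this y, of i] have "norm (num z y $ i) / norm (\<Delta> z) \<le> K * l2_norm y / norm (\<Delta> q)"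
        using q(2) [of z] q0 z K(1) by (intro frac_le) (auto simp: dist_norm norm_minus_commute)
      then show "norm ((z - \<zeta>\<^sub>0) ^ j * (num z y $ i / \<Delta> z)) \<le> r ^ j * (K * l2_norm y / norm (\<Delta> q))"
        using r z by (simp add: norm_mult norm_power norm_divide mult_left_mono del: times_divide_eq_right)
    qed (rule r)
    then show ?thesis
      using K(1) r by (intro exI [of _ "r ^ j * (K / norm (\<Delta> q)) * (2 * pi * r)"]) (auto simp: mult_ac)
  qed
  ultimately show ?thesis unfolding l2_functional_def by blast
qed

lemma residue_functional_eqI:
  assumes "(h has_contour_integral c) (circlepath \<zeta>\<^sub>0 r)"
    "\<And>z. z \<in> sphere \<zeta>\<^sub>0 r \<Longrightarrow> (z - \<zeta>\<^sub>0) ^ j * (num z g $ i / \<Delta> z) = h z"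
  shows "residue_functional \<zeta>\<^sub>0 r j i g = c"
  unfolding residue_functional_def using assms r
  by (intro contour_integral_unique) (rule has_contour_integral_eq [of h], auto)

lemma residue_functional_holomorphic:
  assumes "h holomorphic_on ball \<zeta>\<^sub>0 \<rho>" "r < \<rho>"
    "\<And>z. z \<in> sphere \<zeta>\<^sub>0 r \<Longrightarrow> (z - \<zeta>\<^sub>0) ^ j * (num z g $ i / \<Delta> z) = h z"
  shows "residue_functional \<zeta>\<^sub>0 r j i g = 0"
proof (rule residue_functional_eqI [OF _ assms(3)])
  show "(h has_contour_integral 0) (circlepath \<zeta>\<^sub>0 r)"
    using assms(2) r by (intro Cauchy_theorem_disc_simple [OF assms(1)]) auto
qed

text \<open>By \<open>resolvent_root\<close> the only pole of the integrand is \<mu>, which lies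
  outside the disc of radius 2r, so Cauchy's theorem applies.\<close>

lemma residue_functional_other_root:
  assumes \<mu>: "\<Delta> \<mu> = 0" "\<mu> \<noteq> \<zeta>\<^sub>0" and y: "y \<in> root_set \<mu>"
  shows "residue_functional \<zeta>\<^sub>0 r j i y = 0"
proof -
  obtain u k where u: "u 0 = y" "u k = 0" "\<And>l. l < k \<Longrightarrow> (u l, u (Suc l)) \<in> rel \<mu>"
    using root_setE [OF y] by blast
  show ?thesis
  proof (cases "k = 0")
    case True
    then show ?thesis using u l2_functional_zero [OF residue_functional_l2] by simp
  next
    case False
    then have k: "0 < k" by simp
    have \<rho>: "2 * r < dist \<zeta>\<^sub>0 \<mu>" using nonzero [of \<mu>] \<mu> by (auto simp: not_le [symmetric])
    show ?thesis
    proof (rule residue_functional_holomorphic)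
      show "(\<lambda>z. (z - \<zeta>\<^sub>0) ^ j * (\<Sum>l<k. u l 0 $ i / (z - \<mu>) ^ Suc l)) holomorphic_on ball \<zeta>\<^sub>0 (dist \<zeta>\<^sub>0 \<mu>)"
        by (intro holomorphic_intros) auto
      show "r < dist \<zeta>\<^sub>0 \<mu>" using \<rho> r by simp
      fix z assume z: "z \<in> sphere \<zeta>\<^sub>0 r"
      then have "z \<noteq> \<mu>" using \<rho> r by auto
      then show "(z - \<zeta>\<^sub>0) ^ j * (num z y $ i / \<Delta> z) = (z - \<zeta>\<^sub>0) ^ j * (\<Sum>l<k. u l 0 $ i / (z - \<mu>) ^ Suc l)"
        using resolvent_root [OF u(2,3) circle_nonzero [OF z] _ k, of i] u(1) by simp
    qed
  qed
qed

text \<open>The power of z - \<open>\<zeta>\<^sub>0\<close> cancels the zero of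
  \<open>\<Delta>\<close>, and the integrand extends holomorphically to the disc of radius 2r. Hence
  finitely many residue functionals carry all information.\<close>

lemma residue_functional_high_order:
  assumes g: "g \<in> L2" and j: "zero_order \<zeta>\<^sub>0 \<le> j"
  shows "residue_functional \<zeta>\<^sub>0 r j i g = 0"
proof -
  let ?D = "fps_expansion (\<lambda>z. \<Delta> (\<zeta>\<^sub>0 + z)) 0"
  let ?N = "fps_expansion (\<lambda>z. num (\<zeta>\<^sub>0 + z) g $ i) 0"
  have P: "(\<lambda>z. z ^ j * num (\<zeta>\<^sub>0 + z) g $ i) has_fps_expansion fps_X ^ j * ?N"
    by (intro has_fps_expansion_mult has_fps_expansion_power has_fps_expansion_fps_X holomorphic_shift_fps num_holomorphic g)
  obtain d where d: "(\<lambda>z. if z = 0 then d else z ^ j * num (\<zeta>\<^sub>0 + z) g $ i / \<Delta> (\<zeta>\<^sub>0 + z)) analytic_on {0}"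
  \<comment> \<open>The vanishing numerator is split off because the subdegree of the zero series is
    0 by convention.\<close>
  proof (cases "?N = 0")
    case True
    have "eventually (\<lambda>z. eval_fps 0 z = z ^ j * num (\<zeta>\<^sub>0 + z) g $ i) (nhds 0)"
      using P unfolding True mult_zero_right has_fps_expansion_def by blast
    then have "eventually (\<lambda>z. 0 = (if z = 0 then 0 else z ^ j * num (\<zeta>\<^sub>0 + z) g $ i / \<Delta> (\<zeta>\<^sub>0 + z))) (nhds 0)"
    proof eventually_elim
      case (elim z)
      then have "z ^ j * num (\<zeta>\<^sub>0 + z) g $ i = 0" by (simp only: eval_fps_0)
      then show ?case by (simp only: div_0 if_cancel)
    qed
    from analytic_at_cong [OF this refl] show thesis
      by (intro that [of 0]) simp
  next
    case False
    have "subdegree ?D \<le> subdegree (fps_X ^ j * ?N)"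
      using j False by (simp add: zero_order_def)
    note quotient = has_fps_expansion_divide [OF P \<Delta>_fps this \<Delta>_fps_nonzero]
    show thesis
      by (rule that, rule has_fps_expansion_imp_analytic_0, rule quotient, rule refl)
  qed
  define G where "G = (\<lambda>z. if z = 0 then d else z ^ j * num (\<zeta>\<^sub>0 + z) g $ i / \<Delta> (\<zeta>\<^sub>0 + z))"
  define h where "h = (\<lambda>w. if w = \<zeta>\<^sub>0 then d else (w - \<zeta>\<^sub>0) ^ j * (num w g $ i / \<Delta> w))"
  have "h analytic_on {w}" if w: "w \<in> ball \<zeta>\<^sub>0 (2 * r)" for w
  proof (cases "w = \<zeta>\<^sub>0")
    case True
    have "(G \<circ> (\<lambda>w. w - \<zeta>\<^sub>0)) analytic_on {\<zeta>\<^sub>0}"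
      using d by (intro analytic_on_compose_gen [where T = "{0}"] analytic_intros) (auto simp: G_def)
    also have "G \<circ> (\<lambda>w. w - \<zeta>\<^sub>0) = h" by (auto simp: G_def h_def fun_eq_iff)
    finally show ?thesis using True by simp
  next
    case False
    have "(\<lambda>w. (w - \<zeta>\<^sub>0) ^ j * (num w g $ i / \<Delta> w)) holomorphic_on (ball \<zeta>\<^sub>0 (2 * r) - {\<zeta>\<^sub>0})"
      using nonzero by (intro holomorphic_intros num_holomorphic g \<Delta>_holomorphic) auto
    then have "h holomorphic_on (ball \<zeta>\<^sub>0 (2 * r) - {\<zeta>\<^sub>0})"
      by (rule holomorphic_transform) (simp add: h_def)
    then have "h analytic_on (ball \<zeta>\<^sub>0 (2 * r) - {\<zeta>\<^sub>0})"
      by (simp add: analytic_on_open open_delete)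
    then show ?thesis using False w by (auto intro: analytic_on_subset)
  qed
  then have "h analytic_on ball \<zeta>\<^sub>0 (2 * r)"
    using analytic_on_analytic_at by blast
  then have "h holomorphic_on ball \<zeta>\<^sub>0 (2 * r)"
    by (rule analytic_imp_holomorphic)
  then show ?thesis
    by (rule residue_functional_holomorphic) (use r in \<open>auto simp: h_def\<close>)
qed

text \<open>The last nonzero element of the Jordan chain is an eigenfunction and is determined by
  its value at 0. The residue functional of matching order picks out a component of exactly this
  value.\<close>

lemma residue_functional_separates:
  assumes y: "y \<in> root_set \<zeta>\<^sub>0" and zero: "\<And>j i. j < zero_order \<zeta>\<^sub>0 \<Longrightarrow> residue_functional \<zeta>\<^sub>0 r j i y = 0"
  shows "y = 0"
proof (rule ccontr)
  assume "y \<noteq> 0"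
  obtain u k where u: "u 0 = y" "u k = 0" "\<And>l. l < k \<Longrightarrow> (u l, u (Suc l)) \<in> rel \<zeta>\<^sub>0"
    using root_setE [OF y] by blast
  \<comment> \<open>The first index whose successor vanishes; so \<open>u J\<close> is nonzero also
    for \<open>J = 0\<close>, where it is \<open>y\<close>.\<close>
  define J where "J = (LEAST J. u (Suc J) = 0)"
  have "k \<noteq> 0" using u \<open>y \<noteq> 0\<close> by metis
  then have "u (Suc (k - 1)) = 0" using u(2) by simp
  then have J: "u (Suc J) = 0" "J \<le> k - 1"
    unfolding J_def by (rule LeastI, rule Least_le)
  have Jk: "J < k" using J(2) \<open>k \<noteq> 0\<close> by simp
  have uJ: "u J \<noteq> 0"
  proof (cases J)
    case 0
    then show ?thesis using u(1) \<open>y \<noteq> 0\<close> by simp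
  next
    case (Suc l)
    then show ?thesis using not_less_Least [of l "\<lambda>J. u (Suc J) = 0"] by (simp add: J_def)
  qed
  have "sol \<zeta>\<^sub>0 0 (u J)" using u(3) [OF Jk] J(1) by (simp add: rel_def)
  then have "u J = solve \<zeta>\<^sub>0 0 (u J 0)"
    by (intro solve_unique [symmetric]) simp_all
  then have "u J 0 \<noteq> 0" using uJ solve_zero by metis
  then obtain i where i: "u J 0 $ i \<noteq> 0" by (auto simp: vec_eq_iff)
  have yL: "y \<in> L2" using y root_set_C0 C0_L2 by blast
  \<comment> \<open>The integrand is p / (z - \<open>\<zeta>\<^sub>0\<close>); at the centre only
    the summand with l = J survives, since its exponent is 0.\<close>
  define p where "p = (\<lambda>z. \<Sum>l<Suc J. u l 0 $ i * (z - \<zeta>\<^sub>0) ^ (J - l))"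
  have "residue_functional \<zeta>\<^sub>0 r J i y = 2 * of_real pi * \<i> * p \<zeta>\<^sub>0"
  proof (rule residue_functional_eqI)
    show "((\<lambda>z. p z / (z - \<zeta>\<^sub>0)) has_contour_integral 2 * of_real pi * \<i> * p \<zeta>\<^sub>0) (circlepath \<zeta>\<^sub>0 r)"
      unfolding p_def using r by (intro Cauchy_integral_circlepath_simple holomorphic_intros) auto
    fix z assume z: "z \<in> sphere \<zeta>\<^sub>0 r"
    then have ne: "z \<noteq> \<zeta>\<^sub>0" using r by auto
    have "num z (u 0) $ i / \<Delta> z = (\<Sum>l<Suc J. u l 0 $ i / (z - \<zeta>\<^sub>0) ^ Suc l)"
      using u(3) Jk
      by (intro resolvent_root [where u = u and k = "Suc J", OF J(1) _ circle_nonzero [OF z] ne]) auto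
    then have "(z - \<zeta>\<^sub>0) ^ J * (num z y $ i / \<Delta> z) = (\<Sum>l<Suc J. (z - \<zeta>\<^sub>0) ^ J * (u l 0 $ i / (z - \<zeta>\<^sub>0) ^ Suc l))"
      by (simp only: u(1) sum_distrib_left)
    also have "\<dots> = (\<Sum>l<Suc J. u l 0 $ i * (z - \<zeta>\<^sub>0) ^ (J - l) / (z - \<zeta>\<^sub>0))"
      using ne by (intro sum.cong refl) (simp add: power_diff field_simps)
    finally show "(z - \<zeta>\<^sub>0) ^ J * (num z y $ i / \<Delta> z) = p z / (z - \<zeta>\<^sub>0)"
      by (simp only: p_def sum_divide_distrib)
  qed
  moreover have "p \<zeta>\<^sub>0 = u J 0 $ i"
  proof -
    have "(\<Sum>l<J. u l 0 $ i * (\<zeta>\<^sub>0 - \<zeta>\<^sub>0) ^ (J - l)) = 0"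
      by (intro sum.neutral) auto
    then show ?thesis by (simp add: p_def)
  qed
  moreover have "residue_functional \<zeta>\<^sub>0 r J i y = 0"
    using zero [of J i] residue_functional_high_order [OF yL, of J i] by (cases "J < zero_order \<zeta>\<^sub>0") auto
  ultimately show False using i by simp
qed

end

text \<open>The coordinate along \<open>f\<close> is a linear functional on the root subspace. It is
  a combination of finitely many residue functionals because these separate points, and the
  combination extends it continuously to L2 with value 0 on all other root subspaces.\<close>

lemma root_system_dual:
  assumes bas: "\<And>\<zeta>. \<Delta> \<zeta> = 0 \<Longrightarrow> fun_vs.independent (bas \<zeta>) \<and> fun_vs.span (bas \<zeta>) = root_set \<zeta>"
    and \<zeta>\<^sub>0: "\<Delta> \<zeta>\<^sub>0 = 0" and f: "f \<in> bas \<zeta>\<^sub>0"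
  obtains \<phi> where "l2_functional \<phi>" "\<phi> f = 1" "\<And>\<zeta> h. \<Delta> \<zeta> = 0 \<Longrightarrow> h \<in> bas \<zeta> \<Longrightarrow> h \<noteq> f \<Longrightarrow> \<phi> h = 0"
proof -
  obtain \<beta> where \<beta>: "\<Delta> \<beta> \<noteq> 0" by (rule \<Delta>_nontrivial)
  obtain s where s: "0 < s" "\<And>w. w \<in> cball \<zeta>\<^sub>0 s - {\<zeta>\<^sub>0} \<Longrightarrow> \<Delta> w \<noteq> 0"
    using entire_nonzero_nearby [OF \<Delta>_holomorphic \<beta>] by metis
  define r where "r = s / 2"
  have r: "0 < r" and nz: "\<And>w. w \<in> cball \<zeta>\<^sub>0 (2 * r) - {\<zeta>\<^sub>0} \<Longrightarrow> \<Delta> w \<noteq> 0"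
    using s by (auto simp: r_def)
  define I where "I = {..<zero_order \<zeta>\<^sub>0} \<times> (UNIV :: 'n set)"
  define \<psi> where "\<psi> = (\<lambda>(j, i). residue_functional \<zeta>\<^sub>0 r j i)"
  define \<rho> where "\<rho> = (\<lambda>y. fun_vs.representation (bas \<zeta>\<^sub>0) y f)"
  have ind: "fun_vs.independent (bas \<zeta>\<^sub>0)" and span: "fun_vs.span (bas \<zeta>\<^sub>0) = root_set \<zeta>\<^sub>0"
    using bas [OF \<zeta>\<^sub>0] by auto
  have L: "root_set \<zeta> \<subseteq> L2" for \<zeta> using root_set_C0 C0_L2 by blast
  have \<psi>: "l2_functional (\<psi> x)" for x
    using residue_functional_l2 [OF r nz] by (simp add: \<psi>_def split: prod.split)
  have "\<exists>c. \<forall>x\<in>root_set \<zeta>\<^sub>0. \<rho> x = (\<Sum>i\<in>I. c i * \<psi> i x)"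
  proof (rule functional_in_span [OF _ subspace_root_set])
    show "finite I" by (simp add: I_def)
    show "\<psi> i (x + y) = \<psi> i x + \<psi> i y" if "x \<in> root_set \<zeta>\<^sub>0" "y \<in> root_set \<zeta>\<^sub>0" for i x y
      using that L by (intro l2_functional_add \<psi>) auto
    show "\<psi> i (fscale c x) = c * \<psi> i x" if "x \<in> root_set \<zeta>\<^sub>0" for i c x
      using that L by (intro l2_functional_fscale \<psi>) auto
    show "\<rho> (x + y) = \<rho> x + \<rho> y" if "x \<in> root_set \<zeta>\<^sub>0" "y \<in> root_set \<zeta>\<^sub>0" for x y
      using that unfolding \<rho>_def by (subst fun_vs.representation_add [OF ind]) (simp_all add: span)
    show "\<rho> (fscale c x) = c * \<rho> x" if "x \<in> root_set \<zeta>\<^sub>0" for c x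
      using that unfolding \<rho>_def by (subst fun_vs.representation_scale [OF ind]) (simp_all add: span)
    show "\<rho> x = 0" if x: "x \<in> root_set \<zeta>\<^sub>0" "\<And>i. i \<in> I \<Longrightarrow> \<psi> i x = 0" for x
    proof -
      have "x = 0"
        by (rule residue_functional_separates [OF r nz x(1)])
          (use x(2) in \<open>auto simp: I_def \<psi>_def\<close>)
      then show ?thesis by (simp add: \<rho>_def fun_vs.representation_zero)
    qed
  qed
  then obtain c where c: "\<And>x. x \<in> root_set \<zeta>\<^sub>0 \<Longrightarrow> \<rho> x = (\<Sum>i\<in>I. c i * \<psi> i x)" by blast
  have mem: "h \<in> root_set \<zeta>" if "\<Delta> \<zeta> = 0" "h \<in> bas \<zeta>" for \<zeta> h
    using bas [OF that(1)] fun_vs.span_base [OF that(2)] by simp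
  show thesis
  proof (rule that)
    show "l2_functional (\<lambda>y. \<Sum>i\<in>I. c i * \<psi> i y)"
      by (intro l2_functional_linear_combination \<psi>) (simp add: I_def)
    show "(\<Sum>i\<in>I. c i * \<psi> i f) = 1"
      using c [OF mem [OF \<zeta>\<^sub>0 f]] fun_vs.representation_basis [OF ind f] by (simp add: \<rho>_def)
    fix \<zeta> h assume h: "\<Delta> \<zeta> = 0" "h \<in> bas \<zeta>" "h \<noteq> f"
    show "(\<Sum>i\<in>I. c i * \<psi> i h) = 0"
    proof (cases "\<zeta> = \<zeta>\<^sub>0")
      case True
      then show ?thesis
        using c [OF mem [OF \<zeta>\<^sub>0, of h]] fun_vs.representation_basis [OF ind, of h] h by (simp add: \<rho>_def)
    next
      case False
      then show ?thesis
        using residue_functional_other_root [OF r nz h(1) False mem [OF h(1,2)]]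
        by (intro sum.neutral) (auto simp: \<psi>_def)
    qed
  qed
qed

theorem root_system_complete_minimal:
  assumes bas: "\<And>\<zeta>. \<Delta> \<zeta> = 0 \<Longrightarrow> fun_vs.independent (bas \<zeta>) \<and> fun_vs.span (bas \<zeta>) = root_set \<zeta>"
    and S: "S = (\<Union>\<zeta>\<in>{\<zeta>. \<Delta> \<zeta> = 0}. bas \<zeta>)"
  shows "complete_system S" "minimal_system S"
proof -
  have "bas \<zeta> \<subseteq> root_set \<zeta>" if "\<Delta> \<zeta> = 0" for \<zeta>
    using bas [OF that] fun_vs.span_superset by blast
  then have SL: "S \<subseteq> L2" unfolding S using root_set_C0 C0_L2 by blast
  show "complete_system S"
  proof (rule complete_systemI [OF SL])
    fix \<phi> and g :: "real \<Rightarrow> complex^'n"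
    assume \<phi>: "l2_functional \<phi>" "\<And>y. y \<in> fun_vs.span S \<Longrightarrow> \<phi> y = 0" and g: "g \<in> L2"
    show "\<phi> g = 0"
    proof (rule functional_zero [OF \<phi>(1) _ g])
      fix \<zeta> y assume \<zeta>: "\<Delta> \<zeta> = 0" and y: "y \<in> root_set \<zeta>"
      have "fun_vs.span (bas \<zeta>) \<subseteq> fun_vs.span S"
        using \<zeta> by (intro fun_vs.span_mono) (auto simp: S)
      then show "\<phi> y = 0" using bas [OF \<zeta>] y \<phi>(2) by blast
    qed
  qed
  show "minimal_system S"
  proof (rule minimal_systemI [OF SL])
    fix f assume "f \<in> S"
    then obtain \<zeta>\<^sub>0 where \<zeta>\<^sub>0: "\<Delta> \<zeta>\<^sub>0 = 0" "f \<in> bas \<zeta>\<^sub>0" unfolding S by blast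
    obtain \<phi> where "l2_functional \<phi>" "\<phi> f = 1" "\<And>\<zeta> h. \<Delta> \<zeta> = 0 \<Longrightarrow> h \<in> bas \<zeta> \<Longrightarrow> h \<noteq> f \<Longrightarrow> \<phi> h = 0"
      using root_system_dual [OF bas \<zeta>\<^sub>0] by blast
    then show "\<exists>\<phi>. l2_functional \<phi> \<and> \<phi> f = 1 \<and> (\<forall>h\<in>S - {f}. \<phi> h = 0)"
      unfolding S by blast
  qed
qed

end

section \<open>The operator \<open>L\<^sub>C\<^sub>,\<^sub>D(Q)\<close>\<close>

lemma L2_integrable_subinterval:
  fixes f :: "real \<Rightarrow> 'a::euclidean_space"
  assumes "f \<in> L2" "x \<in> {0..1}"
  shows "integrable (lebesgue_on {0..x}) f"
  using L2_absolutely_integrable_sub [OF assms(1), of 0 x] assms(2)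
  by (simp add: set_integrable_def integrable_restrict_space)

lemma lebesgue_integral_subinterval:
  fixes f :: "real \<Rightarrow> 'a::euclidean_space"
  assumes "f \<in> L2" "x \<in> {0..1}"
  shows "(LINT t|lebesgue_on {0..x}. f t) = integral {0..x} f"
  by (intro lebesgue_integral_eq_integral L2_integrable_subinterval assms) simp

lemma lebesgue_integral_subinterval_cong:
  fixes f g :: "real \<Rightarrow> 'a::euclidean_space"
  assumes "f \<in> L2" "g \<in> L2" "AE t in lebesgue_on {0..1}. f t = g t" "x \<in> {0..1}"
  shows "integral {0..x} f = integral {0..x} g"
proof -
  have AE: "AE t in lebesgue_on {0..x}. f t = g t"
    using assms(3,4) by (auto simp: AE_restrict_space_iff elim!: eventually_mono)
  have "(LINT t|lebesgue_on {0..x}. f t) = (LINT t|lebesgue_on {0..x}. g t)"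
    by (intro integral_cong_AE borel_measurable_integrable L2_integrable_subinterval AE assms)
  then show ?thesis
    using assms by (simp add: lebesgue_integral_subinterval)
qed

context boundary_value_problem
begin

text \<open>Both graphs contain all representatives of a value: changing it on a null set changes no
  integral. In one direction the derivative is known almost everywhere, in the other it is chosen as
  \<open>rhs\<close>.\<close>

lemma op_shift_L_op_iff:
  assumes B: "\<And>v i. (B *v v) $ i = v $ i / of_real (a i)"
  shows "op_shift (L_op B C D Q) z = rel z"
proof (intro set_eqI iffI)
  have "- \<i> * (x / of_real (a i)) = w \<longleftrightarrow> x = \<i> * of_real (a i) * w" for x w i
  proof
    assume w: "- \<i> * (x / of_real (a i)) = w"
    show "x = \<i> * of_real (a i) * w" unfolding w [symmetric] using a_nonzero [of i] by simp
  next
    assume x: "x = \<i> * of_real (a i) * w"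
    show "- \<i> * (x / of_real (a i)) = w" unfolding x using a_nonzero [of i] by simp
  qed
  then have diag: "(- \<i>) *s (B *v v) = w \<longleftrightarrow> v = (\<chi> i. \<i> * of_real (a i) * w $ i)" for v w
    by (simp only: vec_eq_iff vector_smult_component B vec_lambda_beta)
  fix p assume "p \<in> op_shift (L_op B C D Q) z"
  then obtain y F where p: "p = (y, F - fscale z y)" and yF: "(y, F) \<in> L_op B C D Q"
    unfolding op_shift_def by blast
  then obtain y' where W: "W12 y y'" and y0: "\<And>x. x \<notin> {0..1} \<Longrightarrow> y x = 0" and bc: "C *v y 0 + D *v y 1 = 0"
    and F: "F \<in> L2" and AE: "AE x in lebesgue_on {0..1}. F x = (- \<i>) *s (B *v y' x) + Q x *v y x"
    unfolding L_op_def by blast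
  have y': "y' \<in> L2" using W by (simp add: W12_def)
  have y_eq: "y x = y 0 + integral {0..x} y'" if "x \<in> {0..1}" for x
    using W that lebesgue_integral_subinterval [OF y' that] unfolding W12_def by metis
  have "continuous_on {0..1} (\<lambda>x. y 0 + integral {0..x} y')"
    using L2_integrable_on [OF y', of 0 1] by (intro continuous_intros indefinite_integral_continuous_1) simp
  then have cont: "continuous_on {0..1} y"
    by (rule continuous_on_eq) (simp add: y_eq [symmetric])
  have C: "y \<in> C0" using cont y0 by (simp add: C0_def)
  have L: "F - fscale z y \<in> L2" by (intro L2_fdiff L2_fscale F C0_L2 C)
  have "AE t in lebesgue_on {0..1}. y' t = rhs z (F - fscale z y) y t"
    using AE
  proof eventually_elim
    case (elim t)
    then have "(- \<i>) *s (B *v y' t) = F t - Q t *v y t" by simp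
    then show ?case
      unfolding diag by (simp add: rhs_def fscale_def vec_eq_iff)
  qed
  then have "integral {0..x} y' = integral {0..x} (rhs z (F - fscale z y) y)" if "x \<in> {0..1}" for x
    using that by (intro lebesgue_integral_subinterval_cong y' rhs_L2 L cont)
  then have "sol z (F - fscale z y) y"
    unfolding sol_def using C y_eq by metis
  then show "p \<in> rel z" using L bc by (simp add: p rel_def bdry_def)
next
  fix p assume "p \<in> rel z"
  then obtain y f where p: "p = (y, f)" and f: "f \<in> L2" and y: "sol z f y" and bc: "bdry y = 0"
    unfolding rel_def by blast
  have C: "y \<in> C0" by (rule sol_C0 [OF y])
  define y' where "y' = rhs z f y"
  have y': "y' \<in> L2" unfolding y'_def by (intro rhs_L2 f sol_continuous [OF y])
  have "W12 y y'"
    unfolding W12_def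
  proof (intro conjI y' ballI)
    fix x :: real assume x: "x \<in> {0..1}"
    show "y x = y 0 + (LINT t|lebesgue_on {0..x}. y' t)"
      unfolding lebesgue_integral_subinterval [OF y' x] unfolding y'_def
      using y x unfolding sol_def by blast
  qed
  moreover have "(f + fscale z y) t = (- \<i>) *s (B *v y' t) + Q t *v y t" for t
    using a_nonzero by (simp add: y'_def rhs_def fscale_def vec_eq_iff B)
  moreover have "f + fscale z y \<in> L2" by (intro L2_fplus L2_fscale f C0_L2 C)
  ultimately have "(y, f + fscale z y) \<in> L_op B C D Q"
    unfolding L_op_def using C bc by (auto simp: C0_def bdry_def)
  moreover have "f = (f + fscale z y) - fscale z y" by simp
  ultimately show "p \<in> op_shift (L_op B C D Q) z"
    unfolding op_shift_def p by blast
qed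

lemma eigenvalue_iff:
  assumes B: "\<And>v i. (B *v v) $ i = v $ i / of_real (a i)"
  shows "eigenvalue (L_op B C D Q) z \<longleftrightarrow> \<Delta> z = 0"
proof
  assume "eigenvalue (L_op B C D Q) z"
  \<comment> \<open>An operator kernel different from {0} could also be empty; this excludes that
    reading and leaves a nonzero element.\<close>
  moreover have "0 \<in> op_ker (op_shift (L_op B C D Q) z)"
    unfolding op_shift_L_op_iff [OF B] op_ker_def using rel_zero by blast
  ultimately obtain y where y: "(y, 0) \<in> rel z" "y \<noteq> 0"
    unfolding eigenvalue_def op_shift_L_op_iff [OF B] op_ker_def by blast
  show "\<Delta> z = 0"
  proof (rule ccontr)
    assume nz: "\<Delta> z \<noteq> 0"
    have "y = resolvent z 0" "0 = resolvent z 0"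
      using sol_bdry_zero_iff [OF L2_zero(1) nz] y(1) rel_zero [of z] unfolding rel_def by blast+
    then show False using y(2) by simp
  qed
next
  assume "\<Delta> z = 0"
  then obtain v where v: "char_matrix z *v v = 0" "v \<noteq> 0"
    using det_nonzero_iff_kernel [of "char_matrix z"] unfolding \<Delta>_def by blast
  have "(solve z 0 v, 0) \<in> rel z"
    using v(1) by (simp add: rel_def sol_solve bdry_solve_zero)
  moreover have "solve z 0 v \<noteq> 0"
    using v(2) solve_initial [OF L2_zero(1), of z v] by auto
  ultimately show "eigenvalue (L_op B C D Q) z"
    unfolding eigenvalue_def op_shift_L_op_iff [OF B] op_ker_def by blast
qed

lemma root_subspace_eq:
  assumes B: "\<And>v i. (B *v v) $ i = v $ i / of_real (a i)"
  shows "root_subspace (L_op B C D Q) z = root_set z"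
proof -
  have "(\<Union>k::nat. op_ker (op_shift (L_op B C D Q) z ^^ k)) = root_set z"
    unfolding op_shift_L_op_iff [OF B] op_ker_def root_set_def by blast
  then show ?thesis
    unfolding root_subspace_def by (simp add: fun_vs.span_eq_iff subspace_root_set)
qed

lemma root_system_L_op:
  assumes B: "\<And>v i. (B *v v) $ i = v $ i / of_real (a i)" and S: "root_system (L_op B C D Q) S"
  shows "complete_system S" "minimal_system S"
proof -
  obtain bas where "S = (\<Union>z\<in>{z. \<Delta> z = 0}. bas z)"
    "\<And>z. \<Delta> z = 0 \<Longrightarrow> fun_vs.independent (bas z) \<and> fun_vs.span (bas z) = root_set z"
    using S unfolding root_system_def eigenvalue_iff [OF B] root_subspace_eq [OF B] by blast
  then show "complete_system S" "minimal_system S"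
    using root_system_complete_minimal by blast+
qed

end

text \<open>The simplest domain element with prescribed boundary values interpolates them linearly.
  The value of the operator is then constant, so the inner product only sees the midpoint of
  \<open>p\<close> and \<open>q\<close>.\<close>

lemma linear_function_in_L_op:
  fixes p q :: "complex^'n" and B C D :: "complex^'n^'n"
  assumes bc: "C *v p + D *v q = 0"
  defines "y \<equiv> \<lambda>x. if x \<in> {0..1} then p + x *\<^sub>R (q - p) else 0"
  defines "f \<equiv> \<lambda>x. (- \<i>) *s (B *v (q - p))"
  shows "(y, f) \<in> L_op B C D (\<lambda>_. 0)"
    and "l2_inner f y = (\<Sum>i\<in>UNIV. - \<i> * (B *v (q - p)) $ i * cnj ((p $ i + q $ i) / 2))"
proof -
  have "W12 y (\<lambda>x. q - p)"
    unfolding W12_def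
  proof (intro conjI ballI L2_const)
    fix x :: real assume x: "x \<in> {0..1}"
    show "y x = y 0 + (LINT t|lebesgue_on {0..x}. q - p)"
      unfolding lebesgue_integral_subinterval [OF L2_const x] using x by (simp add: y_def)
  qed
  then show "(y, f) \<in> L_op B C D (\<lambda>_. 0)"
    unfolding L_op_def using bc by (auto simp: y_def f_def L2_const)
  define F where "F = (\<lambda>x. \<Sum>i\<in>UNIV. (- \<i> * (B *v (q - p)) $ i) * (cnj (p $ i) + of_real x * cnj (q $ i - p $ i)))"
  have "l2_inner f y = (LINT x|lebesgue_on {0..1}. F x)"
    unfolding l2_inner_def
    by (rule Bochner_Integration.integral_cong) (auto simp: F_def f_def y_def scaleR_conv_of_real [where 'a = complex] intro!: sum.cong)
  also have "\<dots> = integral {0..1} F"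
    unfolding F_def
    by (intro lebesgue_integral_subinterval continuous_imp_L2 continuous_intros) simp
  also have "(F has_integral (\<Sum>i\<in>UNIV. - \<i> * (B *v (q - p)) $ i * cnj ((p $ i + q $ i) / 2))) {0..1}"
    unfolding F_def
  proof (intro has_integral_sum has_integral_mult_right)
    fix i
    define u v where "u = cnj (p $ i)" and "v = cnj (q $ i - p $ i)"
    have "((\<lambda>x. u + of_real x * v) has_integral
        (of_real 1 * u + (of_real 1)\<^sup>2 / 2 * v) - (of_real 0 * u + (of_real 0)\<^sup>2 / 2 * v)) {0..1}"
      by (rule fundamental_theorem_of_calculus)
        (auto intro!: has_vector_derivative_real_field derivative_eq_intros)
    then show "((\<lambda>x. cnj (p $ i) + of_real x * cnj (q $ i - p $ i)) has_integral cnj ((p $ i + q $ i) / 2)) {0..1}"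
      by (simp add: u_def v_def field_simps)
  qed simp
  then have "integral {0..1} F = (\<Sum>i\<in>UNIV. - \<i> * (B *v (q - p)) $ i * cnj ((p $ i + q $ i) / 2))"
    by (rule integral_unique)
  finally show "l2_inner f y = (\<Sum>i\<in>UNIV. - \<i> * (B *v (q - p)) $ i * cnj ((p $ i + q $ i) / 2))" .
qed

text \<open>With boundary values y(0) and y(1) the imaginary part of the form is half of (B y(0),
  y(0)) - (B y(1), y(1)). Placing the positive and negative parts of \<open>v\<close> at opposite
  ends gives both terms the same sign.\<close>

lemma Im_form_split:
  fixes v :: "complex^'n" and a :: "'n \<Rightarrow> real"
  assumes a: "\<And>i. a i \<noteq> 0" and B: "\<And>v i. (B *v v) $ i = v $ i / of_real (a i)"
  defines "p \<equiv> \<chi> i. if 0 < a i then v $ i else 0" and "m \<equiv> \<chi> i. if a i < 0 then v $ i else 0"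
  shows "Im (\<Sum>i\<in>UNIV. - \<i> * (B *v (m - p)) $ i * cnj ((p $ i + m $ i) / 2)) = (\<Sum>i\<in>UNIV. (norm (v $ i))\<^sup>2 / (2 * \<bar>a i\<bar>))"
    and "Im (\<Sum>i\<in>UNIV. - \<i> * (B *v (p - m)) $ i * cnj ((m $ i + p $ i) / 2)) = - (\<Sum>i\<in>UNIV. (norm (v $ i))\<^sup>2 / (2 * \<bar>a i\<bar>))"
proof -
  have *: "Im (- \<i> * (c * w / of_real b) * cnj (w / 2)) = - (c' * (norm w)\<^sup>2 / (2 * b))" if "c = of_real c'" "b \<noteq> 0" for c w b c'
  proof -
    have "- \<i> * (c * w / of_real b) * cnj (w / 2) = - \<i> * of_real (c' / (2 * b)) * (w * cnj w)"
      using that by (simp add: mult_ac)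
    also have "w * cnj w = of_real ((norm w)\<^sup>2)" by (rule complex_norm_square [symmetric])
    finally show ?thesis by simp
  qed
  have "Im (- \<i> * (B *v (m - p)) $ i * cnj ((p $ i + m $ i) / 2)) = (norm (v $ i))\<^sup>2 / (2 * \<bar>a i\<bar>)" for i
    using a [of i] *[of "- 1" "- 1" "a i" "v $ i"] *[of 1 1 "a i" "v $ i"]
    by (cases "0 < a i") (simp_all add: B p_def m_def)
  then show "Im (\<Sum>i\<in>UNIV. - \<i> * (B *v (m - p)) $ i * cnj ((p $ i + m $ i) / 2)) = (\<Sum>i\<in>UNIV. (norm (v $ i))\<^sup>2 / (2 * \<bar>a i\<bar>))"
    by (simp only: Im_sum)
  have "Im (- \<i> * (B *v (p - m)) $ i * cnj ((m $ i + p $ i) / 2)) = - ((norm (v $ i))\<^sup>2 / (2 * \<bar>a i\<bar>))" for i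
    using a [of i] *[of "- 1" "- 1" "a i" "v $ i"] *[of 1 1 "a i" "v $ i"]
    by (cases "0 < a i") (simp_all add: B p_def m_def)
  then show "Im (\<Sum>i\<in>UNIV. - \<i> * (B *v (p - m)) $ i * cnj ((m $ i + p $ i) / 2)) = - (\<Sum>i\<in>UNIV. (norm (v $ i))\<^sup>2 / (2 * \<bar>a i\<bar>))"
    by (simp only: Im_sum sum_negf)
qed

lemma weighted_sum_pos:
  fixes v :: "complex^'n" and a :: "'n \<Rightarrow> real"
  assumes a: "\<And>i. a i \<noteq> 0" and le: "(\<Sum>i\<in>UNIV. (norm (v $ i))\<^sup>2 / (2 * \<bar>a i\<bar>)) \<le> 0"
  shows "v = 0"
proof -
  have "(\<Sum>i\<in>UNIV. (norm (v $ i))\<^sup>2 / (2 * \<bar>a i\<bar>)) = 0"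
    using le by (intro antisym sum_nonneg) auto
  then have "\<forall>i\<in>UNIV. (norm (v $ i))\<^sup>2 / (2 * \<bar>a i\<bar>) = 0"
    by (subst (asm) sum_nonneg_eq_0_iff) auto
  then show ?thesis using a by (simp add: vec_eq_iff)
qed

theorem corollary4p3:
  fixes r :: nat and b :: "nat \<Rightarrow> complex" and blk :: "'n::{finite,linorder} \<Rightarrow> nat"
    and B C D :: "((complex, 'n) vec, 'n) vec"
  assumes b_nonzero: "\<And>j. j \<in> {1..r} \<Longrightarrow> b j \<noteq> 0"
    and b_distinct: "inj_on b {1..r}"
    and blocks: "range blk = {1..r}" "mono blk"
    and B_def: "B = block_diag b blk"
    and B_selfadjoint: "B = conj_transpose B"
    and rank_CD: "rank (hjoin C D) = CARD('n)"
    and acc_or_diss: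
      "(accumulative (L_op B C D (\<lambda>_. 0)) \<and> det (T_minus B C D) \<noteq> 0) \<or>
       (dissipative (L_op B C D (\<lambda>_. 0)) \<and> det (T_plus B C D) \<noteq> 0)"
  shows "det (T_plus B C D) \<noteq> 0 \<and> det (T_minus B C D) \<noteq> 0 \<and>
    (\<forall>Q\<in>L2. \<forall>S. root_system (L_op B C D Q) S \<longrightarrow> complete_system S \<and> minimal_system S)"
proof -
  \<comment> \<open>Selfadjointness makes the numbers b real, so these are the reciprocals of the
    diagonal entries of \<open>B\<close>; their signs decide the spectral projectors.\<close>
  define a where "a = (\<lambda>i. Re (b (blk i)))"
  have b_nz: "b (blk i) \<noteq> 0" for i
    using b_nonzero [of "blk i"] blocks(1) by blast
  have "inverse (b (blk i)) = cnj (inverse (b (blk i)))" for i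
    using arg_cong [OF B_selfadjoint, of "\<lambda>M. M $ i $ i"] by (simp add: B_def block_diag_def conj_transpose_def)
  then have "b (blk i) = cnj (b (blk i))" for i
    by (metis complex_cnj_inverse inverse_inverse_eq)
  then have b_eq: "b (blk i) = of_real (a i)" for i
    unfolding a_def by (metis Reals_cnj_iff of_real_Re)
  have a: "a i \<noteq> 0" for i using b_nz [of i] by (simp add: b_eq)
  have B: "(B *v v) $ i = v $ i / of_real (a i)" for v i
  proof -
    have "(B *v v) $ i = inverse (of_real (a i)) * v $ i"
      by (simp add: B_def block_diag_def matrix_vector_mult_def b_eq if_distrib [of "\<lambda>x. x * _"] cong: if_cong)
    then show ?thesis by (simp add: divide_inverse mult.commute)
  qed
  define P M where "P = (\<lambda>v :: (complex, 'n) vec. \<chi> i. if 0 < a i then v $ i else 0)"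
    and "M = (\<lambda>v :: (complex, 'n) vec. \<chi> i. if a i < 0 then v $ i else 0)"
  have mem: "complex_of_real x \<in> of_real ` A \<longleftrightarrow> x \<in> A" for x A by auto
  have inv_pos: "inverse (b (blk i)) \<in> of_real ` {0<..} \<longleftrightarrow> 0 < a i"
    and inv_neg: "inverse (b (blk i)) \<in> of_real ` {..<0} \<longleftrightarrow> a i < 0" for i
    unfolding b_eq of_real_inverse [symmetric] mem by simp_all
  have proj: "proj_pos B *v v = P v" "proj_neg B *v v = M v" for v
    unfolding proj_pos_def proj_neg_def B_def block_diag_def spectral_projector_diag
    by (simp_all add: inv_pos inv_neg P_def M_def vec_eq_iff matrix_vector_mult_def if_distrib [of "\<lambda>x. x * _"] cong: if_cong)
  have Tp: "T_plus B C D *v v = C *v P v + D *v M v" and Tm: "T_minus B C D *v v = C *v M v + D *v P v" for v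
    by (simp_all add: T_plus_def T_minus_def matrix_vector_mult_add_rdistrib matrix_vector_mul_assoc [symmetric] proj)
  have "det (T_plus B C D) \<noteq> 0" if acc: "accumulative (L_op B C D (\<lambda>_. 0))"
    unfolding det_nonzero_iff_kernel
  proof (intro allI impI)
    \<comment> \<open>A kernel vector supplies an element of the domain with boundary values
      \<open>P v\<close> and \<open>M v\<close>, on which the form is nonnegative; accumulativity
      then forces it to vanish and with it \<open>v\<close>.\<close>
    fix v assume "T_plus B C D *v v = 0"
    then have "C *v P v + D *v M v = 0" by (simp add: Tp)
    note lin = linear_function_in_L_op [OF this, of B]
    have "Im (\<Sum>i\<in>UNIV. - \<i> * (B *v (M v - P v)) $ i * cnj ((P v $ i + M v $ i) / 2)) \<le> 0"
      using acc lin(1) unfolding accumulative_def lin(2) [symmetric] by blast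
    then show "v = 0"
      using Im_form_split(1) [OF a B, of v] by (intro weighted_sum_pos [OF a]) (simp add: P_def M_def)
  qed
  moreover have "det (T_minus B C D) \<noteq> 0" if diss: "dissipative (L_op B C D (\<lambda>_. 0))"
    unfolding det_nonzero_iff_kernel
  proof (intro allI impI)
    fix v assume "T_minus B C D *v v = 0"
    then have "C *v M v + D *v P v = 0" by (simp add: Tm)
    note lin = linear_function_in_L_op [OF this, of B]
    have "0 \<le> Im (\<Sum>i\<in>UNIV. - \<i> * (B *v (P v - M v)) $ i * cnj ((M v $ i + P v $ i) / 2))"
      using diss lin(1) unfolding dissipative_def lin(2) [symmetric] by blast
    then show "v = 0"
      using Im_form_split(2) [OF a B, of v] by (intro weighted_sum_pos [OF a]) (simp add: P_def M_def)
  qed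
  ultimately have det: "det (T_plus B C D) \<noteq> 0" "det (T_minus B C D) \<noteq> 0"
    using acc_or_diss by blast+
  have "complete_system S \<and> minimal_system S"
    if Q: "Q \<in> L2" and S: "root_system (L_op B C D Q) S" for Q S
  proof -
    \<comment> \<open>Since no \<open>a i\<close> is zero, the complement of one sign condition is
      the other one, which matches the locale assumptions with T_+ and T_-.\<close>
    have not_pos: "(\<chi> i. if 0 < a i then 0 else v $ i) = M v" and not_neg: "(\<chi> i. if a i < 0 then 0 else v $ i) = P v"
      for v :: "(complex, 'n) vec"
      using a by (auto simp: P_def M_def vec_eq_iff not_less order_le_less)
    interpret boundary_value_problem a Q C D
    proof
      fix v
      show "v = 0" if "C *v (\<chi> i. if 0 < a i then v $ i else 0) + D *v (\<chi> i. if 0 < a i then 0 else v $ i) = 0"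
        using that det(1) Tp [of v] unfolding det_nonzero_iff_kernel not_pos P_def by metis
      show "v = 0" if "C *v (\<chi> i. if a i < 0 then v $ i else 0) + D *v (\<chi> i. if a i < 0 then 0 else v $ i) = 0"
        using that det(2) Tm [of v] unfolding det_nonzero_iff_kernel not_neg M_def by metis
    qed (use a Q in auto)
    show ?thesis using root_system_L_op [OF B S] by blast
  qed
  with det show ?thesis by blast
qed

end
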